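(* The class $\mathcal{K}$ of finite diversities, viewed as relational metric structures, satisfies HP, JEP, bAP, PP and CP, and is therefore a Fraïssé class with an ultrahomogeneous limit.
   Context: **Diversities.** A diversity is a pair $(X,\delta)$ where $X$ is a set and $\delta$ maps finite subsets of $X$ to $\mathbb{R}$ such that, for all finite $A,B,C\subseteq X$: (D1) $\delta(A)\ge0$, and $\delta(A)=0$ if and only if $|A|\le1$; (D2) if $B\ne\emptyset$ then $\delta(A\cup B)+\delta(B\cup C)\ge\delta(A\cup C)$. Its induced metric is $d(x,y)=\delta(\{x,y\})$. A diversity is viewed as a relational metric structure with metric $d$ and one $k$-ary predicate $\delta_k$ for each $k\ge1$, given by $\delta_k(x_1,\dots,x_k)=\delta(\{x_1,\dots,x_k\})$. It is finite if $X$ is finite. **Structures.** A relational language $\mathcal{L}$ is a collection of predicate symbols with finite arities, including a distinguished binary symbol $d$. An $\mathcal{L}$-structure $\mathfrak{A}$ is a complete metric space $(A,d)$ together with, for each $n$-ary $R\in\mathcal{L}$, a uniformly continuous function $R^{\mathfrak{A}}\colon A^n\to\mathbb{R}$ ($d$ being interpreted by the metric). An embedding is a map preserving the values of all predicates (hence isometric). $\mathfrak{A}$ is a substructure of $\mathfrak{B}$ if there is an embedding $\mathfrak{A}\to\mathfrak{B}$. An isomorphism is a surjective embedding; an automorphism is an isomorphism from a structure to itself. A separable structure $\mathfrak{M}$ is ultrahomogeneous if every embedding $A_0\to M$ with $A_0\subseteq M$ finite extends to an automorphism of $\mathfrak{M}$. **Properties of a class $\mathcal{K}$ of finite structures.**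 A $\mathcal{K}$-structure is an $\mathcal{L}$-structure all of whose finite substructures are in $\mathcal{K}$. - HP: all members of $\mathcal{K}$ are $\mathcal{K}$-structures. - JEP: every two structures in $\mathcal{K}$ embed into a third one in $\mathcal{K}$. - AP: for all $\mathfrak{A},\mathfrak{B},\mathfrak{C}\in\mathcal{K}$ and embeddings $f_B\colon\mathfrak{A}\to\mathfrak{B}$, $f_C\colon\mathfrak{A}\to\mathfrak{C}$ there are $\mathfrak{D}\in\mathcal{K}$ and embeddings $g_B\colon\mathfrak{B}\to\mathfrak{D}$, $g_C\colon\mathfrak{C}\to\mathfrak{D}$ with $g_B\circ f_B=g_C\circ f_C$. $\mathcal{K}_n$ is the set of enumerated structures of length $n$: all $n$-tuples $\bar a$ (repetitions allowed) of elements of some structure in $\mathcal{K}$; an embedding of $\bar a$ is a map on its entries preserving all predicate values. For $\bar a,\bar b\in\mathcal{K}_n$, $$d_{\mathcal{K}}(\bar a,\bar b)=\inf_{\bar a',\bar b'}\max_i d(a_i',b_i'),$$ over images $\bar a',\bar b'$ of $\bar a,\bar b$ under embeddings into a common structure in $\mathcal{K}$; and $$d_\infty(\bar a,\bar b)=\max_{m\le n}\ \max_{X\subseteq\{1,\dots,n\},\,|X|=m,\ R\text{ of arity }m}|R(\bar a_X)-R(\bar b_X)|,$$ where $R$ ranges over the predicates including $d$ and $\bar a_X$ is the subtuple indexed by $X$. - PP: for every $n$, $\mathcal{K}_n$ is separable and complete under the pseudometric $d_{\mathcal{K}}$. - CP: for every $n$-ary predicate $P$, the map $\mathcal{K}_n\to\mathbb{R}$,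 $\bar a\mapsto P(\bar a)$, is continuous with respect to $d_{\mathcal{K}}$. - bAP: for each $n$ there is a constant $c$ depending only on $n$ such that if $(\bar a,w)$ and $(\bar a,z)$ are enumerated structures in $\mathcal{K}_n$ with common substructure $\bar a$, then there is an amalgamation $B=(\bar a,w,z)$ in $\mathcal{K}_{n+1}$ (its subtuples $(\bar a,w)$, $(\bar a,z)$ carry the given predicate values) with $d_B(w,z)\le c\,d_\infty((\bar a,w),(\bar a,z))$. **Fraïssé classes and limits.** $\mathcal{K}$ is a Fraïssé class if it satisfies HP, JEP, AP, PP and CP. Its limit is the (unique up to isomorphism) separable $\mathcal{K}$-structure $\mathfrak{M}$ with the approximate extension property: for every finite $\mathcal{K}$-structure $\mathfrak{B}$, finite (possibly empty) tuple $\bar a$ of elements of $B$, embedding $h\colon\bar a\to\mathfrak{M}$ and $\epsilon>0$, there is an embedding $f\colon\mathfrak{B}\to\mathfrak{M}$ with $\max_i d(f(a_i),h(a_i))<\epsilon$. *)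

theory Defs
  imports "HOL-Analysis.Analysis"
begin

section \<open>Relational metric structures\<close>

text \<open>
  A language is given by a type \<open>'r\<close> of predicate symbols other than the distinguished binary
  symbol, together with their arities \<open>ar :: 'r \<Rightarrow> nat\<close>. The distinguished symbol \<open>Dist\<close> is always
  interpreted by the metric.
\<close>

datatype 'r symbol = Dist | Pred 'r

primrec arity :: "('r \<Rightarrow> nat) \<Rightarrow> 'r symbol \<Rightarrow> nat" where
  "arity ar Dist = 2"
| "arity ar (Pred r) = ar r"

record ('a, 'r) mstructure =
  met :: "'a metric"
  rel :: "'r \<Rightarrow> 'a list \<Rightarrow> real"

abbreviation univ :: "('a, 'r) mstructure \<Rightarrow> 'a set" where
  "univ A \<equiv> mspace (met A)"

abbreviation sdist :: "('a, 'r) mstructure \<Rightarrow> 'a \<Rightarrow> 'a \<Rightarrow> real" where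
  "sdist A \<equiv> mdist (met A)"

primrec interp :: "('a, 'r) mstructure \<Rightarrow> 'r symbol \<Rightarrow> 'a list \<Rightarrow> real" where
  "interp A Dist xs = sdist A (xs ! 0) (xs ! 1)"
| "interp A (Pred r) xs = rel A r xs"

definition tuples :: "'a set \<Rightarrow> nat \<Rightarrow> 'a list set" where
  "tuples S n = {xs. set xs \<subseteq> S \<and> length xs = n}"

text \<open>
  Only the values of \<open>rel A r\<close> on \<open>tuples (univ A) (ar r)\<close> are meaningful; everything below ignores
  the remaining ones.
\<close>

definition is_structure :: "('r \<Rightarrow> nat) \<Rightarrow> ('a, 'r) mstructure \<Rightarrow> bool" where
  "is_structure ar A \<longleftrightarrow>
     mcomplete_of (met A) \<and>
     (\<forall>r. \<forall>\<epsilon>>0. \<exists>\<eta>>0. \<forall>xs\<in>tuples (univ A) (ar r). \<forall>ys\<in>tuples (univ A) (ar r).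
        (\<forall>i<ar r. sdist A (xs ! i) (ys ! i) < \<eta>) \<longrightarrow> \<bar>rel A r xs - rel A r ys\<bar> < \<epsilon>)"

definition is_separable :: "('a, 'r) mstructure \<Rightarrow> bool" where
  "is_separable A \<longleftrightarrow> separable_space (mtopology_of (met A))"

definition embedding ::
  "('r \<Rightarrow> nat) \<Rightarrow> ('a \<Rightarrow> 'b) \<Rightarrow> ('a, 'r) mstructure \<Rightarrow> ('b, 'r) mstructure \<Rightarrow> bool" where
  "embedding ar f A B \<longleftrightarrow>
     f ` univ A \<subseteq> univ B \<and>
     (\<forall>s. \<forall>xs\<in>tuples (univ A) (arity ar s). interp B s (map f xs) = interp A s xs)"

definition substructure ::
  "('r \<Rightarrow> nat) \<Rightarrow> ('a, 'r) mstructure \<Rightarrow> ('b, 'r) mstructure \<Rightarrow> bool" where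
  "substructure ar A B \<longleftrightarrow> (\<exists>f. embedding ar f A B)"

definition isomorphism ::
  "('r \<Rightarrow> nat) \<Rightarrow> ('a \<Rightarrow> 'b) \<Rightarrow> ('a, 'r) mstructure \<Rightarrow> ('b, 'r) mstructure \<Rightarrow> bool" where
  "isomorphism ar f A B \<longleftrightarrow> embedding ar f A B \<and> f ` univ A = univ B"

definition isomorphic ::
  "('r \<Rightarrow> nat) \<Rightarrow> ('a, 'r) mstructure \<Rightarrow> ('b, 'r) mstructure \<Rightarrow> bool" where
  "isomorphic ar A B \<longleftrightarrow> (\<exists>f. isomorphism ar f A B)"

abbreviation automorphism :: "('r \<Rightarrow> nat) \<Rightarrow> ('a \<Rightarrow> 'a) \<Rightarrow> ('a, 'r) mstructure \<Rightarrow> bool" where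
  "automorphism ar f A \<equiv> isomorphism ar f A A"

definition induced :: "('a, 'r) mstructure \<Rightarrow> 'a set \<Rightarrow> ('a, 'r) mstructure" where
  "induced A S = A\<lparr>met := submetric (met A) S\<rparr>"

definition ultrahomogeneous :: "('r \<Rightarrow> nat) \<Rightarrow> ('a, 'r) mstructure \<Rightarrow> bool" where
  "ultrahomogeneous ar M \<longleftrightarrow>
     is_structure ar M \<and> is_separable M \<and>
     (\<forall>S h. finite S \<and> S \<subseteq> univ M \<and> embedding ar h (induced M S) M \<longrightarrow>
        (\<exists>g. automorphism ar g M \<and> (\<forall>x\<in>S. g x = h x)))"


section \<open>Properties of classes of finite structures\<close>

text \<open>
  A class \<open>K\<close> of finite structures has type \<open>('a, 'r) mstructure set\<close>. If \<open>'a\<close> is infinite, then every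
  finite structure has an isomorphic copy with elements in \<open>'a\<close>, so fixing \<open>'a\<close> loses nothing.
  The type of elements of a \<open>K\<close>-structure may be different from \<open>'a\<close>.
\<close>

definition K_structure ::
  "('r \<Rightarrow> nat) \<Rightarrow> ('a, 'r) mstructure set \<Rightarrow> ('b, 'r) mstructure \<Rightarrow> bool" where
  "K_structure ar K M \<longleftrightarrow>
     is_structure ar M \<and>
     (\<forall>A :: ('a, 'r) mstructure.
        is_structure ar A \<and> finite (univ A) \<and> substructure ar A M \<longrightarrow> A \<in> K)"

definition HP :: "('r \<Rightarrow> nat) \<Rightarrow> ('a, 'r) mstructure set \<Rightarrow> bool" where
  "HP ar K \<longleftrightarrow> (\<forall>A\<in>K. K_structure ar K A)"

definition JEP :: "('r \<Rightarrow> nat) \<Rightarrow> ('a, 'r) mstructure set \<Rightarrow> bool" where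
  "JEP ar K \<longleftrightarrow>
     (\<forall>A\<in>K. \<forall>B\<in>K. \<exists>C\<in>K. (\<exists>f. embedding ar f A C) \<and> (\<exists>g. embedding ar g B C))"

definition AP :: "('r \<Rightarrow> nat) \<Rightarrow> ('a, 'r) mstructure set \<Rightarrow> bool" where
  "AP ar K \<longleftrightarrow>
     (\<forall>A\<in>K. \<forall>B\<in>K. \<forall>C\<in>K. \<forall>fB fC. embedding ar fB A B \<and> embedding ar fC A C \<longrightarrow>
        (\<exists>D\<in>K. \<exists>gB gC. embedding ar gB B D \<and> embedding ar gC C D \<and>
           (\<forall>x\<in>univ A. gB (fB x) = gC (fC x))))"

text \<open>
  An enumerated structure is a pair of a structure and a list of elements of it; it stands for the
  structure induced on the entries of the list.
\<close>

type_synonym ('a, 'r) enumerated = "('a, 'r) mstructure \<times> 'a list"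

definition enumerated_structures ::
  "('a, 'r) mstructure set \<Rightarrow> nat \<Rightarrow> ('a, 'r) enumerated set" where
  "enumerated_structures K n = {(A, as). A \<in> K \<and> as \<in> tuples (univ A) n}"

definition value_at :: "'r symbol \<Rightarrow> ('a, 'r) enumerated \<Rightarrow> real" where
  "value_at s a = interp (fst a) s (snd a)"

definition enum_embedding ::
  "('r \<Rightarrow> nat) \<Rightarrow> ('a \<Rightarrow> 'b) \<Rightarrow> ('a, 'r) enumerated \<Rightarrow> ('b, 'r) mstructure \<Rightarrow> bool" where
  "enum_embedding ar f a C \<longleftrightarrow> embedding ar f (induced (fst a) (set (snd a))) C"

text \<open>The zero inserted below is the value of the maximum for empty tuples.\<close>

definition tuple_dist :: "('a, 'r) mstructure \<Rightarrow> 'a list \<Rightarrow> 'a list \<Rightarrow> real" where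
  "tuple_dist C xs ys = Max (insert 0 ((\<lambda>i. sdist C (xs ! i) (ys ! i)) ` {..<length xs}))"

definition dK ::
  "('r \<Rightarrow> nat) \<Rightarrow> ('a, 'r) mstructure set \<Rightarrow> ('a, 'r) enumerated \<Rightarrow> ('a, 'r) enumerated \<Rightarrow> real"
  where
  "dK ar K a b =
     Inf {tuple_dist C (map f (snd a)) (map g (snd b)) | C f g.
            C \<in> K \<and> enum_embedding ar f a C \<and> enum_embedding ar g b C}"

text \<open>
  The supremum is a maximum whenever there are finitely many predicates of each arity, as is the case
  for diversities. Indices start at 0.
\<close>

definition dinf ::
  "('r \<Rightarrow> nat) \<Rightarrow> ('a, 'r) enumerated \<Rightarrow> ('a, 'r) enumerated \<Rightarrow> real" where
  "dinf ar a b =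
     Sup (insert 0 {\<bar>interp (fst a) s (nths (snd a) X) - interp (fst b) s (nths (snd b) X)\<bar> | s X.
            X \<subseteq> {..<length (snd a)} \<and> card X = arity ar s})"

definition PP :: "('r \<Rightarrow> nat) \<Rightarrow> ('a, 'r) mstructure set \<Rightarrow> bool" where
  "PP ar K \<longleftrightarrow> (\<forall>n.
     (\<exists>Q. countable Q \<and> Q \<subseteq> enumerated_structures K n \<and>
        (\<forall>a\<in>enumerated_structures K n. \<forall>\<epsilon>>0. \<exists>q\<in>Q. dK ar K a q < \<epsilon>)) \<and>
     (\<forall>\<sigma> :: nat \<Rightarrow> ('a, 'r) enumerated.
        (\<forall>k. \<sigma> k \<in> enumerated_structures K n) \<and>
        (\<forall>\<epsilon>>0. \<exists>N. \<forall>j\<ge>N. \<forall>k\<ge>N. dK ar K (\<sigma> j) (\<sigma> k) < \<epsilon>) \<longrightarrow>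
        (\<exists>a\<in>enumerated_structures K n. (\<lambda>k. dK ar K (\<sigma> k) a) \<longlonglongrightarrow> 0)))"

definition CP :: "('r \<Rightarrow> nat) \<Rightarrow> ('a, 'r) mstructure set \<Rightarrow> bool" where
  "CP ar K \<longleftrightarrow>
     (\<forall>s. \<forall>a\<in>enumerated_structures K (arity ar s). \<forall>\<epsilon>>0. \<exists>\<eta>>0.
        \<forall>b\<in>enumerated_structures K (arity ar s).
          dK ar K a b < \<eta> \<longrightarrow> \<bar>value_at s a - value_at s b\<bar> < \<epsilon>)"

text \<open>
  The common substructure is presented by its copies \<open>as\<close> and \<open>bs\<close> in the two structures, matched by
  \<open>h\<close>. The amalgamation is the tuple \<open>map f as @ [f w, g z]\<close> in \<open>D\<close>.
\<close>

definition bAP :: "('r \<Rightarrow> nat) \<Rightarrow> ('a, 'r) mstructure set \<Rightarrow> bool" where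
  "bAP ar K \<longleftrightarrow> (\<forall>n. \<exists>c :: real. \<forall>A B as bs w z.
     (A, as @ [w]) \<in> enumerated_structures K n \<and>
     (B, bs @ [z]) \<in> enumerated_structures K n \<and>
     (\<exists>h. enum_embedding ar h (A, as) B \<and> map h as = bs) \<longrightarrow>
     (\<exists>D f g.
        (D, map f as @ [f w, g z]) \<in> enumerated_structures K (Suc n) \<and>
        enum_embedding ar f (A, as @ [w]) D \<and>
        enum_embedding ar g (B, bs @ [z]) D \<and>
        map f as = map g bs \<and>
        sdist D (f w) (g z) \<le> c * dinf ar (A, as @ [w]) (B, bs @ [z])))"

definition fraisse_class :: "('r \<Rightarrow> nat) \<Rightarrow> ('a, 'r) mstructure set \<Rightarrow> bool" where
  "fraisse_class ar K \<longleftrightarrow> HP ar K \<and> JEP ar K \<and> AP ar K \<and> PP ar K \<and> CP ar K"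

definition fraisse_limit ::
  "('r \<Rightarrow> nat) \<Rightarrow> ('a, 'r) mstructure set \<Rightarrow> ('b, 'r) mstructure \<Rightarrow> bool" where
  "fraisse_limit ar K M \<longleftrightarrow>
     K_structure ar K M \<and> is_separable M \<and>
     (\<forall>(B :: ('a, 'r) mstructure) as h \<epsilon>.
        finite (univ B) \<and> K_structure ar K B \<and> set as \<subseteq> univ B \<and>
        enum_embedding ar h (B, as) M \<and> \<epsilon> > 0 \<longrightarrow>
        (\<exists>f. embedding ar f B M \<and> (\<forall>x\<in>set as. sdist M (f x) (h x) < \<epsilon>)))"


section \<open>Diversities\<close>

definition diversity :: "'a set \<Rightarrow> ('a set \<Rightarrow> real) \<Rightarrow> bool" where
  "diversity X \<delta> \<longleftrightarrow>
     (\<forall>A. finite A \<and> A \<subseteq> X \<longrightarrow> 0 \<le> \<delta> A \<and> (\<delta> A = 0 \<longleftrightarrow> card A \<le> 1)) \<and>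
     (\<forall>A B C. finite A \<and> A \<subseteq> X \<and> finite B \<and> B \<subseteq> X \<and> finite C \<and> C \<subseteq> X \<and> B \<noteq> {} \<longrightarrow>
        \<delta> (A \<union> C) \<le> \<delta> (A \<union> B) + \<delta> (B \<union> C))"

text \<open>
  In the language of diversities the symbols are the natural numbers with arities \<^term>\<open>Suc\<close>: the
  symbol \<open>k\<close> stands for \<open>\<delta>\<close> on \<open>(k + 1)\<close>-tuples, so that the arities range over the positive
  integers.
\<close>

definition diversity_structure :: "('a, nat) mstructure \<Rightarrow> bool" where
  "diversity_structure A \<longleftrightarrow>
     (\<exists>\<delta>. diversity (univ A) \<delta> \<and>
          (\<forall>x\<in>univ A. \<forall>y\<in>univ A. sdist A x y = \<delta> {x, y}) \<and>
          (\<forall>k. \<forall>xs\<in>tuples (univ A) (Suc k). rel A k xs = \<delta> (set xs)))"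

definition finite_diversities :: "('a, nat) mstructure set" where
  "finite_diversities = {A. finite (univ A) \<and> diversity_structure A}"

end

theory Submission
  imports Defs
begin

text \<open>
  Allow distinct points at distance zero, and a diversity becomes a function on finite sets that
  vanishes on the empty set and on singletons, is monotone, and is subadditive on pairs of sets that
  meet (\<open>pseudodiversity\<close>). In this form the axioms pass to subsets, pullbacks, maxima and pointwise
  limits. Adding one new point to a finite set \<open>S\<close> amounts to a function \<open>\<phi>\<close> on the subsets of \<open>S\<close>,
  where \<open>\<phi> T\<close> is the value of \<open>T\<close> together with the new point (\<open>one_point_extension\<close>).

  Everything rests on one construction (\<open>one_point_extension_insert\<close>). Let \<open>\<phi>\<close> and \<open>\<psi>\<close> be two
  one-point extensions of the same finite set \<open>A\<close>, by points \<open>w\<close> and \<open>z\<close>. The set \<open>T \<union> {w, z}\<close> receives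
  the least value that the axioms permit, namely the maximum over all \<open>U \<subseteq> A\<close> of
  \<open>\<phi> (T \<union> U) - \<psi> U\<close> and \<open>\<psi> (T \<union> U) - \<phi> U\<close>, and this is again a diversity. For empty \<open>T\<close> it says that the
  distance of \<open>w\<close> and \<open>z\<close> is the maximum of \<open>\<bar>\<phi> - \<psi>\<bar>\<close>, so bAP holds with constant 1. Adding points one
  at a time extends \<open>\<phi>\<close> from \<open>S\<close> to any larger finite set (\<open>one_point_extension_extend\<close>) and amalgamates
  finite diversities (\<open>pseudodiversity_amalgam\<close>); this gives AP, and JEP over the empty structure.

  For PP and CP, an \<open>n\<close>-tuple is regarded as a pseudodiversity on the index set \<open>{..<n}\<close>, that is, as a
  vector of finitely many reals. Diversities are Lipschitz for their metric, so the coordinates of two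
  tuples differ by at most \<open>n\<close> times their distance (\<open>index_values_near\<close>). Conversely the distance is
  at most twice the largest difference of coordinates (\<open>dK_le\<close>): both pseudodiversities are close to
  their maximum, where a two-layer amalgam is easy to write down. Hence separability and completeness
  are inherited from finite-dimensional space, and the predicates are continuous.

  For the limit, a pseudodiversity on the natural numbers is built point by point so that every
  one-point extension of every finite subset is realized approximately
  (\<open>countable_universal_pseudodiversity\<close>). Its completion keeps this approximate property. In a complete
  diversity approximate realizations can be corrected to exact ones: bounded amalgamation makes each
  correction as small as the error it removes, so the successive realizations form a Cauchy sequence
  (\<open>extension_property_complete\<close>). Two complete separable diversities with the exact property are
  isomorphic over any finite partial isomorphism: back and forth yields a partial isomorphism with dense
  domain and dense range, and its closure is an isomorphism (\<open>back_and_forth\<close>). This shows both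
  ultrahomogeneity and uniqueness, since every limit of the class has the approximate property
  (\<open>fraisse_limit_approximate_extension\<close>).
\<close>

section \<open>Pseudodiversities\<close>

definition pseudodiversity :: "'c set \<Rightarrow> ('c set \<Rightarrow> real) \<Rightarrow> bool" where
  "pseudodiversity X \<delta> \<longleftrightarrow>
     \<delta> {} = 0 \<and> (\<forall>x\<in>X. \<delta> {x} = 0) \<and>
     (\<forall>S T. finite T \<and> T \<subseteq> X \<and> S \<subseteq> T \<longrightarrow> \<delta> S \<le> \<delta> T) \<and>
     (\<forall>S T. finite S \<and> S \<subseteq> X \<and> finite T \<and> T \<subseteq> X \<and> S \<inter> T \<noteq> {} \<longrightarrow> \<delta> (S \<union> T) \<le> \<delta> S + \<delta> T)"

lemma pseudodiversity_empty: "pseudodiversity X \<delta> \<Longrightarrow> \<delta> {} = 0"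
  and pseudodiversity_singleton: "pseudodiversity X \<delta> \<Longrightarrow> x \<in> X \<Longrightarrow> \<delta> {x} = 0"
  and pseudodiversity_mono:
    "pseudodiversity X \<delta> \<Longrightarrow> finite T \<Longrightarrow> T \<subseteq> X \<Longrightarrow> S \<subseteq> T \<Longrightarrow> \<delta> S \<le> \<delta> T"
  and pseudodiversity_Un:
    "pseudodiversity X \<delta> \<Longrightarrow> finite S \<Longrightarrow> S \<subseteq> X \<Longrightarrow> finite T \<Longrightarrow> T \<subseteq> X \<Longrightarrow> S \<inter> T \<noteq> {} \<Longrightarrow>
       \<delta> (S \<union> T) \<le> \<delta> S + \<delta> T"
  unfolding pseudodiversity_def by blast+

lemma pseudodiversity_nonneg:
  assumes "pseudodiversity X \<delta>" "finite T" "T \<subseteq> X"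
  shows "0 \<le> \<delta> T"
  using pseudodiversity_mono[OF assms, of "{}"] pseudodiversity_empty[OF assms(1)] by simp

lemma pseudodiversity_subset: "pseudodiversity X \<delta> \<Longrightarrow> Y \<subseteq> X \<Longrightarrow> pseudodiversity Y \<delta>"
  unfolding pseudodiversity_def by (meson subset_trans subsetD)

lemma pseudodiversity_cong:
  assumes "pseudodiversity X \<delta>" "\<And>T. finite T \<Longrightarrow> T \<subseteq> X \<Longrightarrow> \<delta>' T = \<delta> T"
  shows "pseudodiversity X \<delta>'"
proof -
  have "\<delta>' S \<le> \<delta>' T" if "finite T" "T \<subseteq> X" "S \<subseteq> T" for S T
    using pseudodiversity_mono[OF assms(1) that] assms(2)[of S] assms(2)[of T] that
    by (metis finite_subset subset_trans)
  moreover have "\<delta>' (S \<union> T) \<le> \<delta>' S + \<delta>' T"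
    if "finite S" "S \<subseteq> X" "finite T" "T \<subseteq> X" "S \<inter> T \<noteq> {}" for S T
    using pseudodiversity_Un[OF assms(1) that] assms(2)[of S] assms(2)[of T]
      assms(2)[of "S \<union> T"] that by simp
  moreover have "\<delta>' {} = 0" "\<forall>x\<in>X. \<delta>' {x} = 0"
    using assms(2)[of "{}"] assms(2) pseudodiversity_empty[OF assms(1)]
      pseudodiversity_singleton[OF assms(1)] by simp_all
  ultimately show ?thesis
    unfolding pseudodiversity_def by blast
qed

lemma pseudodiversity_pullback:
  assumes "pseudodiversity Y \<delta>" "f ` X \<subseteq> Y"
  shows "pseudodiversity X (\<lambda>T. \<delta> (f ` T))"
  unfolding pseudodiversity_def
proof (intro conjI allI impI ballI)
  show "\<delta> (f ` {}) = 0"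
    using pseudodiversity_empty[OF assms(1)] by simp
  show "\<delta> (f ` {x}) = 0" if "x \<in> X" for x
    using pseudodiversity_singleton[OF assms(1), of "f x"] assms(2) that by auto
  show "\<delta> (f ` S) \<le> \<delta> (f ` T)" if "finite T \<and> T \<subseteq> X \<and> S \<subseteq> T" for S T
    using that assms(2) by (intro pseudodiversity_mono[OF assms(1)]) auto
  show "\<delta> (f ` (S \<union> T)) \<le> \<delta> (f ` S) + \<delta> (f ` T)"
    if "finite S \<and> S \<subseteq> X \<and> finite T \<and> T \<subseteq> X \<and> S \<inter> T \<noteq> {}" for S T
    unfolding image_Un using that assms(2) by (intro pseudodiversity_Un[OF assms(1)]) auto
qed

lemma pseudodiversity_triangle:
  assumes "pseudodiversity X \<delta>" "x \<in> X" "y \<in> X" "z \<in> X"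
  shows "\<delta> {x, z} \<le> \<delta> {x, y} + \<delta> {y, z}"
proof -
  have "\<delta> {x, z} \<le> \<delta> ({x, y} \<union> {y, z})"
    using assms by (intro pseudodiversity_mono[OF assms(1)]) auto
  also have "\<dots> \<le> \<delta> {x, y} + \<delta> {y, z}"
    using assms by (intro pseudodiversity_Un[OF assms(1)]) auto
  finally show ?thesis .
qed

text \<open>
  The triangle inequality with a singleton in the middle shows that adding a point to a set does not
  decrease the value, which gives monotonicity; with the middle set \<open>S \<inter> T\<close> it is subadditivity.
\<close>

lemma diversity_iff_pseudodiversity:
  "diversity X \<delta> \<longleftrightarrow> pseudodiversity X \<delta> \<and> (\<forall>x\<in>X. \<forall>y\<in>X. \<delta> {x, y} = 0 \<longrightarrow> x = y)"
proof
  assume D: "diversity X \<delta>"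
  have zero: "\<delta> A = 0 \<longleftrightarrow> card A \<le> 1" if "finite A" "A \<subseteq> X" for A
    using D that unfolding diversity_def by blast
  have nonneg: "0 \<le> \<delta> A" if "finite A" "A \<subseteq> X" for A
    using D that unfolding diversity_def by blast
  have tri: "\<delta> (A \<union> C) \<le> \<delta> (A \<union> B) + \<delta> (B \<union> C)"
    if "finite A" "A \<subseteq> X" "finite B" "B \<subseteq> X" "finite C" "C \<subseteq> X" "B \<noteq> {}" for A B C
    using D that unfolding diversity_def by blast
  have grow: "\<delta> S \<le> \<delta> (S \<union> F)" if "finite F" "finite S" "S \<subseteq> X" "F \<subseteq> X" for S F
    using that(1,4)
  proof (induction F rule: finite_induct)
    case (insert x F)
    have "\<delta> ((S \<union> F) \<union> {}) \<le> \<delta> ((S \<union> F) \<union> {x}) + \<delta> ({x} \<union> {})"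
      using insert that by (intro tri) auto
    moreover have "\<delta> {x} = 0"
      using insert zero[of "{x}"] by simp
    ultimately show ?case
      using insert by simp
  qed simp
  have "pseudodiversity X \<delta>"
    unfolding pseudodiversity_def
  proof (intro conjI allI impI ballI)
    show "\<delta> {} = 0" using zero[of "{}"] by simp
    show "\<delta> {x} = 0" if "x \<in> X" for x using zero[of "{x}"] that by simp
    show "\<delta> S \<le> \<delta> T" if "finite T \<and> T \<subseteq> X \<and> S \<subseteq> T" for S T
    proof -
      have "finite S" using that finite_subset by blast
      moreover have "S \<union> T = T" using that by blast
      ultimately show ?thesis using grow[of T S] that by auto
    qed
    show "\<delta> (S \<union> T) \<le> \<delta> S + \<delta> T"
      if "finite S \<and> S \<subseteq> X \<and> finite T \<and> T \<subseteq> X \<and> S \<inter> T \<noteq> {}" for S T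
    proof -
      have "\<delta> (S \<union> T) \<le> \<delta> (S \<union> (S \<inter> T)) + \<delta> ((S \<inter> T) \<union> T)"
        using that by (intro tri) auto
      then show ?thesis
        by (simp add: Un_absorb2 Un_absorb1)
    qed
  qed
  moreover have "x = y" if "x \<in> X" "y \<in> X" "\<delta> {x, y} = 0" for x y
    using zero[of "{x, y}"] that by (cases "x = y") auto
  ultimately show "pseudodiversity X \<delta> \<and> (\<forall>x\<in>X. \<forall>y\<in>X. \<delta> {x, y} = 0 \<longrightarrow> x = y)"
    by blast
next
  assume R: "pseudodiversity X \<delta> \<and> (\<forall>x\<in>X. \<forall>y\<in>X. \<delta> {x, y} = 0 \<longrightarrow> x = y)"
  then have P: "pseudodiversity X \<delta>" by blast
  show "diversity X \<delta>"
    unfolding diversity_def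
  proof (intro conjI allI impI)
    fix A assume A: "finite A \<and> A \<subseteq> X"
    show "0 \<le> \<delta> A" using pseudodiversity_nonneg[OF P] A by blast
    show "\<delta> A = 0 \<longleftrightarrow> card A \<le> 1"
    proof
      assume z: "\<delta> A = 0"
      have "x = y" if "x \<in> A" "y \<in> A" for x y
      proof -
        have "\<delta> {x, y} \<le> \<delta> A" "0 \<le> \<delta> {x, y}"
          using that A by (auto intro!: pseudodiversity_mono[OF P] pseudodiversity_nonneg[OF P])
        then show ?thesis using R z that A by (metis order_antisym subsetD)
      qed
      then show "card A \<le> 1"
        using A by (auto simp: card_le_Suc0_iff_eq)
    next
      assume "card A \<le> 1"
      then have "card A = 0 \<or> card A = 1"
        by linarith
      then consider "A = {}" | x where "A = {x}"
        using A by (metis card_0_eq card_1_singletonE)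
      then show "\<delta> A = 0"
        using pseudodiversity_empty[OF P] pseudodiversity_singleton[OF P] A by cases auto
    qed
  next
    fix A B C
    assume H: "finite A \<and> A \<subseteq> X \<and> finite B \<and> B \<subseteq> X \<and> finite C \<and> C \<subseteq> X \<and> B \<noteq> {}"
    have "\<delta> (A \<union> C) \<le> \<delta> ((A \<union> B) \<union> (B \<union> C))"
      using H by (intro pseudodiversity_mono[OF P]) auto
    also have "\<dots> \<le> \<delta> (A \<union> B) + \<delta> (B \<union> C)"
      using H by (intro pseudodiversity_Un[OF P]) auto
    finally show "\<delta> (A \<union> C) \<le> \<delta> (A \<union> B) + \<delta> (B \<union> C)" .
  qed
qed

text \<open>
  Starting from \<open>g ` I\<close>, the pairs \<open>{f i, g i}\<close> can be added one after the other, and each of them meets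
  \<open>g ` I\<close>.
\<close>

lemma pseudodiversity_lipschitz_le:
  assumes P: "pseudodiversity X \<delta>" and "finite I" "f ` I \<subseteq> X" "g ` I \<subseteq> X"
  shows "\<delta> (f ` I) \<le> \<delta> (g ` I) + (\<Sum>i\<in>I. \<delta> {f i, g i})"
proof -
  have "\<delta> (g ` I \<union> f ` J) \<le> \<delta> (g ` I) + (\<Sum>i\<in>J. \<delta> {f i, g i})" if "finite J" "J \<subseteq> I" for J
    using that
  proof (induction J rule: finite_induct)
    case (insert j J)
    have "\<delta> (g ` I \<union> f ` insert j J) = \<delta> ((g ` I \<union> f ` J) \<union> {f j, g j})"
      using insert.prems by (intro arg_cong[where f = \<delta>]) auto
    also have "\<dots> \<le> \<delta> (g ` I \<union> f ` J) + \<delta> {f j, g j}"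
      using insert assms by (intro pseudodiversity_Un[OF P]) auto
    finally show ?case
      using insert by simp
  qed simp
  from this[of I] have "\<delta> (g ` I \<union> f ` I) \<le> \<delta> (g ` I) + (\<Sum>i\<in>I. \<delta> {f i, g i})"
    using assms by simp
  moreover have "\<delta> (f ` I) \<le> \<delta> (g ` I \<union> f ` I)"
    using assms by (intro pseudodiversity_mono[OF P]) auto
  ultimately show ?thesis by linarith
qed

lemma pseudodiversity_lipschitz:
  assumes "pseudodiversity X \<delta>" "finite I" "f ` I \<subseteq> X" "g ` I \<subseteq> X"
  shows "\<bar>\<delta> (f ` I) - \<delta> (g ` I)\<bar> \<le> (\<Sum>i\<in>I. \<delta> {f i, g i})"
  using pseudodiversity_lipschitz_le[OF assms] pseudodiversity_lipschitz_le[OF assms(1,2,4,3)]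
  by (simp add: insert_commute)

lemma pseudodiversity_lipschitz_bound:
  assumes "pseudodiversity X \<delta>" "finite I" "f ` I \<subseteq> X" "g ` I \<subseteq> X"
    and "\<And>i. i \<in> I \<Longrightarrow> \<delta> {f i, g i} \<le> \<epsilon>"
  shows "\<bar>\<delta> (f ` I) - \<delta> (g ` I)\<bar> \<le> real (card I) * \<epsilon>"
  using pseudodiversity_lipschitz[OF assms(1-4)] sum_bounded_above[of I "\<lambda>i. \<delta> {f i, g i}" \<epsilon>] assms(5)
  by fastforce

lemma pseudodiversity_insert_near:
  assumes P: "pseudodiversity X \<delta>" and "finite T" "T \<subseteq> X" "x \<in> X" "y \<in> X"
  shows "\<bar>\<delta> (insert x T) - \<delta> (insert y T)\<bar> \<le> \<delta> {x, y}"
proof -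
  have le: "\<delta> (insert u T) \<le> \<delta> (insert v T) + \<delta> {u, v}" if "u \<in> X" "v \<in> X" for u v
  proof -
    have "\<delta> (insert u T) \<le> \<delta> (insert v T \<union> {u, v})"
      using assms that by (intro pseudodiversity_mono[OF P]) auto
    also have "\<dots> \<le> \<delta> (insert v T) + \<delta> {u, v}"
      using assms that by (intro pseudodiversity_Un[OF P]) auto
    finally show ?thesis .
  qed
  show ?thesis
    using le[OF assms(4,5)] le[OF assms(5,4)] by (simp add: insert_commute abs_le_iff)
qed

text \<open>
  The axioms speak about finite sets only. This reduces infinite carriers to finite ones.
\<close>

lemma pseudodiversity_finite_subsets:
  assumes "\<And>F. finite F \<Longrightarrow> F \<subseteq> X \<Longrightarrow> pseudodiversity F \<delta>"
  shows "pseudodiversity X \<delta>"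
  unfolding pseudodiversity_def
proof (intro conjI allI impI ballI)
  show "\<delta> {} = 0"
    using pseudodiversity_empty[OF assms[of "{}"]] by simp
  show "\<delta> {x} = 0" if "x \<in> X" for x
    using pseudodiversity_singleton[OF assms[of "{x}"]] that by simp
  show "\<delta> S \<le> \<delta> T" if "finite T \<and> T \<subseteq> X \<and> S \<subseteq> T" for S T
    using pseudodiversity_mono[OF assms[of T]] that by simp
  show "\<delta> (S \<union> T) \<le> \<delta> S + \<delta> T"
    if "finite S \<and> S \<subseteq> X \<and> finite T \<and> T \<subseteq> X \<and> S \<inter> T \<noteq> {}" for S T
    using pseudodiversity_Un[OF assms[of "S \<union> T"], of S T] that by simp
qed

lemma pseudodiversity_limit:
  assumes P: "\<And>k :: nat. pseudodiversity X (D k)"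
    and lim: "\<And>T. finite T \<Longrightarrow> T \<subseteq> X \<Longrightarrow> (\<lambda>k. D k T) \<longlonglongrightarrow> \<delta> T"
  shows "pseudodiversity X \<delta>"
  unfolding pseudodiversity_def
proof (intro conjI allI impI ballI)
  show "\<delta> {} = 0"
    using lim[of "{}"] pseudodiversity_empty[OF P] LIMSEQ_unique[OF _ tendsto_const] by simp
  show "\<delta> {x} = 0" if "x \<in> X" for x
    using lim[of "{x}"] pseudodiversity_singleton[OF P that] LIMSEQ_unique[OF _ tendsto_const] that by simp
  show "\<delta> S \<le> \<delta> T" if H: "finite T \<and> T \<subseteq> X \<and> S \<subseteq> T" for S T
  proof -
    have S: "finite S" "S \<subseteq> X" using H finite_subset by auto
    show ?thesis
      using H pseudodiversity_mono[OF P] by (intro LIMSEQ_le[OF lim[OF S] lim[of T]]) auto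
  qed
  show "\<delta> (S \<union> T) \<le> \<delta> S + \<delta> T"
    if H: "finite S \<and> S \<subseteq> X \<and> finite T \<and> T \<subseteq> X \<and> S \<inter> T \<noteq> {}" for S T
    using H pseudodiversity_Un[OF P]
    by (intro LIMSEQ_le[OF lim[of "S \<union> T"] tendsto_add[OF lim[of S] lim[of T]]]) auto
qed

lemma pseudodiversity_max:
  assumes P: "pseudodiversity X \<delta>\<^sub>1" "pseudodiversity X \<delta>\<^sub>2"
  shows "pseudodiversity X (\<lambda>T. max (\<delta>\<^sub>1 T) (\<delta>\<^sub>2 T))"
  unfolding pseudodiversity_def
proof (intro conjI allI impI ballI)
  show "max (\<delta>\<^sub>1 {}) (\<delta>\<^sub>2 {}) = 0"
    using assms by (simp add: pseudodiversity_empty)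
  show "max (\<delta>\<^sub>1 {x}) (\<delta>\<^sub>2 {x}) = 0" if "x \<in> X" for x
    using assms that by (simp add: pseudodiversity_singleton)
  show "max (\<delta>\<^sub>1 S) (\<delta>\<^sub>2 S) \<le> max (\<delta>\<^sub>1 T) (\<delta>\<^sub>2 T)" if "finite T \<and> T \<subseteq> X \<and> S \<subseteq> T" for S T
    using pseudodiversity_mono[OF P(1), of T S] pseudodiversity_mono[OF P(2), of T S] that by auto
  show "max (\<delta>\<^sub>1 (S \<union> T)) (\<delta>\<^sub>2 (S \<union> T)) \<le> max (\<delta>\<^sub>1 S) (\<delta>\<^sub>2 S) + max (\<delta>\<^sub>1 T) (\<delta>\<^sub>2 T)"
    if "finite S \<and> S \<subseteq> X \<and> finite T \<and> T \<subseteq> X \<and> S \<inter> T \<noteq> {}" for S T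
    using pseudodiversity_Un[OF P(1), of S T] pseudodiversity_Un[OF P(2), of S T] that by auto
qed

section \<open>One-point extensions\<close>

text \<open>
  The clauses are the axioms of a pseudodiversity on \<open>S\<close> plus one point, for sets that contain this
  point. Two such sets meet in the new point, so the first subadditivity clause has no further condition;
  in the second, one of the two sets lies inside \<open>S\<close>.
\<close>

definition one_point_extension :: "'c set \<Rightarrow> ('c set \<Rightarrow> real) \<Rightarrow> ('c set \<Rightarrow> real) \<Rightarrow> bool" where
  "one_point_extension S \<delta> \<phi> \<longleftrightarrow>
     \<phi> {} = 0 \<and>
     (\<forall>T U. U \<subseteq> S \<and> T \<subseteq> U \<longrightarrow> \<phi> T \<le> \<phi> U) \<and>
     (\<forall>T. T \<subseteq> S \<longrightarrow> \<delta> T \<le> \<phi> T) \<and>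
     (\<forall>T U. T \<subseteq> S \<and> U \<subseteq> S \<longrightarrow> \<phi> (T \<union> U) \<le> \<phi> T + \<phi> U) \<and>
     (\<forall>T U. T \<subseteq> S \<and> U \<subseteq> S \<and> T \<inter> U \<noteq> {} \<longrightarrow> \<phi> (T \<union> U) \<le> \<phi> T + \<delta> U)"

lemma one_point_extension_empty: "one_point_extension S \<delta> \<phi> \<Longrightarrow> \<phi> {} = 0"
  and one_point_extension_mono:
    "one_point_extension S \<delta> \<phi> \<Longrightarrow> U \<subseteq> S \<Longrightarrow> T \<subseteq> U \<Longrightarrow> \<phi> T \<le> \<phi> U"
  and one_point_extension_ge: "one_point_extension S \<delta> \<phi> \<Longrightarrow> T \<subseteq> S \<Longrightarrow> \<delta> T \<le> \<phi> T"
  and one_point_extension_Un: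
    "one_point_extension S \<delta> \<phi> \<Longrightarrow> T \<subseteq> S \<Longrightarrow> U \<subseteq> S \<Longrightarrow> \<phi> (T \<union> U) \<le> \<phi> T + \<phi> U"
  and one_point_extension_Un_base:
    "one_point_extension S \<delta> \<phi> \<Longrightarrow> T \<subseteq> S \<Longrightarrow> U \<subseteq> S \<Longrightarrow> T \<inter> U \<noteq> {} \<Longrightarrow> \<phi> (T \<union> U) \<le> \<phi> T + \<delta> U"
  by (simp_all add: one_point_extension_def)

lemma one_point_extension_cong:
  assumes "one_point_extension S \<delta> \<phi>" "\<And>T. T \<subseteq> S \<Longrightarrow> \<delta>' T = \<delta> T" "\<And>T. T \<subseteq> S \<Longrightarrow> \<phi>' T = \<phi> T"
  shows "one_point_extension S \<delta>' \<phi>'"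
proof -
  show ?thesis
    unfolding one_point_extension_def
  proof (intro conjI allI impI)
    show "\<phi>' {} = 0"
      using one_point_extension_empty[OF assms(1)] assms(3) by simp
    show "\<phi>' T \<le> \<phi>' U" if "U \<subseteq> S \<and> T \<subseteq> U" for T U
      using one_point_extension_mono[OF assms(1), of U T] assms(3)[of T] assms(3)[of U] that by auto
    show "\<delta>' T \<le> \<phi>' T" if "T \<subseteq> S" for T
      using one_point_extension_ge[OF assms(1) that] assms(2,3) that by simp
    show "\<phi>' (T \<union> U) \<le> \<phi>' T + \<phi>' U" if "T \<subseteq> S \<and> U \<subseteq> S" for T U
      using one_point_extension_Un[OF assms(1), of T U] assms(3) that by simp
    show "\<phi>' (T \<union> U) \<le> \<phi>' T + \<delta>' U" if "T \<subseteq> S \<and> U \<subseteq> S \<and> T \<inter> U \<noteq> {}" for T U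
      using one_point_extension_Un_base[OF assms(1), of T U] assms(2,3) that by simp
  qed
qed

lemma one_point_extension_pullback:
  assumes "one_point_extension S \<delta> \<phi>" "f ` R \<subseteq> S"
  shows "one_point_extension R (\<lambda>T. \<delta> (f ` T)) (\<lambda>T. \<phi> (f ` T))"
  unfolding one_point_extension_def
proof (intro conjI allI impI)
  show "\<phi> (f ` {}) = 0"
    using one_point_extension_empty[OF assms(1)] by simp
  show "\<phi> (f ` T) \<le> \<phi> (f ` U)" if "U \<subseteq> R \<and> T \<subseteq> U" for T U
    using that assms(2) by (intro one_point_extension_mono[OF assms(1)]) auto
  show "\<delta> (f ` T) \<le> \<phi> (f ` T)" if "T \<subseteq> R" for T
    using that assms(2) by (intro one_point_extension_ge[OF assms(1)]) auto
  show "\<phi> (f ` (T \<union> U)) \<le> \<phi> (f ` T) + \<phi> (f ` U)" if "T \<subseteq> R \<and> U \<subseteq> R" for T U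
    unfolding image_Un using that assms(2) by (intro one_point_extension_Un[OF assms(1)]) auto
  show "\<phi> (f ` (T \<union> U)) \<le> \<phi> (f ` T) + \<delta> (f ` U)" if "T \<subseteq> R \<and> U \<subseteq> R \<and> T \<inter> U \<noteq> {}" for T U
    unfolding image_Un using that assms(2) by (intro one_point_extension_Un_base[OF assms(1)]) auto
qed

lemma one_point_extension_of_point:
  assumes P: "pseudodiversity X \<delta>" and "finite S" "S \<subseteq> X" "x \<in> X"
  shows "one_point_extension S \<delta> (\<lambda>T. \<delta> (insert x T))"
  unfolding one_point_extension_def
proof (intro conjI allI impI)
  have fin: "finite T" if "T \<subseteq> S" for T
    using that assms(2) finite_subset by blast
  show "\<delta> {x} = 0"
    using pseudodiversity_singleton[OF P] assms by simp
  show "\<delta> (insert x T) \<le> \<delta> (insert x U)" if "U \<subseteq> S \<and> T \<subseteq> U" for T U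
    using that assms fin by (intro pseudodiversity_mono[OF P]) auto
  show "\<delta> T \<le> \<delta> (insert x T)" if "T \<subseteq> S" for T
    using that assms fin by (intro pseudodiversity_mono[OF P]) auto
  show "\<delta> (insert x (T \<union> U)) \<le> \<delta> (insert x T) + \<delta> (insert x U)" if "T \<subseteq> S \<and> U \<subseteq> S" for T U
    using pseudodiversity_Un[OF P, of "insert x T" "insert x U"] that assms fin by auto
  show "\<delta> (insert x (T \<union> U)) \<le> \<delta> (insert x T) + \<delta> U" if "T \<subseteq> S \<and> U \<subseteq> S \<and> T \<inter> U \<noteq> {}" for T U
    using pseudodiversity_Un[OF P, of "insert x T" U] that assms fin by auto
qed

lemma pseudodiversity_insert:
  assumes P: "pseudodiversity S \<delta>" and "finite S" and E: "one_point_extension S \<delta> \<phi>" and "w \<notin> S"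
  shows "pseudodiversity (insert w S) (\<lambda>T. if w \<in> T then \<phi> (T - {w}) else \<delta> T)"
    (is "pseudodiversity _ ?D")
  unfolding pseudodiversity_def
proof (intro conjI allI impI ballI)
  show "?D {} = 0"
    using pseudodiversity_empty[OF P] by simp
  show "?D {x} = 0" if "x \<in> insert w S" for x
    using that one_point_extension_empty[OF E] pseudodiversity_singleton[OF P] by auto
  show "?D T \<le> ?D U" if H: "finite U \<and> U \<subseteq> insert w S \<and> T \<subseteq> U" for T U
  proof -
    have "T - {w} \<subseteq> U - {w}" "U - {w} \<subseteq> S" "T - {w} \<subseteq> S" using H by auto
    then have "\<phi> (T - {w}) \<le> \<phi> (U - {w})" "\<delta> (T - {w}) \<le> \<delta> (U - {w})" "\<delta> (T - {w}) \<le> \<phi> (T - {w})"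
      using one_point_extension_mono[OF E] pseudodiversity_mono[OF P] one_point_extension_ge[OF E] H
      by auto
    then show ?thesis using H by auto
  qed
  show "?D (T \<union> U) \<le> ?D T + ?D U"
    if H: "finite T \<and> T \<subseteq> insert w S \<and> finite U \<and> U \<subseteq> insert w S \<and> T \<inter> U \<noteq> {}" for T U
  proof -
    let ?T = "T - {w}" and ?U = "U - {w}"
    have sub: "?T \<subseteq> S" "?U \<subseteq> S" using H by auto
    have un: "T \<union> U - {w} = ?T \<union> ?U" by auto
    show ?thesis
    proof (cases "w \<in> T"; cases "w \<in> U")
      assume "w \<in> T" "w \<in> U"
      then show ?thesis using one_point_extension_Un[OF E sub] by (simp add: un)
    next
      assume w: "w \<in> T" "w \<notin> U"
      then have "?T \<inter> ?U \<noteq> {}" using H by auto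
      then show ?thesis using one_point_extension_Un_base[OF E sub] w by (simp add: un)
    next
      assume w: "w \<notin> T" "w \<in> U"
      then have "?U \<inter> ?T \<noteq> {}" using H by auto
      then show ?thesis using one_point_extension_Un_base[OF E sub(2,1)] w
        by (simp add: un Un_commute add.commute)
    next
      assume w: "w \<notin> T" "w \<notin> U"
      then show ?thesis using pseudodiversity_Un[OF P, of T U] H by auto
    qed
  qed
qed

text \<open>
  The new point is \<open>None\<close>, which is available on any type.
\<close>

lemma one_point_extension_realized:
  assumes P: "pseudodiversity S \<delta>" and "finite S" and E: "one_point_extension S \<delta> \<phi>"
  obtains \<Delta> where "pseudodiversity (insert None (Some ` S)) \<Delta>" "\<forall>T. \<Delta> (Some ` T) = \<delta> T"
    "\<forall>T. \<Delta> (insert None (Some ` T)) = \<phi> T"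
proof -
  have sub: "the ` Some ` S \<subseteq> S" by auto
  let ?D = "\<lambda>T. if None \<in> T then \<phi> (the ` (T - {None})) else \<delta> (the ` T)"
  have "pseudodiversity (insert None (Some ` S)) ?D"
    using pseudodiversity_insert[OF pseudodiversity_pullback[OF P sub] _
        one_point_extension_pullback[OF E sub], of None] assms(2) by auto
  moreover have "?D (Some ` T) = \<delta> T" for T
    by (auto simp: image_image)
  moreover have "?D (insert None (Some ` T)) = \<phi> T" for T
  proof -
    have "insert None (Some ` T) - {None} = Some ` T" by auto
    then show ?thesis by (simp add: image_image)
  qed
  ultimately show ?thesis by (intro that[of ?D]) blast+
qed

text \<open>
  This is the Lipschitz property of the pseudodiversity that contains the new point. The summand 1
  stands for the new point itself, which is kept fixed.
\<close>

lemma one_point_extension_lipschitz: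
  assumes P: "pseudodiversity S \<delta>" and "finite S" and E: "one_point_extension S \<delta> \<phi>"
    and "finite I" "f ` I \<subseteq> S" "g ` I \<subseteq> S" "0 \<le> \<epsilon>" and near: "\<And>i. i \<in> I \<Longrightarrow> \<delta> {f i, g i} \<le> \<epsilon>"
  shows "\<bar>\<phi> (f ` I) - \<phi> (g ` I)\<bar> \<le> (real (card I) + 1) * \<epsilon>"
proof -
  obtain \<Delta> where \<Delta>: "pseudodiversity (insert None (Some ` S)) \<Delta>" "\<forall>T. \<Delta> (Some ` T) = \<delta> T"
    "\<forall>T. \<Delta> (insert None (Some ` T)) = \<phi> T"
    by (rule one_point_extension_realized[OF P assms(2) E])
  let ?I = "insert None (Some ` I)"
  have img: "map_option h ` ?I = insert None (Some ` h ` I)" for h :: "'b \<Rightarrow> 'a"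
    by (auto simp: image_image)
  have "\<bar>\<Delta> (map_option f ` ?I) - \<Delta> (map_option g ` ?I)\<bar> \<le> real (card ?I) * \<epsilon>"
  proof (rule pseudodiversity_lipschitz_bound[OF \<Delta>(1)])
    fix i assume i: "i \<in> ?I"
    show "\<Delta> {map_option f i, map_option g i} \<le> \<epsilon>"
    proof (cases i)
      case None
      then show ?thesis
        using pseudodiversity_singleton[OF \<Delta>(1), of None] \<open>0 \<le> \<epsilon>\<close> by simp
    next
      case (Some j)
      then have "\<Delta> {map_option f i, map_option g i} = \<delta> {f j, g j}"
        using \<Delta>(2)[rule_format, of "{f j, g j}"] by simp
      then show ?thesis using near i Some by auto
    qed
  qed (use assms in auto)
  moreover have "card ?I = Suc (card I)"
    using assms(4) by (simp add: card_image)
  ultimately show ?thesis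
    unfolding img using \<Delta>(3) by (simp add: add.commute)
qed

section \<open>Amalgamation of one-point extensions\<close>

text \<open>
  The least value \<open>c\<close> that \<open>T \<union> {w, z}\<close> can have if \<open>\<phi>\<close> and \<open>\<psi>\<close> describe the points \<open>w\<close> and \<open>z\<close>:
  as \<open>T \<union> {w, z}\<close> and \<open>U \<union> {z}\<close> meet in \<open>z\<close>, subadditivity forces \<open>\<phi> (T \<union> U) \<le> c + \<psi> U\<close>, and
  likewise with \<open>w\<close> and \<open>z\<close> exchanged.
\<close>

definition joint_value ::
  "'c set \<Rightarrow> ('c set \<Rightarrow> real) \<Rightarrow> ('c set \<Rightarrow> real) \<Rightarrow> 'c set \<Rightarrow> real" where
  "joint_value A \<phi> \<psi> T = Max ((\<lambda>U. max (\<phi> (T \<union> U) - \<psi> U) (\<psi> (T \<union> U) - \<phi> U)) ` Pow A)"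

lemma joint_value_commute: "joint_value A \<phi> \<psi> = joint_value A \<psi> \<phi>"
  unfolding joint_value_def by (simp add: max.commute)

lemma joint_value_le_iff:
  assumes "finite A"
  shows "joint_value A \<phi> \<psi> T \<le> c \<longleftrightarrow>
    (\<forall>U\<subseteq>A. \<phi> (T \<union> U) \<le> c + \<psi> U \<and> \<psi> (T \<union> U) \<le> c + \<phi> U)"
  unfolding joint_value_def using assms by (subst Max_le_iff) (auto simp: algebra_simps)

lemma joint_value_ge:
  assumes "finite A" "U \<subseteq> A"
  shows "\<phi> (T \<union> U) \<le> joint_value A \<phi> \<psi> T + \<psi> U"
  using joint_value_le_iff[OF assms(1), of \<phi> \<psi> T "joint_value A \<phi> \<psi> T"] assms(2) by blast

lemma joint_value_ge_left:
  assumes "finite A" "one_point_extension A \<delta> \<psi>"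
  shows "\<phi> T \<le> joint_value A \<phi> \<psi> T"
  using joint_value_ge[OF assms(1), of "{}" \<phi> T \<psi>] one_point_extension_empty[OF assms(2)] by simp

lemma joint_value_mono:
  assumes "finite A" and E: "one_point_extension A \<delta> \<phi>" "one_point_extension A \<delta> \<psi>"
    and "T \<subseteq> V" "V \<subseteq> A"
  shows "joint_value A \<phi> \<psi> T \<le> joint_value A \<phi> \<psi> V"
  unfolding joint_value_le_iff[OF assms(1)]
proof (intro allI impI)
  fix U assume U: "U \<subseteq> A"
  have "\<phi> (T \<union> U) \<le> \<phi> (V \<union> U)" "\<psi> (T \<union> U) \<le> \<psi> (V \<union> U)"
    using U assms by (auto intro!: one_point_extension_mono[OF E(1)] one_point_extension_mono[OF E(2)])
  then show "\<phi> (T \<union> U) \<le> joint_value A \<phi> \<psi> V + \<psi> U \<and> \<psi> (T \<union> U) \<le> joint_value A \<phi> \<psi> V + \<phi> U"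
    using joint_value_ge[OF assms(1) U, of \<phi> V \<psi>] joint_value_ge[OF assms(1) U, of \<psi> V \<phi>]
      joint_value_commute[of A \<phi> \<psi>] by simp
qed

lemma joint_value_Un_left:
  assumes "finite A" and E: "one_point_extension A \<delta> \<phi>" and "T \<subseteq> A" "V \<subseteq> A"
  shows "joint_value A \<phi> \<psi> (T \<union> V) \<le> joint_value A \<phi> \<psi> T + \<phi> V"
  unfolding joint_value_le_iff[OF assms(1)]
proof (intro allI impI conjI)
  fix U assume U: "U \<subseteq> A"
  have "\<phi> (T \<union> V \<union> U) \<le> \<phi> (T \<union> U) + \<phi> V"
    using one_point_extension_Un[OF E, of "T \<union> U" V] U assms by (simp add: ac_simps)
  then show "\<phi> (T \<union> V \<union> U) \<le> joint_value A \<phi> \<psi> T + \<phi> V + \<psi> U"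
    using joint_value_ge[OF assms(1) U, of \<phi> T \<psi>] by simp
  have "\<psi> (T \<union> (V \<union> U)) \<le> joint_value A \<phi> \<psi> T + \<phi> (V \<union> U)"
    using joint_value_ge[OF assms(1), of "V \<union> U" \<psi> T \<phi>] joint_value_commute[of A \<phi> \<psi>] U assms by simp
  then show "\<psi> (T \<union> V \<union> U) \<le> joint_value A \<phi> \<psi> T + \<phi> V + \<phi> U"
    using one_point_extension_Un[OF E assms(4) U] by (simp add: Un_assoc)
qed

lemma joint_value_Un_base:
  assumes "finite A" and E: "one_point_extension A \<delta> \<phi>" "one_point_extension A \<delta> \<psi>"
    and "T \<subseteq> A" "V \<subseteq> A" "T \<inter> V \<noteq> {}"
  shows "joint_value A \<phi> \<psi> (T \<union> V) \<le> joint_value A \<phi> \<psi> T + \<delta> V"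
  unfolding joint_value_le_iff[OF assms(1)]
proof (intro allI impI)
  fix U assume U: "U \<subseteq> A"
  have "\<phi> (T \<union> V \<union> U) \<le> \<phi> (T \<union> U) + \<delta> V" "\<psi> (T \<union> V \<union> U) \<le> \<psi> (T \<union> U) + \<delta> V"
    using one_point_extension_Un_base[OF E(1), of "T \<union> U" V]
      one_point_extension_Un_base[OF E(2), of "T \<union> U" V] U assms
    by (auto simp: ac_simps)
  then show "\<phi> (T \<union> V \<union> U) \<le> joint_value A \<phi> \<psi> T + \<delta> V + \<psi> U \<and>
      \<psi> (T \<union> V \<union> U) \<le> joint_value A \<phi> \<psi> T + \<delta> V + \<phi> U"
    using joint_value_ge[OF assms(1) U, of \<phi> T \<psi>] joint_value_ge[OF assms(1) U, of \<psi> T \<phi>]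
      joint_value_commute[of A \<phi> \<psi>] by simp
qed

text \<open>
  This is the decisive inequality: a set containing \<open>w\<close> and a set containing \<open>z\<close> that meet inside \<open>A\<close>.
  To bound \<open>\<phi> (T \<union> V \<union> U)\<close>, the set \<open>V \<union> U\<close> is first joined through \<open>z\<close>, which costs
  \<open>\<psi> V + \<psi> U\<close>; afterwards \<open>V \<union> U\<close> is a set inside \<open>A\<close> that meets \<open>T\<close>.
\<close>

lemma joint_value_Un_cross:
  assumes "finite A" and E: "one_point_extension A \<delta> \<phi>" "one_point_extension A \<delta> \<psi>"
    and "T \<subseteq> A" "V \<subseteq> A" "T \<inter> V \<noteq> {}"
  shows "joint_value A \<phi> \<psi> (T \<union> V) \<le> \<phi> T + \<psi> V"
  unfolding joint_value_le_iff[OF assms(1)]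
proof (intro allI impI conjI)
  fix U assume U: "U \<subseteq> A"
  have "\<phi> (T \<union> (V \<union> U)) \<le> \<phi> T + \<delta> (V \<union> U)"
    using U assms by (intro one_point_extension_Un_base[OF E(1)]) auto
  moreover have "\<delta> (V \<union> U) \<le> \<psi> (V \<union> U)"
    using U assms by (intro one_point_extension_ge[OF E(2)]) auto
  moreover have "\<psi> (V \<union> U) \<le> \<psi> V + \<psi> U"
    using U assms by (intro one_point_extension_Un[OF E(2)]) auto
  ultimately show "\<phi> (T \<union> V \<union> U) \<le> \<phi> T + \<psi> V + \<psi> U"
    by (simp add: Un_assoc)
  have "\<psi> (V \<union> (T \<union> U)) \<le> \<psi> V + \<delta> (T \<union> U)"
    using U assms by (intro one_point_extension_Un_base[OF E(2)]) auto
  moreover have "\<delta> (T \<union> U) \<le> \<phi> (T \<union> U)"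
    using U assms by (intro one_point_extension_ge[OF E(1)]) auto
  moreover have "\<phi> (T \<union> U) \<le> \<phi> T + \<phi> U"
    using U assms by (intro one_point_extension_Un[OF E(1)]) auto
  ultimately show "\<psi> (T \<union> V \<union> U) \<le> \<phi> T + \<psi> V + \<phi> U"
    by (simp add: ac_simps)
qed

text \<open>
  The extension by \<open>w\<close> is \<open>\<phi>\<close>, the point \<open>z\<close> is already present, and \<open>\<phi>'\<close> describes \<open>w\<close> over
  \<open>A \<union> {z}\<close>. The last clause bounds the distance of \<open>w\<close> and \<open>z\<close>.
\<close>

lemma one_point_extension_insert:
  assumes "finite A" and P: "pseudodiversity (insert z A) \<delta>" and E: "one_point_extension A \<delta> \<phi>"
  obtains \<phi>' where "one_point_extension (insert z A) \<delta> \<phi>'" "\<forall>T\<subseteq>A. \<phi>' T = \<phi> T"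
    "\<forall>\<epsilon>. (\<forall>T\<subseteq>A. \<bar>\<phi> T - \<delta> (insert z T)\<bar> \<le> \<epsilon>) \<longrightarrow> \<phi>' {z} \<le> \<epsilon>"
proof (cases "z \<in> A")
  case True
  show ?thesis
  proof (rule that[of \<phi>])
    show "one_point_extension (insert z A) \<delta> \<phi>"
      using E True by (simp add: insert_absorb)
    have "\<phi> {z} \<le> \<epsilon>" if "\<forall>T\<subseteq>A. \<bar>\<phi> T - \<delta> (insert z T)\<bar> \<le> \<epsilon>" for \<epsilon>
      using that[rule_format, of "{z}"] pseudodiversity_singleton[OF P, of z] True by simp
    then show "\<forall>\<epsilon>. (\<forall>T\<subseteq>A. \<bar>\<phi> T - \<delta> (insert z T)\<bar> \<le> \<epsilon>) \<longrightarrow> \<phi> {z} \<le> \<epsilon>"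
      by blast
  qed simp
next
  case False
  define \<psi> where "\<psi> = (\<lambda>T. \<delta> (insert z T))"
  have E': "one_point_extension A \<delta> \<psi>"
    unfolding \<psi>_def using one_point_extension_of_point[OF P] assms(1) by auto
  let ?\<theta> = "joint_value A \<phi> \<psi>"
  define \<phi>' where "\<phi>' = (\<lambda>T. if z \<in> T then ?\<theta> (T - {z}) else \<phi> T)"
  have \<psi>: "\<delta> T = \<psi> (T - {z})" if "z \<in> T" for T
    unfolding \<psi>_def using that by (simp add: insert_absorb)
  have ge1: "\<phi> T \<le> ?\<theta> T" and ge2: "\<psi> T \<le> ?\<theta> T" for T
    using joint_value_ge_left[OF assms(1) E', of \<phi> T] joint_value_ge_left[OF assms(1) E, of \<psi> T]
    by (simp_all add: joint_value_commute)
  have un: "T \<union> U - {z} = (T - {z}) \<union> (U - {z})" for T U by auto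
  show ?thesis
  proof (rule that[of \<phi>'])
    show "\<forall>T\<subseteq>A. \<phi>' T = \<phi> T"
      using False unfolding \<phi>'_def by auto
    have "\<phi>' {z} \<le> \<epsilon>" if H: "\<forall>T\<subseteq>A. \<bar>\<phi> T - \<delta> (insert z T)\<bar> \<le> \<epsilon>" for \<epsilon>
    proof -
      have "?\<theta> {} \<le> \<epsilon>"
        unfolding joint_value_le_iff[OF assms(1)] \<psi>_def
      proof (intro allI impI)
        fix U assume "U \<subseteq> A"
        then show "\<phi> ({} \<union> U) \<le> \<epsilon> + \<delta> (insert z U) \<and> \<delta> (insert z ({} \<union> U)) \<le> \<epsilon> + \<phi> U"
          using H[rule_format, of U] by (simp add: abs_le_iff)
      qed
      then show ?thesis unfolding \<phi>'_def by simp
    qed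
    then show "\<forall>\<epsilon>. (\<forall>T\<subseteq>A. \<bar>\<phi> T - \<delta> (insert z T)\<bar> \<le> \<epsilon>) \<longrightarrow> \<phi>' {z} \<le> \<epsilon>"
      by blast
    show "one_point_extension (insert z A) \<delta> \<phi>'"
      unfolding one_point_extension_def
    proof (intro conjI allI impI)
      show "\<phi>' {} = 0"
        using one_point_extension_empty[OF E] unfolding \<phi>'_def by simp
      show "\<phi>' T \<le> \<phi>' U" if H: "U \<subseteq> insert z A \<and> T \<subseteq> U" for T U
      proof -
        have sub: "T - {z} \<subseteq> U - {z}" "U - {z} \<subseteq> A" using H by auto
        have "\<phi> (T - {z}) \<le> \<phi> (U - {z})" "?\<theta> (T - {z}) \<le> ?\<theta> (U - {z})"
          using one_point_extension_mono[OF E sub(2,1)] joint_value_mono[OF assms(1) E E' sub] by auto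
        then show ?thesis
          using H ge1[of "U - {z}"] unfolding \<phi>'_def by (auto split: if_splits)
      qed
      show "\<delta> T \<le> \<phi>' T" if "T \<subseteq> insert z A" for T
        using that ge2[of "T - {z}"] one_point_extension_ge[OF E, of T] \<psi>[of T]
        unfolding \<phi>'_def by (auto simp: subset_insert)
      show "\<phi>' (T \<union> U) \<le> \<phi>' T + \<phi>' U" if H: "T \<subseteq> insert z A \<and> U \<subseteq> insert z A" for T U
      proof -
        have sub: "T - {z} \<subseteq> A" "U - {z} \<subseteq> A" using H by auto
        show ?thesis
          using joint_value_Un_left[OF assms(1) E sub, of \<psi>] ge1[of "U - {z}"]
            joint_value_Un_left[OF assms(1) E sub(2,1), of \<psi>]
            one_point_extension_Un[OF E sub]
          unfolding \<phi>'_def by (auto simp: un Un_commute)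
      qed
      show "\<phi>' (T \<union> U) \<le> \<phi>' T + \<delta> U"
        if H: "T \<subseteq> insert z A \<and> U \<subseteq> insert z A \<and> T \<inter> U \<noteq> {}" for T U
      proof -
        have sub: "T - {z} \<subseteq> A" "U - {z} \<subseteq> A" using H by auto
        show ?thesis
        proof (cases "z \<in> U")
          case U: True
          show ?thesis
          proof (cases "z \<in> T")
            case True
            then show ?thesis
              using joint_value_Un_left[OF assms(1) E' sub, of \<phi>] U \<psi>[OF U]
              unfolding \<phi>'_def by (simp add: un joint_value_commute)
          next
            case False
            then have "(T - {z}) \<inter> (U - {z}) \<noteq> {}" using H by auto
            then show ?thesis
              using joint_value_Un_cross[OF assms(1) E E' sub] U False \<psi>[OF U]
              unfolding \<phi>'_def by (simp add: un)
          qed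
        next
          case U: False
          then have "(T - {z}) \<inter> (U - {z}) \<noteq> {}" using H by auto
          then show ?thesis
            using joint_value_Un_base[OF assms(1) E E' sub] one_point_extension_Un_base[OF E sub] U
            unfolding \<phi>'_def by (auto simp: un)
        qed
      qed
    qed
  qed
qed

text \<open>
  Iterating \<open>one_point_extension_insert\<close> over the points of \<open>X - S\<close>.
\<close>

lemma one_point_extension_extend:
  assumes "finite X" and P: "pseudodiversity X \<delta>" and "S \<subseteq> X" and E: "one_point_extension S \<delta> \<phi>"
  obtains \<phi>' where "one_point_extension X \<delta> \<phi>'" "\<forall>T\<subseteq>S. \<phi>' T = \<phi> T"
proof -
  have "\<exists>\<phi>'. one_point_extension (S \<union> F) \<delta> \<phi>' \<and> (\<forall>T\<subseteq>S. \<phi>' T = \<phi> T)" if "finite F" "F \<subseteq> X" for F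
    using that
  proof (induction F rule: finite_induct)
    case empty
    then show ?case using E by auto
  next
    case (insert z F)
    from insert.prems have "F \<subseteq> X"
      by simp
    from insert.IH[OF this] obtain \<phi>1 where 1: "one_point_extension (S \<union> F) \<delta> \<phi>1"
      "\<forall>T\<subseteq>S. \<phi>1 T = \<phi> T"
      by blast
    have fin: "finite (S \<union> F)"
      using assms(1,3) insert.hyps finite_subset by auto
    have "pseudodiversity (insert z (S \<union> F)) \<delta>"
      using pseudodiversity_subset[OF P] insert.prems assms(3) by auto
    then obtain \<phi>2 where 2: "one_point_extension (insert z (S \<union> F)) \<delta> \<phi>2"
      "\<forall>T\<subseteq>S \<union> F. \<phi>2 T = \<phi>1 T"
      "\<forall>\<epsilon>. (\<forall>T\<subseteq>S \<union> F. \<bar>\<phi>1 T - \<delta> (insert z T)\<bar> \<le> \<epsilon>) \<longrightarrow> \<phi>2 {z} \<le> \<epsilon>"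
      by (rule one_point_extension_insert[OF fin _ 1(1)])
    have "\<phi>2 T = \<phi> T" if "T \<subseteq> S" for T
    proof -
      have "T \<subseteq> S \<union> F" using that by blast
      then show ?thesis using 2(2) 1(2) that by simp
    qed
    moreover have "one_point_extension (S \<union> insert z F) \<delta> \<phi>2"
      using 2(1) by simp
    ultimately show ?case by blast
  qed
  from this[of X] obtain \<phi>' where "one_point_extension (S \<union> X) \<delta> \<phi>'" "\<forall>T\<subseteq>S. \<phi>' T = \<phi> T"
    using assms(1) by blast
  then show ?thesis
    using that[of \<phi>'] assms(3) by (simp add: Un_absorb1)
qed

text \<open>
  The points of \<open>Y\<close> are added to \<open>X\<close> one by one. Over the part of \<open>Y\<close> that is already present, \<open>\<delta>\<^sub>2\<close>
  prescribes the next point, and \<open>one_point_extension_extend\<close> extends this prescription to all points.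
\<close>

lemma pseudodiversity_amalgam:
  assumes "finite X" "finite Y" and P: "pseudodiversity X \<delta>\<^sub>1" "pseudodiversity Y \<delta>\<^sub>2"
    and agree: "\<And>T. T \<subseteq> X \<inter> Y \<Longrightarrow> \<delta>\<^sub>1 T = \<delta>\<^sub>2 T"
  obtains \<Delta> where "pseudodiversity (X \<union> Y) \<Delta>" "\<forall>T\<subseteq>X. \<Delta> T = \<delta>\<^sub>1 T" "\<forall>T\<subseteq>Y. \<Delta> T = \<delta>\<^sub>2 T"
proof -
  have "\<exists>\<Delta>. pseudodiversity (X \<union> F) \<Delta> \<and> (\<forall>T\<subseteq>X. \<Delta> T = \<delta>\<^sub>1 T) \<and> (\<forall>T\<subseteq>Y \<inter> (X \<union> F). \<Delta> T = \<delta>\<^sub>2 T)"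
    if "finite F" "F \<subseteq> Y" for F
    using that
  proof (induction F rule: finite_induct)
    case empty
    have "\<forall>T\<subseteq>Y \<inter> X. \<delta>\<^sub>1 T = \<delta>\<^sub>2 T"
      using agree by (simp add: Int_commute)
    then show ?case using P(1) by (intro exI[of _ \<delta>\<^sub>1]) simp
  next
    case (insert w F)
    from insert.prems have "F \<subseteq> Y"
      by simp
    from insert.IH[OF this] obtain \<Delta> where D: "pseudodiversity (X \<union> F) \<Delta>"
      "\<forall>T\<subseteq>X. \<Delta> T = \<delta>\<^sub>1 T" "\<forall>T\<subseteq>Y \<inter> (X \<union> F). \<Delta> T = \<delta>\<^sub>2 T"
      by blast
    show ?case
    proof (cases "w \<in> X")
      case True
      then have "X \<union> insert w F = X \<union> F" by auto
      then show ?thesis using D by (intro exI[of _ \<Delta>]) simp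
    next
      case False
      let ?S = "Y \<inter> (X \<union> F)"
      have fin: "finite (X \<union> F)" using assms(1) insert.hyps by simp
      have "one_point_extension ?S \<delta>\<^sub>2 (\<lambda>T. \<delta>\<^sub>2 (insert w T))"
        using insert.prems assms(2) by (intro one_point_extension_of_point[OF P(2)]) auto
      then have "one_point_extension ?S \<Delta> (\<lambda>T. \<delta>\<^sub>2 (insert w T))"
        by (rule one_point_extension_cong) (use D in auto)
      then obtain \<phi> where phi: "one_point_extension (X \<union> F) \<Delta> \<phi>"
        "\<forall>T\<subseteq>?S. \<phi> T = \<delta>\<^sub>2 (insert w T)"
        by (rule one_point_extension_extend[OF fin D(1) Int_lower2])
      let ?D = "\<lambda>T. if w \<in> T then \<phi> (T - {w}) else \<Delta> T"
      have "pseudodiversity (insert w (X \<union> F)) ?D"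
        using pseudodiversity_insert[OF D(1) fin phi(1)] False insert.hyps by simp
      moreover have "?D T = \<delta>\<^sub>1 T" if "T \<subseteq> X" for T
        using that False D by auto
      moreover have "?D T = \<delta>\<^sub>2 T" if "T \<subseteq> Y \<inter> (X \<union> insert w F)" for T
      proof (cases "w \<in> T")
        case True
        have "T - {w} \<subseteq> ?S" using that by auto
        then show ?thesis using phi(2) True by (simp add: insert_absorb)
      next
        case False
        then have "T \<subseteq> ?S" using that by auto
        then show ?thesis using D(3) False by auto
      qed
      moreover have "X \<union> insert w F = insert w (X \<union> F)"
        by simp
      ultimately show ?thesis
        by (intro exI[of _ ?D]) (simp del: Un_insert_right)
    qed
  qed
  from this[of Y] assms(2) obtain \<Delta> where "pseudodiversity (X \<union> Y) \<Delta>" "\<forall>T\<subseteq>X. \<Delta> T = \<delta>\<^sub>1 T"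
    "\<forall>T\<subseteq>Y \<inter> (X \<union> Y). \<Delta> T = \<delta>\<^sub>2 T"
    by blast
  then show ?thesis using that[of \<Delta>] by auto
qed

section \<open>Structures that carry a diversity\<close>

text \<open>
  The witness of \<open>diversity_structure\<close> made explicit.
\<close>

definition carries :: "('c, nat) mstructure \<Rightarrow> ('c set \<Rightarrow> real) \<Rightarrow> bool" where
  "carries M \<delta> \<longleftrightarrow> diversity (univ M) \<delta> \<and>
     (\<forall>x\<in>univ M. \<forall>y\<in>univ M. sdist M x y = \<delta> {x, y}) \<and>
     (\<forall>k. \<forall>xs\<in>tuples (univ M) (Suc k). rel M k xs = \<delta> (set xs))"

lemma diversity_structure_iff: "diversity_structure M \<longleftrightarrow> (\<exists>\<delta>. carries M \<delta>)"
  unfolding diversity_structure_def carries_def by simp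

lemma carries_pseudodiversity: "carries M \<delta> \<Longrightarrow> pseudodiversity (univ M) \<delta>"
  and carries_zero: "carries M \<delta> \<Longrightarrow> x \<in> univ M \<Longrightarrow> y \<in> univ M \<Longrightarrow> \<delta> {x, y} = 0 \<Longrightarrow> x = y"
  and carries_sdist: "carries M \<delta> \<Longrightarrow> x \<in> univ M \<Longrightarrow> y \<in> univ M \<Longrightarrow> sdist M x y = \<delta> {x, y}"
  and carries_rel: "carries M \<delta> \<Longrightarrow> xs \<in> tuples (univ M) (Suc k) \<Longrightarrow> rel M k xs = \<delta> (set xs)"
  unfolding carries_def diversity_iff_pseudodiversity by auto

lemma carriesI:
  assumes "pseudodiversity (univ M) \<delta>"
    and "\<And>x y. x \<in> univ M \<Longrightarrow> y \<in> univ M \<Longrightarrow> sdist M x y = \<delta> {x, y}"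
    and "\<And>k xs. xs \<in> tuples (univ M) (Suc k) \<Longrightarrow> rel M k xs = \<delta> (set xs)"
  shows "carries M \<delta>"
proof -
  have "x = y" if "x \<in> univ M" "y \<in> univ M" "\<delta> {x, y} = 0" for x y
    using assms(2)[OF that(1,2)] that by simp
  then show ?thesis
    using assms unfolding carries_def diversity_iff_pseudodiversity by auto
qed

lemma interp_carries:
  assumes "carries M \<delta>" "xs \<in> tuples (univ M) (arity Suc s)"
  shows "interp M s xs = \<delta> (set xs)"
proof (cases s)
  case Dist
  then have "length xs = 2" "set xs \<subseteq> univ M"
    using assms(2) by (simp_all add: tuples_def)
  then obtain x y where "xs = [x, y]" "x \<in> univ M" "y \<in> univ M"
    by (auto simp: numeral_2_eq_2 length_Suc_conv)
  then show ?thesis using carries_sdist[OF assms(1)] Dist by simp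
next
  case (Pred k)
  then show ?thesis using assms carries_rel[OF assms(1)] by simp
qed

lemma Metric_space_pseudodiversity:
  assumes "pseudodiversity X \<delta>" "\<And>x y. x \<in> X \<Longrightarrow> y \<in> X \<Longrightarrow> \<delta> {x, y} = 0 \<Longrightarrow> x = y"
  shows "Metric_space X (\<lambda>x y. if x \<in> X \<and> y \<in> X then \<delta> {x, y} else 0)"
proof
  show "0 \<le> (if x \<in> X \<and> y \<in> X then \<delta> {x, y} else 0)" for x y
    using pseudodiversity_nonneg[OF assms(1), of "{x, y}"] by simp
  show "(if x \<in> X \<and> y \<in> X then \<delta> {x, y} else 0) = (if y \<in> X \<and> x \<in> X then \<delta> {y, x} else 0)" for x y
    by (simp add: insert_commute)
  show "((if x \<in> X \<and> y \<in> X then \<delta> {x, y} else 0) = 0) = (x = y)" if "x \<in> X" "y \<in> X" for x y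
    using assms(2)[OF that] pseudodiversity_singleton[OF assms(1)] that by auto
  show "(if x \<in> X \<and> z \<in> X then \<delta> {x, z} else 0) \<le>
      (if x \<in> X \<and> y \<in> X then \<delta> {x, y} else 0) + (if y \<in> X \<and> z \<in> X then \<delta> {y, z} else 0)"
    if "x \<in> X" "y \<in> X" "z \<in> X" for x y z
    using pseudodiversity_triangle[OF assms(1) that] that by simp
qed

definition structure_of :: "'c metric \<Rightarrow> ('c set \<Rightarrow> real) \<Rightarrow> ('c, nat) mstructure" where
  "structure_of m \<delta> = \<lparr>met = m, rel = \<lambda>k xs. \<delta> (set xs)\<rparr>"

lemma carries_structure_of:
  assumes "pseudodiversity (mspace m) \<delta>"
    and "\<And>x y. x \<in> mspace m \<Longrightarrow> y \<in> mspace m \<Longrightarrow> mdist m x y = \<delta> {x, y}"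
  shows "carries (structure_of m \<delta>) \<delta>"
  using assms by (intro carriesI) (simp_all add: structure_of_def)

text \<open>
  Points at distance zero are identified by choosing a representative of each class, and the finitely
  many classes are then copied into the infinite type \<open>'a\<close>. The map \<open>p\<close> sends a point to the copy of its
  class.
\<close>

lemma finite_structure_exists:
  fixes X :: "'c set"
  assumes "infinite (UNIV :: 'a set)" "finite X" and P: "pseudodiversity X \<delta>"
  obtains A :: "('a, nat) mstructure" and \<alpha> p where
    "A \<in> finite_diversities" "carries A \<alpha>" "p ` X = univ A" "\<forall>T\<subseteq>X. \<alpha> (p ` T) = \<delta> T"
proof -
  define r where "r = (\<lambda>x. SOME y. y \<in> X \<and> \<delta> {x, y} = 0)"
  have r: "r x \<in> X" "\<delta> {x, r x} = 0" if "x \<in> X" for x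
  proof -
    have "x \<in> X \<and> \<delta> {x, x} = 0"
      using pseudodiversity_singleton[OF P that] that by simp
    then have "r x \<in> X \<and> \<delta> {x, r x} = 0"
      unfolding r_def by (rule someI)
    then show "r x \<in> X" "\<delta> {x, r x} = 0" by auto
  qed
  have r_eq: "r x = r y" if "x \<in> X" "y \<in> X" "\<delta> {x, y} = 0" for x y
  proof -
    have "\<delta> {x, z} = 0 \<longleftrightarrow> \<delta> {y, z} = 0" if "z \<in> X" for z
    proof -
      have "\<delta> {x, z} \<le> \<delta> {x, y} + \<delta> {y, z}" "\<delta> {y, z} \<le> \<delta> {y, x} + \<delta> {x, z}"
        using \<open>x \<in> X\<close> \<open>y \<in> X\<close> that by (auto intro!: pseudodiversity_triangle[OF P])
      moreover have "0 \<le> \<delta> {x, z}" "0 \<le> \<delta> {y, z}"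
        using \<open>x \<in> X\<close> \<open>y \<in> X\<close> that by (auto intro!: pseudodiversity_nonneg[OF P])
      ultimately show ?thesis
        using \<open>\<delta> {x, y} = 0\<close> by (simp add: insert_commute)
    qed
    then have "(\<lambda>z. z \<in> X \<and> \<delta> {x, z} = 0) = (\<lambda>z. z \<in> X \<and> \<delta> {y, z} = 0)"
      by auto
    then show ?thesis unfolding r_def by simp
  qed
  have \<delta>_r: "\<delta> (r ` T) = \<delta> T" if "T \<subseteq> X" for T
  proof -
    have "\<bar>\<delta> (r ` T) - \<delta> ((\<lambda>x. x) ` T)\<bar> \<le> real (card T) * 0"
      using that r assms(2) finite_subset
      by (intro pseudodiversity_lipschitz_bound[OF P]) (auto simp: insert_commute)
    then show ?thesis by simp
  qed
  obtain F :: "'a set" where F: "finite F" "card F = card X"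
    using assms(1) infinite_arbitrarily_large by blast
  then obtain e :: "'c \<Rightarrow> 'a" where e: "inj_on e X"
    using card_le_inj[of X F] assms(2) by auto
  define Y where "Y = (e \<circ> r) ` X"
  define i where "i = inv_into X e"
  have i_e: "i (e x) = x" if "x \<in> X" for x
    unfolding i_def using e that by simp
  have iY: "i ` Y \<subseteq> X"
    unfolding Y_def using i_e r by auto
  define \<alpha> where "\<alpha> = (\<lambda>T. \<delta> (i ` T))"
  have PA: "pseudodiversity Y \<alpha>"
    unfolding \<alpha>_def by (rule pseudodiversity_pullback[OF P iY])
  have zero: "u = v" if uv: "u \<in> Y" "v \<in> Y" "\<alpha> {u, v} = 0" for u v
  proof -
    obtain x y where xy: "x \<in> X" "y \<in> X" "u = e (r x)" "v = e (r y)"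
      using uv unfolding Y_def by auto
    then have z: "\<delta> {r x, r y} = 0"
      using uv(3) i_e r unfolding \<alpha>_def by simp
    have "r (r x) = r x" "r (r y) = r y"
      using r_eq[OF xy(1) r[OF xy(1)]] r_eq[OF xy(2) r[OF xy(2)]] by simp_all
    then have "r x = r y"
      using r_eq[OF r(1)[OF xy(1)] r(1)[OF xy(2)] z] by metis
    then show ?thesis using xy by simp
  qed
  let ?d = "\<lambda>x y. if x \<in> Y \<and> y \<in> Y then \<alpha> {x, y} else 0"
  have M: "Metric_space Y ?d"
    using Metric_space_pseudodiversity[OF PA zero] .
  define A where "A = structure_of (metric (Y, ?d)) \<alpha>"
  have univ: "univ A = Y"
    unfolding A_def structure_of_def using Metric_space.mspace_metric[OF M] by simp
  have A: "carries A \<alpha>"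
    unfolding A_def using Metric_space.mspace_metric[OF M] Metric_space.mdist_metric[OF M] PA
    by (intro carries_structure_of) simp_all
  show ?thesis
  proof (rule that[of A \<alpha> "e \<circ> r"])
    have "finite Y" unfolding Y_def using assms(2) by simp
    then show "A \<in> finite_diversities"
      using A univ unfolding finite_diversities_def diversity_structure_iff by auto
    show "carries A \<alpha>" by fact
    show "(e \<circ> r) ` X = univ A" using univ Y_def by simp
    show "\<forall>T\<subseteq>X. \<alpha> ((e \<circ> r) ` T) = \<delta> T"
    proof (intro allI impI)
      fix T assume T: "T \<subseteq> X"
      have "i ` (e \<circ> r) ` T = r ` T"
        unfolding image_comp using T i_e r by (intro image_cong) auto
      then show "\<alpha> ((e \<circ> r) ` T) = \<delta> T"
        unfolding \<alpha>_def using \<delta>_r[OF T] by simp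
    qed
  qed
qed

lemma embedding_iff:
  assumes M: "carries M \<delta>" and N: "carries N \<delta>'"
  shows "embedding Suc f M N \<longleftrightarrow>
    f ` univ M \<subseteq> univ N \<and> (\<forall>T. finite T \<and> T \<subseteq> univ M \<longrightarrow> \<delta>' (f ` T) = \<delta> T)"
proof
  assume E: "embedding Suc f M N"
  have sub: "f ` univ M \<subseteq> univ N"
    using E unfolding embedding_def by blast
  moreover have "\<delta>' (f ` T) = \<delta> T" if T: "finite T" "T \<subseteq> univ M" for T
  proof (cases "T = {}")
    case True
    then show ?thesis
      using pseudodiversity_empty[OF carries_pseudodiversity[OF M]]
        pseudodiversity_empty[OF carries_pseudodiversity[OF N]] by simp
  next
    case False
    obtain xs where xs: "set xs = T"
      using finite_list[OF T(1)] by blast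
    then obtain k where k: "length xs = Suc k"
      using False by (cases xs) auto
    have tup: "xs \<in> tuples (univ M) (Suc k)" "map f xs \<in> tuples (univ N) (Suc k)"
      using xs k T sub unfolding tuples_def by auto
    have "interp N (Pred k) (map f xs) = interp M (Pred k) xs"
      using E tup unfolding embedding_def by (metis arity.simps(2))
    then show ?thesis
      using carries_rel[OF M tup(1)] carries_rel[OF N tup(2)] xs by simp
  qed
  ultimately show "f ` univ M \<subseteq> univ N \<and> (\<forall>T. finite T \<and> T \<subseteq> univ M \<longrightarrow> \<delta>' (f ` T) = \<delta> T)"
    by blast
next
  assume R: "f ` univ M \<subseteq> univ N \<and> (\<forall>T. finite T \<and> T \<subseteq> univ M \<longrightarrow> \<delta>' (f ` T) = \<delta> T)"
  have "interp N s (map f xs) = interp M s xs" if "xs \<in> tuples (univ M) (arity Suc s)" for s xs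
  proof -
    have "map f xs \<in> tuples (univ N) (arity Suc s)"
      using that R unfolding tuples_def by auto
    then show ?thesis
      using interp_carries[OF M that] interp_carries[OF N, of "map f xs" s] R that
      unfolding tuples_def by simp
  qed
  then show "embedding Suc f M N"
    using R unfolding embedding_def by blast
qed

lemma carries_pullback:
  assumes E: "embedding Suc f B A" and A: "carries A \<alpha>"
  shows "carries B (\<lambda>T. \<alpha> (f ` T))"
proof (rule carriesI)
  have sub: "f ` univ B \<subseteq> univ A"
    using E unfolding embedding_def by blast
  have I: "interp B s xs = interp A s (map f xs)" if "xs \<in> tuples (univ B) (arity Suc s)" for s xs
    using E that unfolding embedding_def by metis
  show "pseudodiversity (univ B) (\<lambda>T. \<alpha> (f ` T))"
    using pseudodiversity_pullback[OF carries_pseudodiversity[OF A] sub] .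
  have fxs: "map f xs \<in> tuples (univ A) n" if "xs \<in> tuples (univ B) n" for xs n
    using that sub unfolding tuples_def by auto
  show "sdist B x y = \<alpha> (f ` {x, y})" if "x \<in> univ B" "y \<in> univ B" for x y
    using I[of "[x, y]" Dist] interp_carries[OF A, of "map f [x, y]" Dist] that sub
    by (auto simp: tuples_def)
  show "rel B k xs = \<alpha> (f ` set xs)" if "xs \<in> tuples (univ B) (Suc k)" for k xs
    using I[of xs "Pred k"] carries_rel[OF A fxs[OF that]] that by simp
qed

lemma univ_induced [simp]: "univ (induced M S) = S \<inter> univ M"
  and sdist_induced [simp]: "sdist (induced M S) = sdist M"
  and rel_induced [simp]: "rel (induced M S) = rel M"
  unfolding induced_def by simp_all

lemma carries_induced:
  assumes "carries M \<delta>"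
  shows "carries (induced M S) \<delta>"
proof (rule carriesI)
  show "pseudodiversity (univ (induced M S)) \<delta>"
    using pseudodiversity_subset[OF carries_pseudodiversity[OF assms]] by simp
  show "sdist (induced M S) x y = \<delta> {x, y}"
    if "x \<in> univ (induced M S)" "y \<in> univ (induced M S)" for x y
    using carries_sdist[OF assms] that by simp
  show "rel (induced M S) k xs = \<delta> (set xs)"
    if "xs \<in> tuples (univ (induced M S)) (Suc k)" for k xs
    using carries_rel[OF assms, of xs k] that by (simp add: tuples_def)
qed

lemma enum_embedding_iff:
  assumes "carries A \<alpha>" "carries C \<gamma>" "set as \<subseteq> univ A"
  shows "enum_embedding Suc f (A, as) C \<longleftrightarrow>
    f ` set as \<subseteq> univ C \<and> (\<forall>T\<subseteq>set as. \<gamma> (f ` T) = \<alpha> T)"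
proof -
  have "univ (induced A (set as)) = set as"
    using assms(3) by auto
  moreover have "finite T \<and> T \<subseteq> set as \<longleftrightarrow> T \<subseteq> set as" for T
    using finite_subset[of T "set as"] by auto
  ultimately show ?thesis
    unfolding enum_embedding_def fst_conv snd_conv embedding_iff[OF carries_induced[OF assms(1)] assms(2)]
    by simp
qed

lemma mcomplete_finite:
  assumes "finite (mspace m)"
  shows "mcomplete_of m"
proof -
  interpret Metric_space "mspace m" "mdist m" by simp
  have "compact_space mtopology"
    unfolding compact_space_def using assms
    by (intro finite_imp_compactin) simp_all
  then show ?thesis
    unfolding mcomplete_of_def by (rule compact_space_imp_mcomplete)
qed

text \<open>
  Completeness in terms of distances alone, without the topology.
\<close>

lemma mcomplete_of_iff:
  "mcomplete_of m \<longleftrightarrow> (\<forall>\<sigma>. (\<forall>k. \<sigma> k \<in> mspace m) \<and>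
     (\<forall>\<epsilon>>0. \<exists>N. \<forall>j\<ge>N. \<forall>k\<ge>N. mdist m (\<sigma> j) (\<sigma> k) < \<epsilon>) \<longrightarrow>
     (\<exists>x\<in>mspace m. (\<lambda>k. mdist m (\<sigma> k) x) \<longlonglongrightarrow> 0))"
proof -
  interpret Metric_space "mspace m" "mdist m" by simp
  have "MCauchy \<sigma> \<longleftrightarrow> (\<forall>k. \<sigma> k \<in> mspace m) \<and>
     (\<forall>\<epsilon>>0. \<exists>N. \<forall>j\<ge>N. \<forall>k\<ge>N. mdist m (\<sigma> j) (\<sigma> k) < \<epsilon>)" for \<sigma>
    unfolding MCauchy_def by (auto simp: image_subset_iff)
  moreover have "(\<exists>x. limitin mtopology \<sigma> x sequentially) \<longleftrightarrow>
      (\<exists>x\<in>mspace m. (\<lambda>k. mdist m (\<sigma> k) x) \<longlonglongrightarrow> 0)" if "\<forall>k. \<sigma> k \<in> mspace m" for \<sigma>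
    unfolding limit_metric_sequentially LIMSEQ_iff using that by (auto simp: Bex_def)
  ultimately show ?thesis
    unfolding mcomplete_of_def mcomplete_def by auto
qed

text \<open>
  Uniform continuity of the predicates is the Lipschitz property of the diversity.
\<close>

lemma is_structure_carries:
  assumes M: "carries M \<delta>" and "mcomplete_of (met M)"
  shows "is_structure Suc M"
  unfolding is_structure_def
proof (intro conjI allI impI)
  note P = carries_pseudodiversity[OF M]
  fix k :: nat and \<epsilon> :: real assume "\<epsilon> > 0"
  show "\<exists>\<eta>>0. \<forall>xs\<in>tuples (univ M) (Suc k). \<forall>ys\<in>tuples (univ M) (Suc k).
        (\<forall>i<Suc k. sdist M (xs ! i) (ys ! i) < \<eta>) \<longrightarrow> \<bar>rel M k xs - rel M k ys\<bar> < \<epsilon>"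
  proof (intro exI[of _ "\<epsilon> / (2 * Suc k)"] conjI ballI impI)
    show "0 < \<epsilon> / (2 * Suc k)" using \<open>\<epsilon> > 0\<close> by simp
    fix xs ys assume t: "xs \<in> tuples (univ M) (Suc k)" "ys \<in> tuples (univ M) (Suc k)"
      and near: "\<forall>i<Suc k. sdist M (xs ! i) (ys ! i) < \<epsilon> / (2 * Suc k)"
    have len: "length xs = Suc k" "length ys = Suc k"
      using t by (simp_all add: tuples_def)
    have sub: "xs ! i \<in> univ M" "ys ! i \<in> univ M" if "i < Suc k" for i
      using t len that nth_mem[of i xs] nth_mem[of i ys] by (auto simp: tuples_def)
    have set: "set xs = (!) xs ` {..<Suc k}" "set ys = (!) ys ` {..<Suc k}"
      using len by (auto simp: set_conv_nth)
    have "\<bar>\<delta> (set xs) - \<delta> (set ys)\<bar> \<le> real (card {..<Suc k}) * (\<epsilon> / (2 * Suc k))"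
      unfolding set
    proof (rule pseudodiversity_lipschitz_bound[OF P])
      show "\<delta> {xs ! i, ys ! i} \<le> \<epsilon> / real (2 * Suc k)" if "i \<in> {..<Suc k}" for i
        using near[rule_format, of i] carries_sdist[OF M sub] that by simp
    qed (use sub in auto)
    also have "\<dots> = \<epsilon> / 2"
      by (simp add: field_simps)
    also have "\<dots> < \<epsilon>" using \<open>\<epsilon> > 0\<close> by simp
    finally show "\<bar>rel M k xs - rel M k ys\<bar> < \<epsilon>"
      using carries_rel[OF M] t by simp
  qed
qed (rule assms(2))

lemma finite_diversities_carries:
  "A \<in> finite_diversities \<longleftrightarrow> finite (univ A) \<and> (\<exists>\<alpha>. carries A \<alpha>)"
  unfolding finite_diversities_def diversity_structure_iff by simp

lemma K_structure_carries:
  assumes "carries M \<delta>" "mcomplete_of (met M)"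
  shows "K_structure Suc (finite_diversities :: ('a, nat) mstructure set) M"
  unfolding K_structure_def
proof (intro conjI allI impI)
  show "is_structure Suc M"
    by (rule is_structure_carries[OF assms])
  fix A :: "('a, nat) mstructure"
  assume "is_structure Suc A \<and> finite (univ A) \<and> substructure Suc A M"
  then show "A \<in> finite_diversities"
    unfolding finite_diversities_carries substructure_def
    using carries_pullback[OF _ assms(1)] by blast
qed

section \<open>Heredity, amalgamation and joint embedding\<close>

lemma HP_finite_diversities: "HP Suc (finite_diversities :: ('a, nat) mstructure set)"
  unfolding HP_def
proof
  fix A :: "('a, nat) mstructure" assume "A \<in> finite_diversities"
  then obtain \<alpha> where "carries A \<alpha>" "finite (univ A)"
    unfolding finite_diversities_carries by blast
  then show "K_structure Suc (finite_diversities :: ('a, nat) mstructure set) A"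
    using K_structure_carries mcomplete_finite by blast
qed

text \<open>
  Since \<open>pseudodiversity_amalgam\<close> glues along a common subset, \<open>B\<close> and \<open>C\<close> are copied into a sum type in
  such a way that the two images of \<open>A\<close> coincide: \<open>q\<close> sends \<open>fC x\<close> to the copy of \<open>fB x\<close>.
\<close>

lemma AP_finite_diversities:
  assumes inf: "infinite (UNIV :: 'a set)"
  shows "AP Suc (finite_diversities :: ('a, nat) mstructure set)"
  unfolding AP_def
proof (intro ballI allI impI)
  fix A B C :: "('a, nat) mstructure" and fB fC
  assume K: "A \<in> finite_diversities" "B \<in> finite_diversities" "C \<in> finite_diversities"
    and E: "embedding Suc fB A B \<and> embedding Suc fC A C"
  obtain \<alpha> \<beta> \<gamma> where \<alpha>: "carries A \<alpha>" and \<beta>: "carries B \<beta>" and \<gamma>: "carries C \<gamma>"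
    and fin: "finite (univ A)" "finite (univ B)" "finite (univ C)"
    using K unfolding finite_diversities_carries by blast
  have fB: "fB ` univ A \<subseteq> univ B" "\<And>T. T \<subseteq> univ A \<Longrightarrow> \<beta> (fB ` T) = \<alpha> T"
    and fC: "fC ` univ A \<subseteq> univ C" "\<And>T. T \<subseteq> univ A \<Longrightarrow> \<gamma> (fC ` T) = \<alpha> T"
    using E finite_subset[OF _ fin(1)] unfolding embedding_iff[OF \<alpha> \<beta>] embedding_iff[OF \<alpha> \<gamma>] by auto
  have inj: "x = y" if "x \<in> univ A" "y \<in> univ A" "fC x = fC y" for x y
  proof -
    have "\<gamma> (fC ` {x, y}) = 0"
      using that fC pseudodiversity_singleton[OF carries_pseudodiversity[OF \<gamma>], of "fC x"] by auto
    then show ?thesis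
      using that fC(2)[of "{x, y}"] carries_zero[OF \<alpha>] by simp
  qed
  have injB: "x = y" if "x \<in> univ A" "y \<in> univ A" "fB x = fB y" for x y
  proof -
    have "\<beta> (fB ` {x, y}) = 0"
      using that fB pseudodiversity_singleton[OF carries_pseudodiversity[OF \<beta>], of "fB x"] by auto
    then show ?thesis
      using that fB(2)[of "{x, y}"] carries_zero[OF \<alpha>] by simp
  qed
  define iB where "iB = inv_into (univ A) fB"
  define iC where "iC = inv_into (univ A) fC"
  have iB: "iB (fB x) = x" and iC: "iC (fC x) = x" if "x \<in> univ A" for x
    using that inj injB unfolding iB_def iC_def by (auto simp: inj_on_def intro!: inv_into_f_f)
  define q :: "'a \<Rightarrow> 'a + 'a" where "q = (\<lambda>c. if c \<in> fC ` univ A then Inl (fB (iC c)) else Inr c)"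
  define q' :: "'a + 'a \<Rightarrow> 'a" where "q' = case_sum (\<lambda>b. fC (iB b)) (\<lambda>c. c)"
  define X where "X = (Inl ` univ B :: ('a + 'a) set)"
  define Y where "Y = q ` univ C"
  have q'q: "q' (q c) = c" if "c \<in> univ C" for c
    unfolding q'_def q_def using iB iC by auto
  have "X \<inter> Y = Inl ` fB ` univ A"
  proof
    show "X \<inter> Y \<subseteq> Inl ` fB ` univ A"
      unfolding X_def Y_def q_def using iC by (auto split: if_splits)
    have "Inl (fB x) = q (fC x)" if "x \<in> univ A" for x
      unfolding q_def using that iC by simp
    then have "Inl (fB x) \<in> Y" if "x \<in> univ A" for x
      unfolding Y_def using fC(1) that by blast
    then show "Inl ` fB ` univ A \<subseteq> X \<inter> Y"
      unfolding X_def using fB(1) by blast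
  qed
  then have agree: "\<beta> (projl ` T) = \<gamma> (q' ` T)" if "T \<subseteq> X \<inter> Y" for T
  proof -
    have "T \<subseteq> (\<lambda>x. Inl (fB x)) ` univ A"
      using that \<open>X \<inter> Y = _\<close> by (simp add: image_image)
    then obtain S where S: "S \<subseteq> univ A" "T = (\<lambda>x. Inl (fB x)) ` S"
      by (rule subset_imageE)
    have "projl ` T = fB ` S"
      unfolding S(2) by (simp add: image_image)
    moreover have "q' ` T = fC ` S"
      unfolding S(2) q'_def image_image using iB S(1) by (auto intro!: image_cong)
    ultimately show ?thesis using fB(2)[OF S(1)] fC(2)[OF S(1)] by simp
  qed
  have PX: "pseudodiversity X (\<lambda>T. \<beta> (projl ` T))"
    by (rule pseudodiversity_pullback[OF carries_pseudodiversity[OF \<beta>]]) (auto simp: X_def)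
  have PY: "pseudodiversity Y (\<lambda>T. \<gamma> (q' ` T))"
    by (rule pseudodiversity_pullback[OF carries_pseudodiversity[OF \<gamma>]]) (auto simp: Y_def q'q)
  have finXY: "finite X" "finite Y"
    unfolding X_def Y_def using fin by auto
  obtain \<Delta> where \<Delta>: "pseudodiversity (X \<union> Y) \<Delta>" "\<forall>T\<subseteq>X. \<Delta> T = \<beta> (projl ` T)"
    "\<forall>T\<subseteq>Y. \<Delta> T = \<gamma> (q' ` T)"
    by (rule pseudodiversity_amalgam[OF finXY PX PY agree])
  obtain D :: "('a, nat) mstructure" and d p where D: "D \<in> finite_diversities" "carries D d"
    "p ` (X \<union> Y) = univ D" "\<forall>T\<subseteq>X \<union> Y. d (p ` T) = \<Delta> T"
    using finXY by (rule finite_structure_exists[OF inf finite_UnI \<Delta>(1)])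
  have "embedding Suc (\<lambda>b. p (Inl b)) B D"
    unfolding embedding_iff[OF \<beta> D(2)]
  proof (intro conjI allI impI)
    show "(\<lambda>b. p (Inl b)) ` univ B \<subseteq> univ D"
      using D(3) unfolding X_def by auto
    fix T assume T: "finite T \<and> T \<subseteq> univ B"
    then have "Inl ` T \<subseteq> X" unfolding X_def by auto
    moreover have "(\<lambda>b. p (Inl b)) ` T = p ` Inl ` T"
      by (simp add: image_image)
    moreover have "projl ` (Inl ` T :: ('a + 'a) set) = T"
      by (simp add: image_image)
    ultimately show "d ((\<lambda>b. p (Inl b)) ` T) = \<beta> T"
      using D(4) \<Delta>(2) by (simp add: le_supI1)
  qed
  moreover have "embedding Suc (\<lambda>c. p (q c)) C D"
    unfolding embedding_iff[OF \<gamma> D(2)]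
  proof (intro conjI allI impI)
    show "(\<lambda>c. p (q c)) ` univ C \<subseteq> univ D"
      using D(3) unfolding Y_def by auto
    fix T assume T: "finite T \<and> T \<subseteq> univ C"
    then have "q ` T \<subseteq> Y" unfolding Y_def by auto
    moreover have "(\<lambda>c. p (q c)) ` T = p ` q ` T"
      by (simp add: image_image)
    moreover have "q' ` q ` T = T"
      unfolding image_image using T q'q by (auto simp: image_iff subset_iff)
    ultimately show "d ((\<lambda>c. p (q c)) ` T) = \<gamma> T"
      using D(4) \<Delta>(3) by (simp add: le_supI2)
  qed
  moreover have "p (Inl (fB x)) = p (q (fC x))" if "x \<in> univ A" for x
    unfolding q_def using that iC by simp
  ultimately show "\<exists>D\<in>(finite_diversities :: ('a, nat) mstructure set). \<exists>gB gC. embedding Suc gB B D \<and> embedding Suc gC C D \<and>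
      (\<forall>x\<in>univ A. gB (fB x) = gC (fC x))"
    using D(1)
    by blast
qed

text \<open>
  Amalgamation over the empty structure.
\<close>

lemma JEP_finite_diversities:
  assumes inf: "infinite (UNIV :: 'a set)"
  shows "JEP Suc (finite_diversities :: ('a, nat) mstructure set)"
  unfolding JEP_def
proof (intro ballI)
  fix B C :: "('a, nat) mstructure"
  assume K: "B \<in> finite_diversities" "C \<in> finite_diversities"
  obtain \<beta> \<gamma> where \<beta>: "carries B \<beta>" and \<gamma>: "carries C \<gamma>"
    using K unfolding finite_diversities_carries by blast
  have "pseudodiversity ({} :: 'a set) (\<lambda>_. 0)"
    unfolding pseudodiversity_def by simp
  then obtain A :: "('a, nat) mstructure" and \<alpha> p where A: "A \<in> finite_diversities" "carries A \<alpha>"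
    "p ` ({} :: 'a set) = univ A" "\<forall>T\<subseteq>{}. \<alpha> (p ` T) = 0"
    by (rule finite_structure_exists[OF inf finite.emptyI])
  have E: "embedding Suc id A B" "embedding Suc id A C"
    unfolding embedding_iff[OF A(2) \<beta>] embedding_iff[OF A(2) \<gamma>] using A(3)
      pseudodiversity_empty[OF carries_pseudodiversity[OF A(2)]]
      pseudodiversity_empty[OF carries_pseudodiversity[OF \<beta>]]
      pseudodiversity_empty[OF carries_pseudodiversity[OF \<gamma>]] by auto
  show "\<exists>D\<in>(finite_diversities :: ('a, nat) mstructure set).
      (\<exists>f. embedding Suc f B D) \<and> (\<exists>g. embedding Suc g C D)"
    using AP_finite_diversities[OF inf, unfolded AP_def, rule_format, OF A(1) K conjI[OF E]] by blast
qed

section \<open>Bounded amalgamation\<close>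

lemma enumerated_structuresD:
  assumes "(A, as) \<in> enumerated_structures finite_diversities n"
  shows "\<exists>\<alpha>. carries A \<alpha>" "finite (univ A)" "set as \<subseteq> univ A" "length as = n"
  using assms unfolding enumerated_structures_def tuples_def finite_diversities_carries by auto

lemma pseudodiversity_nth:
  assumes "carries A \<alpha>" "set as \<subseteq> univ A"
  shows "pseudodiversity {..<length as} (\<lambda>T. \<alpha> ((!) as ` T))"
  using assms(2) by (intro pseudodiversity_pullback[OF carries_pseudodiversity[OF assms(1)]]) auto

text \<open>
  Embeddings of tuples may be given on indices. The index function \<open>p\<close> factors through the entries,
  because equal entries have distance zero and their images in the diversity \<open>D\<close> are then equal.
\<close>

lemma enum_embedding_nth:
  assumes A: "carries A \<alpha>" and D: "carries D d" and "set as \<subseteq> univ A"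
    and p: "\<And>i. i < length as \<Longrightarrow> p i \<in> univ D"
    and eq: "\<And>T. T \<subseteq> {..<length as} \<Longrightarrow> d (p ` T) = \<alpha> ((!) as ` T)"
  obtains f where "enum_embedding Suc f (A, as) D" "\<forall>i<length as. f (as ! i) = p i"
proof -
  define f where "f = (\<lambda>x. p (SOME i. i < length as \<and> as ! i = x))"
  have f: "f (as ! i) = p i" if i: "i < length as" for i
  proof -
    let ?j = "SOME j. j < length as \<and> as ! j = as ! i"
    have j: "?j < length as \<and> as ! ?j = as ! i"
      using i by (intro someI[of "\<lambda>j. j < length as \<and> as ! j = as ! i" i]) simp
    have "d (p ` {?j, i}) = \<alpha> ((!) as ` {?j, i})"
      using i j by (intro eq) auto
    also have "(!) as ` {?j, i} = {as ! i}"
      using j by simp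
    also have "\<alpha> {as ! i} = 0"
      using i assms(3) by (intro pseudodiversity_singleton[OF carries_pseudodiversity[OF A]]) auto
    finally have "d {p ?j, p i} = 0" by simp
    then have "p ?j = p i"
      using carries_zero[OF D] p i j by blast
    then show ?thesis unfolding f_def .
  qed
  have img: "f ` (!) as ` T = p ` T" if "T \<subseteq> {..<length as}" for T
    unfolding image_image using that f by (intro image_cong) auto
  have set: "set as = (!) as ` {..<length as}"
    by (auto simp: set_conv_nth)
  have "d (f ` S) = \<alpha> S" if "S \<subseteq> set as" for S
  proof -
    from that have "S \<subseteq> (!) as ` {..<length as}"
      unfolding set .
    then obtain T where T: "T \<subseteq> {..<length as}" "S = (!) as ` T"
      by (rule subset_imageE)
    then show ?thesis using eq[OF T(1)] img[OF T(1)] by simp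
  qed
  moreover have "f ` set as \<subseteq> univ D"
    unfolding set img[OF order_refl] using p by auto
  ultimately have "enum_embedding Suc f (A, as) D"
    unfolding enum_embedding_iff[OF A D assms(3)] by blast
  then show ?thesis using that f by blast
qed

text \<open>
  The symbol of arity \<open>k\<close> evaluated on a subtuple of length \<open>k\<close> is the value of its set of entries, so
  every nonempty index set occurs in the supremum, which ranges over a finite set of values.
\<close>

lemma dinf_ge:
  assumes A: "carries A \<alpha>" "set as \<subseteq> univ A" "length as = n"
    and B: "carries B \<beta>" "set bs \<subseteq> univ B" "length bs = n" and X: "X \<subseteq> {..<n}"
  shows "\<bar>\<alpha> ((!) as ` X) - \<beta> ((!) bs ` X)\<bar> \<le> dinf Suc (A, as) (B, bs)"
proof -
  define V where "V = {\<bar>interp A s (nths as X) - interp B s (nths bs X)\<bar> | s X.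
            X \<subseteq> {..<n} \<and> card X = arity Suc s}"
  have nths: "nths as X \<in> tuples (univ A) (card X)" "nths bs X \<in> tuples (univ B) (card X)"
    "set (nths as X) = (!) as ` X" "set (nths bs X) = (!) bs ` X"
    if "X \<subseteq> {..<n}" for X
  proof -
    have "{i. i < n \<and> i \<in> X} = X" using that by auto
    moreover show "set (nths as X) = (!) as ` X" "set (nths bs X) = (!) bs ` X"
      unfolding set_nths using that A(3) B(3) by auto
    ultimately show "nths as X \<in> tuples (univ A) (card X)" "nths bs X \<in> tuples (univ B) (card X)"
      unfolding tuples_def using A B that set_nths_subset[of as X] set_nths_subset[of bs X]
      by (auto simp: length_nths)
  qed
  have V: "interp A s (nths as X) = \<alpha> ((!) as ` X)" "interp B s (nths bs X) = \<beta> ((!) bs ` X)"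
    if "X \<subseteq> {..<n}" "card X = arity Suc s" for s X
    using interp_carries[OF A(1), of "nths as X" s] interp_carries[OF B(1), of "nths bs X" s]
      nths[OF that(1)] that(2) by simp_all
  have "V \<subseteq> (\<lambda>X. \<bar>\<alpha> ((!) as ` X) - \<beta> ((!) bs ` X)\<bar>) ` Pow {..<n}"
    unfolding V_def using V by auto
  then have "finite V"
    by (rule finite_subset) simp
  then have bdd: "bdd_above (insert 0 V)"
    by (intro bdd_above_finite) simp
  have eq: "dinf Suc (A, as) (B, bs) = Sup (insert 0 V)"
    unfolding dinf_def V_def using A(3) by simp
  show ?thesis
  proof (cases "X = {}")
    case True
    then show ?thesis
      unfolding eq using cSup_upper[OF _ bdd, of 0]
        pseudodiversity_empty[OF carries_pseudodiversity[OF A(1)]]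
        pseudodiversity_empty[OF carries_pseudodiversity[OF B(1)]] by simp
  next
    case False
    have "finite X" using X finite_subset by blast
    then obtain k where k: "card X = Suc k"
      using False by (metis card_0_eq not0_implies_Suc)
    then have c: "card X = arity Suc (Pred k)" by simp
    have "\<bar>\<alpha> ((!) as ` X) - \<beta> ((!) bs ` X)\<bar> \<in> V"
      unfolding V_def mem_Collect_eq
      by (rule exI[of _ "Pred k"], rule exI[of _ X]) (use V[OF X c] X c in simp)
    then show ?thesis
      unfolding eq by (intro cSup_upper[OF _ bdd]) simp
  qed
qed

text \<open>
  The indices \<open>{..<m}\<close> stand for the common part, \<open>m\<close> for the point \<open>z\<close> and \<open>Suc m\<close> for the point \<open>w\<close>.
\<close>

lemma bAP_finite_diversities:
  assumes inf: "infinite (UNIV :: 'a set)"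
  shows "bAP Suc (finite_diversities :: ('a, nat) mstructure set)"
  unfolding bAP_def
proof (intro allI exI[of _ 1] impI)
  fix n and A B :: "('a, nat) mstructure" and as bs w z
  let ?K = "finite_diversities :: ('a, nat) mstructure set"
  assume H: "(A, as @ [w]) \<in> enumerated_structures ?K n \<and> (B, bs @ [z]) \<in> enumerated_structures ?K n \<and>
     (\<exists>h. enum_embedding Suc h (A, as) B \<and> map h as = bs)"
  define m where "m = length as"
  obtain \<alpha> where \<alpha>: "carries A \<alpha>" "set (as @ [w]) \<subseteq> univ A"
    using enumerated_structuresD[of A "as @ [w]" n] H by blast
  obtain \<beta> where \<beta>: "carries B \<beta>" "set (bs @ [z]) \<subseteq> univ B"
    using enumerated_structuresD[of B "bs @ [z]" n] H by blast
  obtain h where h: "enum_embedding Suc h (A, as) B" "map h as = bs"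
    using H by blast
  have len: "length as = m" "length bs = m" "n = Suc m"
    using h(2) H unfolding m_def enumerated_structures_def tuples_def by auto
  have base: "\<beta> ((!) bs ` T) = \<alpha> ((!) as ` T)" if "T \<subseteq> {..<m}" for T
  proof -
    have "(!) bs ` T = h ` (!) as ` T"
      unfolding image_image using that len h(2) by (intro image_cong) auto
    moreover have "(!) as ` T \<subseteq> set as"
      using that len by auto
    ultimately show ?thesis
      using h(1) \<alpha>(2) enum_embedding_iff[OF \<alpha>(1) \<beta>(1), of as h] by simp
  qed
  let ?a = "as @ [w]" and ?b = "bs @ [z]"
  have a_img: "(!) ?a ` T = (!) as ` T" "(!) ?b ` T = (!) bs ` T" if "T \<subseteq> {..<m}" for T
    using that len by (auto intro!: image_cong simp: nth_append)
  have last: "?a ! m = w" "?b ! m = z"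
    using len by (simp_all add: nth_append)
  have Pa: "pseudodiversity {..<Suc m} (\<lambda>T. \<alpha> ((!) ?a ` T))"
    using pseudodiversity_nth[OF \<alpha>] len by simp
  have Pb: "pseudodiversity {..<Suc m} (\<lambda>T. \<beta> ((!) ?b ` T))"
    using pseudodiversity_nth[OF \<beta>] len by simp
  define \<phi> where "\<phi> = (\<lambda>T. \<alpha> ((!) ?a ` insert m T))"
  have "one_point_extension {..<m} (\<lambda>T. \<alpha> ((!) ?a ` T)) \<phi>"
    unfolding \<phi>_def by (rule one_point_extension_of_point[OF Pa]) auto
  then have E: "one_point_extension {..<m} (\<lambda>T. \<beta> ((!) ?b ` T)) \<phi>"
    by (rule one_point_extension_cong) (simp_all add: a_img base)
  define \<epsilon> where "\<epsilon> = dinf Suc (A, ?a) (B, ?b)"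
  obtain \<phi>' where \<phi>': "one_point_extension (insert m {..<m}) (\<lambda>T. \<beta> ((!) ?b ` T)) \<phi>'"
    "\<forall>T\<subseteq>{..<m}. \<phi>' T = \<phi> T"
    "\<forall>\<epsilon>. (\<forall>T\<subseteq>{..<m}. \<bar>\<phi> T - \<beta> ((!) ?b ` insert m T)\<bar> \<le> \<epsilon>) \<longrightarrow> \<phi>' {m} \<le> \<epsilon>"
    by (rule one_point_extension_insert[OF finite_lessThan _ E]) (use Pb in \<open>simp add: lessThan_Suc\<close>)
  have "\<bar>\<phi> T - \<beta> ((!) ?b ` insert m T)\<bar> \<le> \<epsilon>" if "T \<subseteq> {..<m}" for T
    unfolding \<phi>_def \<epsilon>_def using that len \<alpha> \<beta> by (intro dinf_ge[where n = "Suc m"]) auto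
  then have near: "\<phi>' {m} \<le> \<epsilon>"
    using \<phi>'(3) by blast
  define \<Delta> where "\<Delta> = (\<lambda>T. if Suc m \<in> T then \<phi>' (T - {Suc m}) else \<beta> ((!) ?b ` T))"
  have P\<Delta>: "pseudodiversity {..<Suc (Suc m)} \<Delta>"
    using pseudodiversity_insert[OF Pb _ _, of \<phi>' "Suc m"] \<phi>'(1)
    unfolding \<Delta>_def by (simp add: lessThan_Suc)
  obtain D :: "('a, nat) mstructure" and d p where D: "D \<in> ?K" "carries D d"
    "p ` {..<Suc (Suc m)} = univ D" "\<forall>T\<subseteq>{..<Suc (Suc m)}. d (p ` T) = \<Delta> T"
    by (rule finite_structure_exists[OF inf finite_lessThan P\<Delta>])
  \<comment> \<open>In the tuple of \<open>A\<close> the last index \<open>m\<close> denotes \<open>w\<close>, whose index in the amalgam is \<open>Suc m\<close>.\<close>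
  define \<sigma> where "\<sigma> = (\<lambda>i. if i = m then Suc m else i)"
  have p_univ: "p i \<in> univ D" if "i < Suc (Suc m)" for i
    using D(3) that by auto
  have "d ((\<lambda>i. p (\<sigma> i)) ` T) = \<alpha> ((!) ?a ` T)" if T: "T \<subseteq> {..<Suc m}" for T
  proof -
    have sub: "T - {m} \<subseteq> {..<m}" using T by auto
    have "\<sigma> ` T = (if m \<in> T then insert (Suc m) (T - {m}) else T)"
      using T unfolding \<sigma>_def by (auto simp: image_iff)
    moreover have "Suc m \<notin> T" using T by auto
    ultimately have "\<Delta> (\<sigma> ` T) = (if m \<in> T then \<phi> (T - {m}) else \<beta> ((!) ?b ` T))"
      unfolding \<Delta>_def using \<phi>'(2) sub by auto
    also have "\<dots> = \<alpha> ((!) ?a ` T)"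
    proof (cases "m \<in> T")
      case True
      then show ?thesis unfolding \<phi>_def by (simp add: insert_absorb)
    next
      case False
      then have "T \<subseteq> {..<m}" using sub by simp
      then show ?thesis using a_img base False by simp
    qed
    finally have "\<Delta> (\<sigma> ` T) = \<alpha> ((!) ?a ` T)" .
    moreover have "\<sigma> ` T \<subseteq> {..<Suc (Suc m)}"
      using T unfolding \<sigma>_def by auto
    moreover have "(\<lambda>i. p (\<sigma> i)) ` T = p ` \<sigma> ` T"
      by (simp add: image_image)
    ultimately show ?thesis using D(4) by simp
  qed
  moreover have "p (\<sigma> i) \<in> univ D" if "i < Suc m" for i
    using p_univ that unfolding \<sigma>_def by simp
  ultimately obtain f where f: "enum_embedding Suc f (A, ?a) D" "\<forall>i<length ?a. f (?a ! i) = p (\<sigma> i)"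
    using len by (elim enum_embedding_nth[OF \<alpha>(1) D(2) \<alpha>(2), rotated -1]) simp_all
  have "d (p ` T) = \<beta> ((!) ?b ` T)" if T: "T \<subseteq> {..<Suc m}" for T
  proof -
    have "Suc m \<notin> T" "T \<subseteq> {..<Suc (Suc m)}" using T by auto
    then show ?thesis using D(4) unfolding \<Delta>_def by simp
  qed
  then obtain g where g: "enum_embedding Suc g (B, ?b) D" "\<forall>i<length ?b. g (?b ! i) = p i"
    using len p_univ by (elim enum_embedding_nth[OF \<beta>(1) D(2) \<beta>(2), rotated -1]) simp_all
  have fw: "f w = p (Suc m)" and gz: "g z = p m"
    using f(2)[rule_format, of m] g(2)[rule_format, of m] len last unfolding \<sigma>_def by simp_all
  have fi: "f (as ! i) = p i" "g (bs ! i) = p i" if "i < m" for i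
    using f(2)[rule_format, of i] g(2)[rule_format, of i] len that
    unfolding \<sigma>_def by (simp_all add: nth_append)
  have map_eq: "map f as = map p [0..<m]" "map g bs = map p [0..<m]"
    using fi len by (auto intro!: nth_equalityI)
  have "(D, map f as @ [f w, g z]) \<in> enumerated_structures ?K (Suc n)"
    unfolding enumerated_structures_def tuples_def map_eq fw gz using D(1) p_univ len by auto
  moreover have "sdist D (f w) (g z) \<le> 1 * dinf Suc (A, ?a) (B, ?b)"
  proof -
    have "sdist D (f w) (g z) = d (p ` {Suc m, m})"
      using carries_sdist[OF D(2)] p_univ fw gz by simp
    also have "\<dots> = \<Delta> {Suc m, m}"
      using D(4)[rule_format, of "{Suc m, m}"] by simp
    also have "\<dots> = \<phi>' {m}"
      unfolding \<Delta>_def by simp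
    finally show ?thesis using near \<epsilon>_def by simp
  qed
  ultimately show "\<exists>D f g. (D, map f as @ [f w, g z]) \<in> enumerated_structures ?K (Suc n) \<and>
      enum_embedding Suc f (A, ?a) D \<and> enum_embedding Suc g (B, ?b) D \<and> map f as = map g bs \<and>
      sdist D (f w) (g z) \<le> 1 * dinf Suc (A, ?a) (B, ?b)"
    using f(1) g(1) map_eq by metis
qed

section \<open>Continuity and the Polish property\<close>

text \<open>
  Two copies of the same points, on the layers \<open>s\<close> and \<open>t\<close>, at distance \<open>\<epsilon>\<close> from each other. A set that
  meets both layers is projected to the lower layer and charged \<open>\<epsilon>\<close> once.
\<close>

definition layered :: "('c set \<Rightarrow> real) \<Rightarrow> ('c set \<Rightarrow> real) \<Rightarrow> real \<Rightarrow> 'l \<Rightarrow> 'l \<Rightarrow> ('c \<times> 'l) set \<Rightarrow> real"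
  where
  "layered \<delta>\<^sub>1 \<delta>\<^sub>2 \<epsilon> s t S =
     (if t \<notin> snd ` S then \<delta>\<^sub>1 (fst ` S) else if s \<notin> snd ` S then \<delta>\<^sub>2 (fst ` S) else \<delta>\<^sub>1 (fst ` S) + \<epsilon>)"

text \<open>
  Comparability of \<open>\<delta>\<^sub>1\<close> and \<open>\<delta>\<^sub>2\<close> is essential: joining a set of the upper layer to a mixed set costs
  \<open>\<delta>\<^sub>2\<close>, and this must suffice to cover the \<open>\<delta>\<^sub>1\<close> of its projection.
\<close>

lemma layered_pseudodiversity:
  assumes P1: "pseudodiversity I \<delta>\<^sub>1" and P2: "pseudodiversity I \<delta>\<^sub>2" and "s \<noteq> t"
    and le: "\<And>T. finite T \<Longrightarrow> T \<subseteq> I \<Longrightarrow> \<delta>\<^sub>1 T \<le> \<delta>\<^sub>2 T"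
    and le': "\<And>T. finite T \<Longrightarrow> T \<subseteq> I \<Longrightarrow> \<delta>\<^sub>2 T \<le> \<delta>\<^sub>1 T + \<epsilon>"
  shows "pseudodiversity (I \<times> {s, t}) (layered \<delta>\<^sub>1 \<delta>\<^sub>2 \<epsilon> s t)"
  unfolding pseudodiversity_def
proof (intro conjI allI impI ballI)
  let ?D = "layered \<delta>\<^sub>1 \<delta>\<^sub>2 \<epsilon> s t"
  have "0 \<le> \<epsilon>"
    using le'[of "{}"] pseudodiversity_empty[OF P1] pseudodiversity_empty[OF P2] by simp
  show "?D {} = 0"
    unfolding layered_def using pseudodiversity_empty[OF P1] by simp
  show "?D {x} = 0" if "x \<in> I \<times> {s, t}" for x
    unfolding layered_def using pseudodiversity_singleton[OF P1, of "fst x"]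
      pseudodiversity_singleton[OF P2, of "fst x"] that \<open>s \<noteq> t\<close> by auto
  show "?D S \<le> ?D T" if H: "finite T \<and> T \<subseteq> I \<times> {s, t} \<and> S \<subseteq> T" for S T
  proof -
    have T: "finite (fst ` T)" "fst ` T \<subseteq> I" "fst ` S \<subseteq> fst ` T" "snd ` S \<subseteq> snd ` T"
      using H by auto
    then have S: "finite (fst ` S)" "fst ` S \<subseteq> I"
      using finite_subset by auto
    have "\<delta>\<^sub>1 (fst ` S) \<le> \<delta>\<^sub>1 (fst ` T)" "\<delta>\<^sub>2 (fst ` S) \<le> \<delta>\<^sub>2 (fst ` T)"
      using pseudodiversity_mono[OF P1 T(1-3)] pseudodiversity_mono[OF P2 T(1-3)] by auto
    moreover have "s \<in> snd ` T" if S': "t \<notin> snd ` S" "t \<in> snd ` T" "S \<noteq> {}"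
    proof -
      obtain x where "x \<in> S" using S'(3) by blast
      then show ?thesis using S'(1) H by force
    qed
    moreover have "0 \<le> \<delta>\<^sub>2 (fst ` T)"
      using pseudodiversity_nonneg[OF P2 T(1,2)] .
    moreover have "\<delta>\<^sub>1 {} = 0"
      using pseudodiversity_empty[OF P1] .
    ultimately show ?thesis
      unfolding layered_def using T(4) le[OF T(1,2)] le'[OF T(1,2)] \<open>0 \<le> \<epsilon>\<close>
      by (cases "S = {}") auto
  qed
  show "?D (S \<union> T) \<le> ?D S + ?D T"
    if H: "finite S \<and> S \<subseteq> I \<times> {s, t} \<and> finite T \<and> T \<subseteq> I \<times> {s, t} \<and> S \<inter> T \<noteq> {}" for S T
  proof -
    have S: "finite (fst ` S)" "fst ` S \<subseteq> I" and T: "finite (fst ` T)" "fst ` T \<subseteq> I"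
      and meet: "fst ` S \<inter> fst ` T \<noteq> {}"
      using H by auto
    have un1: "\<delta>\<^sub>1 (fst ` (S \<union> T)) \<le> \<delta>\<^sub>1 (fst ` S) + \<delta>\<^sub>1 (fst ` T)"
      and un2: "\<delta>\<^sub>2 (fst ` (S \<union> T)) \<le> \<delta>\<^sub>2 (fst ` S) + \<delta>\<^sub>2 (fst ` T)"
      unfolding image_Un using pseudodiversity_Un[OF P1 S T meet] pseudodiversity_Un[OF P2 S T meet]
      by auto
    obtain x where "x \<in> S" "x \<in> T" using H by auto
    then have "snd x \<in> snd ` S" "snd x \<in> snd ` T" "snd x = s \<or> snd x = t"
      using H by auto
    then have "s \<in> snd ` S \<and> s \<in> snd ` T \<or> t \<in> snd ` S \<and> t \<in> snd ` T"
      by auto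
    then show ?thesis
      unfolding layered_def image_Un[of snd] using un1 un2 le[OF S] le[OF T] \<open>0 \<le> \<epsilon>\<close> by auto
  qed
qed

lemma layered_lower: "s \<noteq> t \<Longrightarrow> layered \<delta>\<^sub>1 \<delta>\<^sub>2 \<epsilon> s t ((\<lambda>i. (i, s)) ` T) = \<delta>\<^sub>1 T"
  unfolding layered_def by (auto simp: image_image)

lemma layered_upper:
  "s \<noteq> t \<Longrightarrow> \<delta>\<^sub>1 {} = \<delta>\<^sub>2 {} \<Longrightarrow> layered \<delta>\<^sub>1 \<delta>\<^sub>2 \<epsilon> s t ((\<lambda>i. (i, t)) ` T) = \<delta>\<^sub>2 T"
  unfolding layered_def by (cases "T = {}") (auto simp: image_image)

text \<open>
  In general neither of \<open>\<delta>\<^sub>1\<close> and \<open>\<delta>\<^sub>2\<close> lies below the other, but both lie below their maximum. The layers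
  0 and 2 carry \<open>\<delta>\<^sub>1\<close> and \<open>\<delta>\<^sub>2\<close>, the layer 1 carries the maximum, and the two pairs of neighbouring layers
  are amalgamated along layer 1.
\<close>

lemma close_pseudodiversities_amalgam:
  assumes "finite I" and P: "pseudodiversity I \<delta>\<^sub>1" "pseudodiversity I \<delta>\<^sub>2"
    and near: "\<And>T. T \<subseteq> I \<Longrightarrow> \<bar>\<delta>\<^sub>1 T - \<delta>\<^sub>2 T\<bar> \<le> \<epsilon>"
  obtains X :: "('c \<times> nat) set" and \<Delta> where "finite X" "pseudodiversity X \<Delta>"
    "\<forall>i\<in>I. (i, 0) \<in> X \<and> (i, 2) \<in> X"
    "\<forall>T\<subseteq>I. \<Delta> ((\<lambda>i. (i, 0)) ` T) = \<delta>\<^sub>1 T"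
    "\<forall>T\<subseteq>I. \<Delta> ((\<lambda>i. (i, 2)) ` T) = \<delta>\<^sub>2 T"
    "\<forall>i\<in>I. \<Delta> {(i, 0), (i, 2)} \<le> 2 * \<epsilon>"
proof -
  define \<mu> where "\<mu> = (\<lambda>T. max (\<delta>\<^sub>1 T) (\<delta>\<^sub>2 T))"
  have \<mu>: "pseudodiversity I \<mu>"
    unfolding \<mu>_def by (rule pseudodiversity_max[OF P])
  let ?X = "I \<times> {0, 1 :: nat}" and ?Y = "I \<times> {2, 1 :: nat}"
  let ?D1 = "layered \<delta>\<^sub>1 \<mu> \<epsilon> (0 :: nat) 1" and ?D2 = "layered \<delta>\<^sub>2 \<mu> \<epsilon> (2 :: nat) 1"
  \<comment> \<open>The maximum exceeds each of the two by at most \<open>\<epsilon>\<close>.\<close>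
  have P1: "pseudodiversity ?X ?D1"
  proof (rule layered_pseudodiversity[OF P(1) \<mu>])
    show "\<mu> T \<le> \<delta>\<^sub>1 T + \<epsilon>" if "T \<subseteq> I" for T
      using near[OF that] unfolding \<mu>_def by (auto simp: abs_le_iff)
  qed (simp_all add: \<mu>_def)
  have P2: "pseudodiversity ?Y ?D2"
  proof (rule layered_pseudodiversity[OF P(2) \<mu>])
    show "\<mu> T \<le> \<delta>\<^sub>2 T + \<epsilon>" if "T \<subseteq> I" for T
      using near[OF that] unfolding \<mu>_def by (auto simp: abs_le_iff)
  qed (simp_all add: \<mu>_def)
  have empty: "\<delta>\<^sub>1 {} = \<mu> {}" "\<delta>\<^sub>2 {} = \<mu> {}"
    using P \<mu> by (simp_all add: pseudodiversity_empty)
  have agree: "?D1 T = ?D2 T" if "T \<subseteq> ?X \<inter> ?Y" for T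
  proof -
    have "T = (\<lambda>i. (i, 1)) ` fst ` T"
      using that by force
    then show ?thesis
      using layered_upper[of 0 "1 :: nat" \<delta>\<^sub>1 \<mu> \<epsilon> "fst ` T"] layered_upper[of 2 "1 :: nat" \<delta>\<^sub>2 \<mu> \<epsilon> "fst ` T"]
        empty by simp
  qed
  have fin: "finite ?X" "finite ?Y" using assms(1) by auto
  obtain \<Delta> where \<Delta>: "pseudodiversity (?X \<union> ?Y) \<Delta>" "\<forall>T\<subseteq>?X. \<Delta> T = ?D1 T" "\<forall>T\<subseteq>?Y. \<Delta> T = ?D2 T"
    by (rule pseudodiversity_amalgam[OF fin P1 P2 agree])
  show ?thesis
  proof (rule that[of "?X \<union> ?Y" \<Delta>])
    show "finite (?X \<union> ?Y)" using fin by simp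
    show "pseudodiversity (?X \<union> ?Y) \<Delta>" by (rule \<Delta>(1))
    show "\<forall>i\<in>I. (i, 0) \<in> ?X \<union> ?Y \<and> (i, 2) \<in> ?X \<union> ?Y" by simp
    show "\<forall>T\<subseteq>I. \<Delta> ((\<lambda>i. (i, 0)) ` T) = \<delta>\<^sub>1 T"
    proof (intro allI impI)
      fix T assume "T \<subseteq> I"
      then have "(\<lambda>i. (i, 0)) ` T \<subseteq> ?X" by auto
      then show "\<Delta> ((\<lambda>i. (i, 0)) ` T) = \<delta>\<^sub>1 T"
        using \<Delta>(2) layered_lower[of 0 "1 :: nat" \<delta>\<^sub>1 \<mu> \<epsilon> T] by simp
    qed
    show "\<forall>T\<subseteq>I. \<Delta> ((\<lambda>i. (i, 2)) ` T) = \<delta>\<^sub>2 T"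
    proof (intro allI impI)
      fix T assume "T \<subseteq> I"
      then have "(\<lambda>i. (i, 2)) ` T \<subseteq> ?Y" by auto
      then show "\<Delta> ((\<lambda>i. (i, 2)) ` T) = \<delta>\<^sub>2 T"
        using \<Delta>(3) layered_lower[of 2 "1 :: nat" \<delta>\<^sub>2 \<mu> \<epsilon> T] by simp
    qed
    show "\<forall>i\<in>I. \<Delta> {(i, 0), (i, 2)} \<le> 2 * \<epsilon>"
    proof
      fix i assume i: "i \<in> I"
      have "\<Delta> {(i, 0), (i, 2)} \<le> \<Delta> {(i, 0), (i, 1)} + \<Delta> {(i, 1), (i, 2)}"
        using i by (intro pseudodiversity_triangle[OF \<Delta>(1)]) auto
      also have "\<Delta> {(i, 0), (i, 1)} = ?D1 {(i, 0), (i, 1)}"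
        using i \<Delta>(2) by simp
      also have "\<dots> = \<epsilon>"
        unfolding layered_def using pseudodiversity_singleton[OF P(1) i] by simp
      also have "\<Delta> {(i, 1), (i, 2)} = ?D2 {(i, 1), (i, 2)}"
        using i \<Delta>(3) by simp
      also have "\<dots> = \<epsilon>"
        unfolding layered_def using pseudodiversity_singleton[OF P(2) i] by simp
      finally show "\<Delta> {(i, 0), (i, 2)} \<le> 2 * \<epsilon>" by simp
    qed
  qed
qed

lemma tuple_dist_nonneg: "0 \<le> tuple_dist C xs ys"
  and tuple_dist_ge: "i < length xs \<Longrightarrow> sdist C (xs ! i) (ys ! i) \<le> tuple_dist C xs ys"
  unfolding tuple_dist_def by (auto intro!: Max_ge)

lemma tuple_dist_le:
  "0 \<le> c \<Longrightarrow> (\<And>i. i < length xs \<Longrightarrow> sdist C (xs ! i) (ys ! i) \<le> c) \<Longrightarrow> tuple_dist C xs ys \<le> c"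
  unfolding tuple_dist_def by (subst Max_le_iff) auto

lemma dK_le_tuple_dist:
  assumes "C \<in> K" "enum_embedding ar f a C" "enum_embedding ar g b C"
  shows "dK ar K a b \<le> tuple_dist C (map f (snd a)) (map g (snd b))"
  unfolding dK_def
proof (rule cInf_lower)
  show "bdd_below {tuple_dist C (map f (snd a)) (map g (snd b)) |C f g.
      C \<in> K \<and> enum_embedding ar f a C \<and> enum_embedding ar g b C}"
    by (rule bdd_belowI[of _ 0]) (use tuple_dist_nonneg in blast)
qed (use assms in blast)

lemma dK_le:
  fixes A B :: "('a, nat) mstructure"
  assumes inf: "infinite (UNIV :: 'a set)"
    and A: "carries A \<alpha>" "set as \<subseteq> univ A" "length as = n"
    and B: "carries B \<beta>" "set bs \<subseteq> univ B" "length bs = n"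
    and near: "\<And>T. T \<subseteq> {..<n} \<Longrightarrow> \<bar>\<alpha> ((!) as ` T) - \<beta> ((!) bs ` T)\<bar> \<le> \<epsilon>"
  shows "dK Suc finite_diversities (A, as) (B, bs) \<le> 2 * \<epsilon>"
proof -
  have P1: "pseudodiversity {..<n} (\<lambda>T. \<alpha> ((!) as ` T))" and P2: "pseudodiversity {..<n} (\<lambda>T. \<beta> ((!) bs ` T))"
    using pseudodiversity_nth[OF A(1,2)] pseudodiversity_nth[OF B(1,2)] A(3) B(3) by simp_all
  obtain X \<Delta> where X: "finite X" "pseudodiversity X \<Delta>"
    "\<forall>i\<in>{..<n}. (i, 0 :: nat) \<in> X \<and> (i, 2) \<in> X"
    "\<forall>T\<subseteq>{..<n}. \<Delta> ((\<lambda>i. (i, 0)) ` T) = \<alpha> ((!) as ` T)"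
    "\<forall>T\<subseteq>{..<n}. \<Delta> ((\<lambda>i. (i, 2)) ` T) = \<beta> ((!) bs ` T)"
    "\<forall>i\<in>{..<n}. \<Delta> {(i, 0), (i, 2)} \<le> 2 * \<epsilon>"
    by (rule close_pseudodiversities_amalgam[OF finite_lessThan P1 P2 near])
  obtain D :: "('a, nat) mstructure" and d p where D: "D \<in> finite_diversities" "carries D d"
    "p ` X = univ D" "\<forall>T\<subseteq>X. d (p ` T) = \<Delta> T"
    by (rule finite_structure_exists[OF inf X(1,2)])
  have p: "p (i, 0) \<in> univ D" "p (i, 2) \<in> univ D" if "i < n" for i
    using X(3) D(3) that by auto
  have eq: "d ((\<lambda>i. p (i, 0)) ` T) = \<alpha> ((!) as ` T)" "d ((\<lambda>i. p (i, 2)) ` T) = \<beta> ((!) bs ` T)"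
    if "T \<subseteq> {..<n}" for T
  proof -
    have "(\<lambda>i. (i, 0)) ` T \<subseteq> X" "(\<lambda>i. (i, 2)) ` T \<subseteq> X"
      using X(3) that by auto
    moreover have "(\<lambda>i. p (i, 0)) ` T = p ` (\<lambda>i. (i, 0)) ` T" "(\<lambda>i. p (i, 2)) ` T = p ` (\<lambda>i. (i, 2)) ` T"
      by (simp_all add: image_image)
    ultimately show "d ((\<lambda>i. p (i, 0)) ` T) = \<alpha> ((!) as ` T)" "d ((\<lambda>i. p (i, 2)) ` T) = \<beta> ((!) bs ` T)"
      using D(4) X(4,5) that by simp_all
  qed
  obtain f where f: "enum_embedding Suc f (A, as) D" "\<forall>i<length as. f (as ! i) = p (i, 0)"
    by (rule enum_embedding_nth[OF A(1) D(2) A(2), of "\<lambda>i. p (i, 0)"]) (use p eq A(3) in simp_all)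
  obtain g where g: "enum_embedding Suc g (B, bs) D" "\<forall>i<length bs. g (bs ! i) = p (i, 2)"
    by (rule enum_embedding_nth[OF B(1) D(2) B(2), of "\<lambda>i. p (i, 2)"]) (use p eq B(3) in simp_all)
  have "0 \<le> \<epsilon>"
    using near[of "{}"] by auto
  have "tuple_dist D (map f as) (map g bs) \<le> 2 * \<epsilon>"
  proof (rule tuple_dist_le)
    fix i assume "i < length (map f as)"
    then have i: "i < n" using A(3) by simp
    have "sdist D (p (i, 0)) (p (i, 2)) = d (p ` {(i, 0), (i, 2)})"
      using carries_sdist[OF D(2)] p i by simp
    also have "\<dots> = \<Delta> {(i, 0), (i, 2)}"
      using D(4)[rule_format, of "{(i, 0), (i, 2)}"] X(3) i by simp
    finally show "sdist D (map f as ! i) (map g bs ! i) \<le> 2 * \<epsilon>"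
      using i A(3) B(3) f(2) g(2) X(6) by simp
  qed (use \<open>0 \<le> \<epsilon>\<close> in simp)
  then show ?thesis
    using dK_le_tuple_dist[OF D(1) f(1) g(1)] by simp
qed

text \<open>
  By joint embedding the infimum in \<open>dK\<close> is taken over a nonempty set.
\<close>

lemma dK_set_nonempty:
  fixes a b :: "('a, nat) enumerated"
  assumes inf: "infinite (UNIV :: 'a set)"
    and "a \<in> enumerated_structures finite_diversities n" "b \<in> enumerated_structures finite_diversities n"
  shows "{tuple_dist C (map f (snd a)) (map g (snd b)) | C f g. C \<in> finite_diversities \<and>
    enum_embedding Suc f a C \<and> enum_embedding Suc g b (C :: ('a, nat) mstructure)} \<noteq> {}"
proof -
  have K: "fst a \<in> finite_diversities" "fst b \<in> finite_diversities"
    using assms(2,3) unfolding enumerated_structures_def by auto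
  then obtain C :: "('a, nat) mstructure" and f g where
    C: "C \<in> finite_diversities" "embedding Suc f (fst a) C" "embedding Suc g (fst b) C"
    using JEP_finite_diversities[OF inf] unfolding JEP_def by meson
  have restrict: "embedding Suc f (induced A S) C" if "embedding Suc f A C"
    for f S and A :: "('a, nat) mstructure"
  proof -
    have "interp (induced A S) s xs = interp A s xs" for s xs
      by (cases s) simp_all
    then show ?thesis
      using that unfolding embedding_def tuples_def by auto
  qed
  have "enum_embedding Suc f a C" "enum_embedding Suc g b C"
    unfolding enum_embedding_def using restrict C(2,3) by auto
  then show ?thesis using C(1) by blast
qed

lemma dK_nonneg:
  assumes "infinite (UNIV :: 'a set)"
    and "a \<in> enumerated_structures (finite_diversities :: ('a, nat) mstructure set) n"
    and "b \<in> enumerated_structures finite_diversities n"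
  shows "0 \<le> dK Suc finite_diversities a b"
  unfolding dK_def
  by (rule cInf_greatest[OF dK_set_nonempty[OF assms]]) (use tuple_dist_nonneg in blast)

lemma index_values_near:
  fixes A B :: "('a, nat) mstructure"
  assumes inf: "infinite (UNIV :: 'a set)"
    and K: "(A, as) \<in> enumerated_structures finite_diversities n"
      "(B, bs) \<in> enumerated_structures finite_diversities n"
    and \<alpha>: "carries A \<alpha>" and \<beta>: "carries B \<beta>"
    and "dK Suc finite_diversities (A, as) (B, bs) < \<eta>" and T: "T \<subseteq> {..<n}"
  shows "\<bar>\<alpha> ((!) as ` T) - \<beta> ((!) bs ` T)\<bar> \<le> real n * \<eta>"
proof -
  note a = enumerated_structuresD[OF K(1)] and b = enumerated_structuresD[OF K(2)]
  obtain C f g where C: "C \<in> (finite_diversities :: ('a, nat) mstructure set)"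
    "enum_embedding Suc f (A, as) C" "enum_embedding Suc g (B, bs) C"
    "tuple_dist C (map f as) (map g bs) < \<eta>"
    using cInf_lessD[OF dK_set_nonempty[OF inf K] assms(6)[unfolded dK_def]] by auto
  then obtain \<gamma> where \<gamma>: "carries C \<gamma>"
    unfolding finite_diversities_carries by blast
  have f: "f ` set as \<subseteq> univ C" "\<forall>T\<subseteq>set as. \<gamma> (f ` T) = \<alpha> T"
    and g: "g ` set bs \<subseteq> univ C" "\<forall>T\<subseteq>set bs. \<gamma> (g ` T) = \<beta> T"
    using C(2,3) unfolding enum_embedding_iff[OF \<alpha> \<gamma> a(3)] enum_embedding_iff[OF \<beta> \<gamma> b(3)] by auto
  have sub: "(!) as ` T \<subseteq> set as" "(!) bs ` T \<subseteq> set bs"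
    using T a(4) b(4) by auto
  have "finite T" using T finite_subset by blast
  have "\<bar>\<gamma> ((\<lambda>i. f (as ! i)) ` T) - \<gamma> ((\<lambda>i. g (bs ! i)) ` T)\<bar> \<le> real (card T) * \<eta>"
  proof (rule pseudodiversity_lipschitz_bound[OF carries_pseudodiversity[OF \<gamma>] \<open>finite T\<close>])
    show "(\<lambda>i. f (as ! i)) ` T \<subseteq> univ C" "(\<lambda>i. g (bs ! i)) ` T \<subseteq> univ C"
      using f(1) g(1) sub by (simp_all add: image_subset_iff)
    fix i assume "i \<in> T"
    then have i: "i < n" using T by auto
    have "f (as ! i) \<in> univ C" "g (bs ! i) \<in> univ C"
      using f(1) g(1) i a(4) b(4) by auto
    then have "\<gamma> {f (as ! i), g (bs ! i)} = sdist C (map f as ! i) (map g bs ! i)"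
      using carries_sdist[OF \<gamma>] i a(4) b(4) by simp
    also have "\<dots> \<le> tuple_dist C (map f as) (map g bs)"
      using i a(4) by (intro tuple_dist_ge) simp
    finally show "\<gamma> {f (as ! i), g (bs ! i)} \<le> \<eta>" using C(4) by simp
  qed
  moreover have "(\<lambda>i. f (as ! i)) ` T = f ` (!) as ` T" "(\<lambda>i. g (bs ! i)) ` T = g ` (!) bs ` T"
    by (simp_all add: image_image)
  ultimately have "\<bar>\<alpha> ((!) as ` T) - \<beta> ((!) bs ` T)\<bar> \<le> real (card T) * \<eta>"
    using f(2) g(2) sub by simp
  also have "\<dots> \<le> real n * \<eta>"
  proof (rule mult_right_mono)
    show "real (card T) \<le> real n"
      using T card_mono[of "{..<n}" T] by simp
    show "0 \<le> \<eta>"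
      using C(4) tuple_dist_nonneg[of C "map f as" "map g bs"] by linarith
  qed
  finally show ?thesis .
qed

lemma CP_finite_diversities:
  assumes inf: "infinite (UNIV :: 'a set)"
  shows "CP Suc (finite_diversities :: ('a, nat) mstructure set)"
  unfolding CP_def
proof (intro allI ballI impI)
  let ?K = "finite_diversities :: ('a, nat) mstructure set"
  fix s and a and \<epsilon> :: real
  assume a: "a \<in> enumerated_structures ?K (arity Suc s)" and "0 < \<epsilon>"
  define n where "n = arity Suc s"
  have val: "value_at s (A, as) = \<alpha> ((!) as ` {..<n})"
    if "(A, as) \<in> enumerated_structures ?K n" "carries A \<alpha>" for A as \<alpha>
  proof -
    have "as \<in> tuples (univ A) (arity Suc s)"
      using that(1) unfolding enumerated_structures_def n_def by simp
    moreover have "set as = (!) as ` {..<n}"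
      using that(1) unfolding enumerated_structures_def tuples_def by (auto simp: set_conv_nth)
    ultimately show ?thesis
      unfolding value_at_def using interp_carries[OF that(2)] by simp
  qed
  have "n > 0" unfolding n_def by (cases s) simp_all
  show "\<exists>\<eta>>0. \<forall>b\<in>enumerated_structures ?K (arity Suc s).
      dK Suc ?K a b < \<eta> \<longrightarrow> \<bar>value_at s a - value_at s b\<bar> < \<epsilon>"
  proof (intro exI[of _ "\<epsilon> / (2 * n)"] conjI ballI impI)
    show "0 < \<epsilon> / real (2 * n)" using \<open>0 < \<epsilon>\<close> \<open>n > 0\<close> by simp
    fix b assume b: "b \<in> enumerated_structures ?K (arity Suc s)" and lt: "dK Suc ?K a b < \<epsilon> / real (2 * n)"
    obtain A as B bs where ab: "a = (A, as)" "b = (B, bs)" by (cases a, cases b)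
    then have K: "(A, as) \<in> enumerated_structures ?K n" "(B, bs) \<in> enumerated_structures ?K n"
      using a b unfolding n_def by simp_all
    obtain \<alpha> \<beta> where car: "carries A \<alpha>" "carries B \<beta>"
      using enumerated_structuresD(1)[OF K(1)] enumerated_structuresD(1)[OF K(2)] by blast
    have "\<bar>\<alpha> ((!) as ` {..<n}) - \<beta> ((!) bs ` {..<n})\<bar> \<le> real n * (\<epsilon> / real (2 * n))"
      using lt unfolding ab by (intro index_values_near[OF inf K car]) auto
    also have "\<dots> = \<epsilon> / 2" using \<open>n > 0\<close> by simp
    finally show "\<bar>value_at s a - value_at s b\<bar> < \<epsilon>"
      unfolding ab using val[OF K(1) car(1)] val[OF K(2) car(2)] \<open>0 < \<epsilon>\<close> by simp
  qed
qed

text \<open>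
  For each \<open>m\<close>, one member is picked from each cell of the grid of mesh \<open>1 / Suc m\<close> in \<open>\<real>\<^sup>P\<close> that is
  occupied by the family.
\<close>

lemma countable_dense_family:
  fixes v :: "'e \<Rightarrow> 'x \<Rightarrow> real"
  assumes "finite P"
  obtains Q where "countable Q" "Q \<subseteq> E" "\<forall>e\<in>E. \<forall>\<epsilon>>0. \<exists>q\<in>Q. \<forall>t\<in>P. \<bar>v q t - v e t\<bar> < \<epsilon>"
proof -
  obtain ts where ts: "set ts = P" using finite_list[OF assms] by blast
  define cell :: "nat \<Rightarrow> 'e \<Rightarrow> int list" where "cell = (\<lambda>m e. map (\<lambda>t. \<lfloor>real (Suc m) * v e t\<rfloor>) ts)"
  define pick where "pick = (\<lambda>m c. SOME e. e \<in> E \<and> cell m e = c)"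
  have pick: "pick m (cell m e) \<in> E \<and> cell m (pick m (cell m e)) = cell m e" if "e \<in> E" for m e
    unfolding pick_def using that by (intro someI[of "\<lambda>e'. e' \<in> E \<and> cell m e' = cell m e" e]) simp
  define Q where "Q = (\<Union>m. pick m ` cell m ` E)"
  show ?thesis
  proof (rule that[of Q])
    show "countable Q"
    proof -
      have "countable (pick m ` cell m ` E)" for m
        by (rule countable_image) (rule countableI_type)
      then show ?thesis
        unfolding Q_def by blast
    qed
    show "Q \<subseteq> E"
      unfolding Q_def using pick by auto
    show "\<forall>e\<in>E. \<forall>\<epsilon>>0. \<exists>q\<in>Q. \<forall>t\<in>P. \<bar>v q t - v e t\<bar> < \<epsilon>"
    proof (intro ballI allI impI)
      fix e and \<epsilon> :: real assume e: "e \<in> E" and "\<epsilon> > 0"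
      obtain m where m: "1 / real (Suc m) < \<epsilon>"
        using nat_approx_posE[OF \<open>\<epsilon> > 0\<close>] by blast
      define q where "q = pick m (cell m e)"
      have "\<bar>v q t - v e t\<bar> < \<epsilon>" if "t \<in> P" for t
      proof -
        have "\<lfloor>real (Suc m) * v q t\<rfloor> = \<lfloor>real (Suc m) * v e t\<rfloor>"
          using pick[OF e, of m] that ts unfolding q_def cell_def by auto
        then have "\<bar>real (Suc m) * v q t - real (Suc m) * v e t\<bar> < 1"
          by linarith
        then have "real (Suc m) * \<bar>v q t - v e t\<bar> < 1"
          by (simp add: abs_mult right_diff_distrib[symmetric] del: of_nat_Suc)
        then have "\<bar>v q t - v e t\<bar> < 1 / real (Suc m)"
          by (simp add: field_simps del: of_nat_Suc)
        then show ?thesis using m by simp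
      qed
      moreover have "q \<in> Q"
        unfolding Q_def q_def using e by blast
      ultimately show "\<exists>q\<in>Q. \<forall>t\<in>P. \<bar>v q t - v e t\<bar> < \<epsilon>"
        by blast
    qed
  qed
qed

text \<open>
  The map \<open>v\<close> sends a tuple to the pseudodiversity on its indices. By \<open>dK_le\<close> and \<open>index_values_near\<close>
  the distance of tuples is equivalent to the maximal difference of the values of \<open>v\<close>, and the range of
  \<open>v\<close> consists of all pseudodiversities on \<open>{..<n}\<close>, which are closed under pointwise limits.
\<close>

lemma PP_finite_diversities:
  assumes inf: "infinite (UNIV :: 'a set)"
  shows "PP Suc (finite_diversities :: ('a, nat) mstructure set)"
  unfolding PP_def
proof (intro allI conjI impI)
  let ?K = "finite_diversities :: ('a, nat) mstructure set"
  fix n :: nat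
  let ?E = "enumerated_structures ?K n"
  define v :: "('a, nat) enumerated \<Rightarrow> nat set \<Rightarrow> real"
    where "v = (\<lambda>a T. (SOME \<alpha>. carries (fst a) \<alpha>) ((!) (snd a) ` T))"
  have some: "carries A (SOME \<alpha>. carries A \<alpha>)" if "(A, as) \<in> ?E" for A as
    using enumerated_structuresD(1)[OF that] by (rule someI_ex)
  have dK_le_v: "dK Suc ?K a b \<le> 2 * \<epsilon>"
    if "a \<in> ?E" "b \<in> ?E" "\<And>T. T \<subseteq> {..<n} \<Longrightarrow> \<bar>v a T - v b T\<bar> \<le> \<epsilon>" for a b \<epsilon>
  proof -
    obtain A as B bs where ab: "a = (A, as)" "b = (B, bs)" by (cases a, cases b)
    note K = that(1)[unfolded ab] that(2)[unfolded ab]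
    show ?thesis
      using that(3) enumerated_structuresD[OF K(1)] enumerated_structuresD[OF K(2)]
      unfolding ab v_def fst_conv snd_conv
      by (intro dK_le[OF inf some[OF K(1)] _ _ some[OF K(2)]]) auto
  qed
  have v_near: "\<bar>v a T - v b T\<bar> \<le> real n * \<eta>"
    if "a \<in> ?E" "b \<in> ?E" "dK Suc ?K a b < \<eta>" "T \<subseteq> {..<n}" for a b \<eta> T
  proof -
    obtain A as B bs where ab: "a = (A, as)" "b = (B, bs)" by (cases a, cases b)
    note K = that(1)[unfolded ab] that(2)[unfolded ab]
    show ?thesis
      using that(3,4) unfolding ab v_def fst_conv snd_conv
      by (intro index_values_near[OF inf K some[OF K(1)] some[OF K(2)]])
  qed
  have v_pseudo: "pseudodiversity {..<n} (v a)" if "a \<in> ?E" for a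
  proof -
    obtain A as where a: "a = (A, as)" by (cases a)
    note K = that[unfolded a]
    show ?thesis
      using pseudodiversity_nth[OF some[OF K] enumerated_structuresD(3)[OF K]]
        enumerated_structuresD(4)[OF K] unfolding a v_def by simp
  qed
  obtain Q where Q: "countable Q" "Q \<subseteq> ?E" "\<forall>e\<in>?E. \<forall>\<epsilon>>0. \<exists>q\<in>Q. \<forall>t\<in>Pow {..<n}. \<bar>v q t - v e t\<bar> < \<epsilon>"
    by (rule countable_dense_family[of "Pow {..<n}" ?E v]) simp
  have "\<exists>q\<in>Q. dK Suc ?K a q < \<epsilon>" if a: "a \<in> ?E" and "\<epsilon> > 0" for a \<epsilon>
  proof -
    have "\<epsilon> / 4 > 0" using that by simp
    then obtain q where q: "q \<in> Q" "\<forall>t\<in>Pow {..<n}. \<bar>v q t - v a t\<bar> < \<epsilon> / 4"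
      using Q(3) a by meson
    have "dK Suc ?K a q \<le> 2 * (\<epsilon> / 4)"
    proof (rule dK_le_v[OF a])
      show "q \<in> ?E" using q Q(2) by blast
      show "\<bar>v a T - v q T\<bar> \<le> \<epsilon> / 4" if "T \<subseteq> {..<n}" for T
        using q(2)[rule_format, of T] that by (simp add: abs_minus_commute)
    qed
    then show ?thesis using q(1) \<open>\<epsilon> > 0\<close> by (intro bexI[of _ q]) auto
  qed
  then show "\<exists>Q. countable Q \<and> Q \<subseteq> ?E \<and> (\<forall>a\<in>?E. \<forall>\<epsilon>>0. \<exists>q\<in>Q. dK Suc ?K a q < \<epsilon>)"
    using Q(1,2) by blast
  fix \<sigma> :: "nat \<Rightarrow> ('a, nat) enumerated"
  assume H: "(\<forall>k. \<sigma> k \<in> ?E) \<and> (\<forall>\<epsilon>>0. \<exists>N. \<forall>j\<ge>N. \<forall>k\<ge>N. dK Suc ?K (\<sigma> j) (\<sigma> k) < \<epsilon>)"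
  then have \<sigma>: "\<sigma> k \<in> ?E" for k by blast
  have "convergent (\<lambda>k. v (\<sigma> k) T)" if T: "T \<subseteq> {..<n}" for T
  proof (rule Cauchy_convergent, rule metric_CauchyI)
    fix \<epsilon> :: real assume "\<epsilon> > 0"
    then have "\<epsilon> / (2 * Suc n) > 0" by simp
    then obtain N where N: "\<forall>j\<ge>N. \<forall>k\<ge>N. dK Suc ?K (\<sigma> j) (\<sigma> k) < \<epsilon> / (2 * Suc n)"
      using H by meson
    have "dist (v (\<sigma> j) T) (v (\<sigma> k) T) < \<epsilon>" if "j \<ge> N" "k \<ge> N" for j k
    proof -
      have "\<bar>v (\<sigma> j) T - v (\<sigma> k) T\<bar> \<le> real n * (\<epsilon> / (2 * Suc n))"
        using N that by (intro v_near \<sigma> T) blast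
      also have "\<dots> \<le> \<epsilon> / 2"
        using \<open>\<epsilon> > 0\<close> by (simp add: field_simps)
      finally show ?thesis using \<open>\<epsilon> > 0\<close> by (simp add: dist_real_def)
    qed
    then show "\<exists>N. \<forall>j\<ge>N. \<forall>k\<ge>N. dist (v (\<sigma> j) T) (v (\<sigma> k) T) < \<epsilon>" by blast
  qed
  then have lim: "(\<lambda>k. v (\<sigma> k) T) \<longlonglongrightarrow> lim (\<lambda>k. v (\<sigma> k) T)" if "T \<subseteq> {..<n}" for T
    using that by (simp add: convergent_LIMSEQ_iff)
  define l where "l = (\<lambda>T. lim (\<lambda>k. v (\<sigma> k) T))"
  have Pl: "pseudodiversity {..<n} l"
    using v_pseudo[OF \<sigma>] lim unfolding l_def by (rule pseudodiversity_limit)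
  obtain A :: "('a, nat) mstructure" and \<alpha> p where A: "A \<in> ?K" "carries A \<alpha>" "p ` {..<n} = univ A"
    "\<forall>T\<subseteq>{..<n}. \<alpha> (p ` T) = l T"
    by (rule finite_structure_exists[OF inf finite_lessThan Pl])
  let ?as = "map p [0..<n]"
  have a: "(A, ?as) \<in> ?E"
    unfolding enumerated_structures_def tuples_def using A(1,3) by auto
  have va: "v (A, ?as) T = l T" if T: "T \<subseteq> {..<n}" for T
  proof -
    have "finite T" "(!) ?as ` T = p ` T"
      using T finite_subset by (auto intro!: image_cong)
    moreover have "p ` T \<subseteq> univ A"
      using T A(3) by auto
    ultimately show ?thesis
    proof -
      let ?\<beta> = "SOME \<alpha>. carries A \<alpha>"
      have "embedding Suc id A A"
        unfolding embedding_def by simp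
      from conjunct2[OF iffD1[OF embedding_iff[OF A(2) some[OF a]] this]]
      have "?\<beta> (id ` (p ` T)) = \<alpha> (p ` T)"
        using \<open>finite T\<close> \<open>p ` T \<subseteq> univ A\<close> by simp
      then show ?thesis
        unfolding v_def using \<open>(!) ?as ` T = p ` T\<close> A(4) T by simp
    qed
  qed
  have "(\<lambda>k. dK Suc ?K (\<sigma> k) (A, ?as)) \<longlonglongrightarrow> 0"
  proof (rule LIMSEQ_I)
    fix \<epsilon> :: real assume "\<epsilon> > 0"
    have "\<forall>\<^sub>F k in sequentially. \<forall>T\<in>Pow {..<n}. dist (v (\<sigma> k) T) (l T) < \<epsilon> / 4"
    proof (intro eventually_ball_finite ballI)
      fix T assume "T \<in> Pow {..<n}"
      then show "\<forall>\<^sub>F k in sequentially. dist (v (\<sigma> k) T) (l T) < \<epsilon> / 4"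
        using lim[of T] \<open>\<epsilon> > 0\<close> unfolding l_def by (intro tendstoD) simp_all
    qed simp
    then obtain N where N: "\<forall>k\<ge>N. \<forall>T\<in>Pow {..<n}. dist (v (\<sigma> k) T) (l T) < \<epsilon> / 4"
      unfolding eventually_sequentially by blast
    have "norm (dK Suc ?K (\<sigma> k) (A, ?as) - 0) < \<epsilon>" if "k \<ge> N" for k
    proof -
      have "dK Suc ?K (\<sigma> k) (A, ?as) \<le> 2 * (\<epsilon> / 4)"
      proof (rule dK_le_v[OF \<sigma> a])
        show "\<bar>v (\<sigma> k) T - v (A, ?as) T\<bar> \<le> \<epsilon> / 4" if "T \<subseteq> {..<n}" for T
          using N[rule_format, OF \<open>k \<ge> N\<close>, of T] that va[OF that] by (simp add: dist_real_def)
      qed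
      then show ?thesis
        using dK_nonneg[OF inf \<sigma> a, of k] \<open>\<epsilon> > 0\<close> by simp
    qed
    then show "\<exists>N. \<forall>k\<ge>N. norm (dK Suc ?K (\<sigma> k) (A, ?as) - 0) < \<epsilon>" by blast
  qed
  then show "\<exists>a\<in>?E. (\<lambda>k. dK Suc ?K (\<sigma> k) a) \<longlonglongrightarrow> 0"
    using a by blast
qed

section \<open>A countable universal diversity\<close>

text \<open>
  A one-point variant of the property that defines the limit of the class. Here the base \<open>S\<close> stays fixed
  and the values are approximate, there the values are exact and the base moves.
\<close>

definition approximate_extension_property :: "'c set \<Rightarrow> ('c set \<Rightarrow> real) \<Rightarrow> bool" where
  "approximate_extension_property X \<delta> \<longleftrightarrow>
     (\<forall>S \<phi> \<epsilon>. finite S \<and> S \<subseteq> X \<and> one_point_extension S \<delta> \<phi> \<and> 0 < \<epsilon> \<longrightarrow>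
        (\<exists>z\<in>X. \<forall>T\<subseteq>S. \<bar>\<delta> (insert z T) - \<phi> T\<bar> < \<epsilon>))"

lemma approximate_extension_propertyD:
  assumes "approximate_extension_property X \<delta>" "finite S" "S \<subseteq> X" "one_point_extension S \<delta> \<phi>" "0 < \<epsilon>"
  obtains z where "z \<in> X" "\<forall>T\<subseteq>S. \<bar>\<delta> (insert z T) - \<phi> T\<bar> < \<epsilon>"
proof -
  have "\<exists>z\<in>X. \<forall>T\<subseteq>S. \<bar>\<delta> (insert z T) - \<phi> T\<bar> < \<epsilon>"
    using assms unfolding approximate_extension_property_def by blast
  then show ?thesis using that by (elim bexE) assumption
qed

definition extension_property :: "'c set \<Rightarrow> ('c set \<Rightarrow> real) \<Rightarrow> bool" where
  "extension_property X \<delta> \<longleftrightarrow>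
     (\<forall>S \<phi>. finite S \<and> S \<subseteq> X \<and> one_point_extension S \<delta> \<phi> \<longrightarrow>
        (\<exists>z\<in>X. \<forall>T\<subseteq>S. \<delta> (insert z T) = \<phi> T))"

lemma one_point_extension_exists:
  assumes P: "pseudodiversity S \<delta>" and "finite S"
  shows "\<exists>\<phi>. one_point_extension S \<delta> \<phi>"
proof (cases "S = {}")
  case True
  then have "one_point_extension S \<delta> (\<lambda>_. 0)"
    unfolding one_point_extension_def using pseudodiversity_empty[OF P] by simp
  then show ?thesis by blast
next
  case False
  then obtain s where "s \<in> S" by blast
  then show ?thesis
    using one_point_extension_of_point[OF P assms(2) order_refl] by blast
qed

lemma dense_one_point_extensions:
  assumes P: "pseudodiversity S \<delta>" and "finite S"
  shows "\<exists>e :: nat \<Rightarrow> 'c set \<Rightarrow> real. (\<forall>j. one_point_extension S \<delta> (e j)) \<and>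
     (\<forall>\<phi> \<epsilon>. one_point_extension S \<delta> \<phi> \<and> 0 < \<epsilon> \<longrightarrow> (\<exists>j. \<forall>T\<subseteq>S. \<bar>e j T - \<phi> T\<bar> < \<epsilon>))"
proof -
  let ?E = "{\<phi>. one_point_extension S \<delta> \<phi>}"
  obtain Q where Q: "countable Q" "Q \<subseteq> ?E"
    "\<forall>\<phi>\<in>?E. \<forall>\<epsilon>>0. \<exists>q\<in>Q. \<forall>T\<in>Pow S. \<bar>q T - \<phi> T\<bar> < \<epsilon>"
    by (rule countable_dense_family[of "Pow S" ?E "\<lambda>\<phi>. \<phi>"]) (use assms(2) in simp)
  obtain \<phi>0 where "one_point_extension S \<delta> \<phi>0"
    using one_point_extension_exists[OF assms] by blast
  then have "\<exists>q\<in>Q. \<forall>T\<in>Pow S. \<bar>q T - \<phi>0 T\<bar> < 1"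
    using Q(3) by simp
  then have "Q \<noteq> {}" by blast
  define e where "e = from_nat_into Q"
  have range: "range e = Q"
    unfolding e_def using \<open>Q \<noteq> {}\<close> Q(1) by (rule range_from_nat_into)
  have "one_point_extension S \<delta> (e j)" for j
    using Q(2) range by blast
  moreover have "\<exists>j. \<forall>T\<subseteq>S. \<bar>e j T - \<phi> T\<bar> < \<epsilon>" if H: "one_point_extension S \<delta> \<phi>" "0 < \<epsilon>" for \<phi> \<epsilon>
  proof -
    have "\<exists>q\<in>Q. \<forall>T\<in>Pow S. \<bar>q T - \<phi> T\<bar> < \<epsilon>"
      using Q(3) H by simp
    then obtain q where q: "q \<in> Q" "\<forall>T\<in>Pow S. \<bar>q T - \<phi> T\<bar> < \<epsilon>"
      by (elim bexE)
    then obtain j where "q = e j" using range by blast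
    then show ?thesis using q(2) by (intro exI[of _ j]) simp
  qed
  ultimately show ?thesis by (intro exI[of _ e]) simp
qed

text \<open>
  The number \<open>n\<close> is added to \<open>{..<n}\<close> so as to realize one prescribed one-point extension of one
  prescribed finite set, both decoded from \<open>n\<close>. For each finite set a dense sequence of its one-point
  extensions is fixed; as the sequence depends only on the values of the pseudodiversity on that set, it
  does not change at later stages. Each pair of a set and an index of its sequence is coded by
  arbitrarily large \<open>n\<close>, hence also after all points of the set have been added.
\<close>

lemma countable_universal_pseudodiversity:
  "\<exists>\<delta> :: nat set \<Rightarrow> real. pseudodiversity UNIV \<delta> \<and> approximate_extension_property UNIV \<delta>"
proof -
  define good where "good = (\<lambda>(S :: nat set) \<delta> (e :: nat \<Rightarrow> nat set \<Rightarrow> real).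
     (\<forall>j. one_point_extension S \<delta> (e j)) \<and>
     (\<forall>\<phi> \<epsilon>. one_point_extension S \<delta> \<phi> \<and> 0 < \<epsilon> \<longrightarrow> (\<exists>j. \<forall>T\<subseteq>S. \<bar>e j T - \<phi> T\<bar> < \<epsilon>)))"
  define en where "en = (\<lambda>S \<delta>. SOME e. good S \<delta> e)"
  have en: "good S \<delta> (en S \<delta>)" if "pseudodiversity S \<delta>" "finite S" for S \<delta>
  proof -
    have "\<exists>e. good S \<delta> e"
      unfolding good_def by (rule dense_one_point_extensions[OF that])
    then show ?thesis unfolding en_def by (rule someI_ex)
  qed
  \<comment> \<open>Normalization outside the subsets of \<open>S\<close>, so that the chosen sequence is the same at all stages.\<close>
  define restr where "restr = (\<lambda>(S :: nat set) (\<delta> :: nat set \<Rightarrow> real) T. if T \<subseteq> S then \<delta> T else 0)"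
  \<comment> \<open>The intersection with \<open>{..<n}\<close> makes every \<open>n\<close> code a legitimate task.\<close>
  define base where "base = (\<lambda>n. set_decode (fst (prod_decode (snd (prod_decode n)))) \<inter> {..<n})"
  define index where "index = (\<lambda>n. snd (prod_decode (snd (prod_decode n))))"
  define goal where "goal = (\<lambda>n \<delta>. en (base n) (restr (base n) \<delta>) (index n))"
  have base: "finite (base n)" "base n \<subseteq> {..<n}" for n
    unfolding base_def by auto
  have "\<exists>\<Delta>. \<forall>n. pseudodiversity {..<n} (\<Delta> n) \<and>
      ((\<forall>T. n \<notin> T \<longrightarrow> \<Delta> (Suc n) T = \<Delta> n T) \<and>
       (\<forall>T\<subseteq>base n. \<Delta> (Suc n) (insert n T) = goal n (\<Delta> n) T))"
  proof (rule dependent_nat_choice)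
    show "\<exists>\<delta>. pseudodiversity {..<0 :: nat} \<delta>"
      by (rule exI[of _ "\<lambda>_. 0"]) (simp add: pseudodiversity_def)
    fix \<delta> :: "nat set \<Rightarrow> real" and n
    assume P: "pseudodiversity {..<n} \<delta>"
    have "pseudodiversity (base n) (restr (base n) \<delta>)"
      by (rule pseudodiversity_cong[OF pseudodiversity_subset[OF P base(2)]]) (simp add: restr_def)
    then have "good (base n) (restr (base n) \<delta>) (en (base n) (restr (base n) \<delta>))"
      using en base(1) by blast
    then have "one_point_extension (base n) (restr (base n) \<delta>) (goal n \<delta>)"
      by (simp add: good_def goal_def)
    then have "one_point_extension (base n) \<delta> (goal n \<delta>)"
      by (rule one_point_extension_cong) (simp_all add: restr_def)
    then obtain \<phi> where \<phi>: "one_point_extension {..<n} \<delta> \<phi>" "\<forall>T\<subseteq>base n. \<phi> T = goal n \<delta> T"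
      by (rule one_point_extension_extend[OF finite_lessThan P base(2)])
    let ?\<delta>' = "\<lambda>T. if n \<in> T then \<phi> (T - {n}) else \<delta> T"
    have "pseudodiversity {..<Suc n} ?\<delta>'"
      unfolding lessThan_Suc by (rule pseudodiversity_insert[OF P finite_lessThan \<phi>(1)]) simp
    moreover have "?\<delta>' (insert n T) = goal n \<delta> T" if "T \<subseteq> base n" for T
    proof -
      have "insert n T - {n} = T" using that base(2)[of n] by auto
      then show ?thesis using \<phi>(2) that by simp
    qed
    ultimately show "\<exists>\<delta>'. pseudodiversity {..<Suc n} \<delta>' \<and>
        ((\<forall>T. n \<notin> T \<longrightarrow> \<delta>' T = \<delta> T) \<and> (\<forall>T\<subseteq>base n. \<delta>' (insert n T) = goal n \<delta> T))"
      by (intro exI[of _ ?\<delta>']) simp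
  qed
  then obtain \<Delta> where \<Delta>: "\<forall>n. pseudodiversity {..<n} (\<Delta> n) \<and>
      ((\<forall>T. n \<notin> T \<longrightarrow> \<Delta> (Suc n) T = \<Delta> n T) \<and>
       (\<forall>T\<subseteq>base n. \<Delta> (Suc n) (insert n T) = goal n (\<Delta> n) T))"
    by (elim exE)
  have P: "pseudodiversity {..<n} (\<Delta> n)"
    and old: "n \<notin> T \<Longrightarrow> \<Delta> (Suc n) T = \<Delta> n T"
    and new: "T \<subseteq> base n \<Longrightarrow> \<Delta> (Suc n) (insert n T) = goal n (\<Delta> n) T" for n T
    using \<Delta>[rule_format, of n] by simp_all
  have stable: "\<Delta> n T = \<Delta> m T" if "m \<le> n" "T \<subseteq> {..<m}" for m n T
    using that(1)
  proof (induction n rule: dec_induct)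
    case (step n)
    have "n \<notin> T" using that(2) step.hyps by auto
    then show ?case using old step.IH by simp
  qed simp
  define \<delta> where "\<delta> = (\<lambda>T. \<Delta> (SOME n. T \<subseteq> {..<n}) T)"
  have \<delta>: "\<delta> T = \<Delta> n T" if "T \<subseteq> {..<n}" for T n
  proof -
    let ?k = "SOME n. T \<subseteq> {..<n}"
    have k: "T \<subseteq> {..<?k}" using that by (rule someI)
    show ?thesis
      unfolding \<delta>_def using stable[OF _ k, of n] stable[OF _ that, of ?k] by (cases "?k \<le> n") simp_all
  qed
  have bound: "\<exists>m. F \<subseteq> {..<m}" if "finite F" for F :: "nat set"
    using that finite_nat_iff_bounded by blast
  have P\<delta>: "pseudodiversity UNIV \<delta>"
  proof (rule pseudodiversity_finite_subsets)
    fix F :: "nat set" assume "finite F"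
    then obtain m where m: "F \<subseteq> {..<m}" using bound by blast
    have "pseudodiversity {..<m} \<delta>"
      using P[of m] by (rule pseudodiversity_cong) (rule \<delta>)
    then show "pseudodiversity F \<delta>" using m by (rule pseudodiversity_subset)
  qed
  moreover have "approximate_extension_property UNIV \<delta>"
    unfolding approximate_extension_property_def
  proof (intro allI impI)
    fix S :: "nat set" and \<phi> and \<epsilon> :: real
    assume H: "finite S \<and> S \<subseteq> UNIV \<and> one_point_extension S \<delta> \<phi> \<and> 0 < \<epsilon>"
    have "pseudodiversity S (restr S \<delta>)"
      by (rule pseudodiversity_cong[OF pseudodiversity_subset[OF P\<delta> subset_UNIV]]) (simp add: restr_def)
    then have "good S (restr S \<delta>) (en S (restr S \<delta>))"
      using en H by blast
    moreover have "one_point_extension S (restr S \<delta>) \<phi>"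
      by (rule one_point_extension_cong[of S \<delta> \<phi>]) (use H in \<open>simp_all add: restr_def\<close>)
    ultimately have "\<exists>j. \<forall>T\<subseteq>S. \<bar>en S (restr S \<delta>) j T - \<phi> T\<bar> < \<epsilon>"
      using H by (simp add: good_def)
    then obtain j where j: "\<forall>T\<subseteq>S. \<bar>en S (restr S \<delta>) j T - \<phi> T\<bar> < \<epsilon>"
      by (elim exE)
    obtain m where m: "S \<subseteq> {..<m}" using bound H by blast
    define n where "n = prod_encode (m, prod_encode (set_encode S, j))"
    have "m \<le> n" unfolding n_def by (rule le_prod_encode_1)
    then have S: "S \<subseteq> {..<n}" using m by auto
    have "base n = S" "index n = j"
      using S H unfolding base_def index_def n_def by (simp_all add: set_encode_inverse Int_absorb2)
    moreover have "\<Delta> n T = \<delta> T" if "T \<subseteq> S" for T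
      using \<delta>[OF subset_trans[OF that S]] by simp
    then have "restr S (\<Delta> n) = restr S \<delta>"
      unfolding restr_def by (intro ext) simp
    ultimately have "goal n (\<Delta> n) = en S (restr S \<delta>) j"
      unfolding goal_def by simp
    then have "\<delta> (insert n T) = en S (restr S \<delta>) j T" if "T \<subseteq> S" for T
    proof -
      have "insert n T \<subseteq> {..<Suc n}" using that S by auto
      then show ?thesis
        using \<delta>[of "insert n T" "Suc n"] new[of T n] that \<open>base n = S\<close> \<open>goal n (\<Delta> n) = _\<close> by simp
    qed
    then show "\<exists>z\<in>UNIV. \<forall>T\<subseteq>S. \<bar>\<delta> (insert z T) - \<phi> T\<bar> < \<epsilon>"
      using j by (intro bexI[of _ n]) simp_all
  qed
  ultimately show ?thesis by blast
qed

text \<open>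
  Of the points at mutual distance zero only the least is kept.
\<close>

lemma countable_universal_diversity:
  "\<exists>(X :: nat set) \<delta>. pseudodiversity X \<delta> \<and> (\<forall>x\<in>X. \<forall>y\<in>X. \<delta> {x, y} = 0 \<longrightarrow> x = y) \<and>
     approximate_extension_property X \<delta>"
proof -
  obtain \<delta> :: "nat set \<Rightarrow> real" where P: "pseudodiversity UNIV \<delta>"
    and A: "approximate_extension_property UNIV \<delta>"
    using countable_universal_pseudodiversity by blast
  define X where "X = {n. \<forall>m<n. \<delta> {m, n} \<noteq> 0}"
  have PX: "pseudodiversity X \<delta>"
    using P by (rule pseudodiversity_subset) simp
  moreover have "x = y" if "x \<in> X" "y \<in> X" "\<delta> {x, y} = 0" for x y
    using that unfolding X_def by (cases x y rule: linorder_cases) (auto simp: insert_commute)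
  moreover have rep: "\<exists>m\<in>X. \<delta> {m, n} = 0" for n
  proof -
    define m where "m = (LEAST m. \<delta> {m, n} = 0)"
    have m: "\<delta> {m, n} = 0"
      unfolding m_def by (rule LeastI[of _ n]) (use pseudodiversity_singleton[OF P] in simp)
    have "\<delta> {k, m} \<noteq> 0" if "k < m" for k
    proof
      assume "\<delta> {k, m} = 0"
      then have "\<delta> {k, n} \<le> 0"
        using pseudodiversity_triangle[OF P, of k m n] m by simp
      then have "\<delta> {k, n} = 0"
        using pseudodiversity_nonneg[OF P, of "{k, n}"] by simp
      then show False
        using not_less_Least[of k "\<lambda>m. \<delta> {m, n} = 0"] that unfolding m_def by blast
    qed
    then have "m \<in> X" unfolding X_def by simp
    then show ?thesis using m by blast
  qed
  moreover have "approximate_extension_property X \<delta>"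
    unfolding approximate_extension_property_def
  proof (intro allI impI)
    fix S \<phi> and \<epsilon> :: real
    assume H: "finite S \<and> S \<subseteq> X \<and> one_point_extension S \<delta> \<phi> \<and> 0 < \<epsilon>"
    then have H': "finite S" "S \<subseteq> UNIV" "one_point_extension S \<delta> \<phi>" "0 < \<epsilon>" by auto
    obtain z where z: "\<forall>T\<subseteq>S. \<bar>\<delta> (insert z T) - \<phi> T\<bar> < \<epsilon>"
      by (rule approximate_extension_propertyD[OF A H'])
    obtain z' where z': "z' \<in> X" "\<delta> {z', z} = 0" using rep by blast
    have "\<bar>\<delta> (insert z' T) - \<phi> T\<bar> < \<epsilon>" if "T \<subseteq> S" for T
    proof -
      have "finite T" using that H finite_subset by blast
      then have "\<delta> (insert z' T) = \<delta> (insert z T)"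
        using pseudodiversity_insert_near[OF P, of T z' z] z'(2) by simp
      then show ?thesis using z that by simp
    qed
    then show "\<exists>z\<in>X. \<forall>T\<subseteq>S. \<bar>\<delta> (insert z T) - \<phi> T\<bar> < \<epsilon>"
      using z'(1) by blast
  qed
  ultimately show ?thesis by (intro exI[of _ X] exI[of _ \<delta>]) blast
qed

section \<open>Completion of a diversity\<close>

text \<open>
  Each point \<open>x\<close> of the metric completion is approximated by a sequence \<open>a x\<close> in \<open>X\<close>, and the value
  of a finite set is the limit of the values of its approximations. The limit exists by the Lipschitz
  property.
\<close>

lemma diversity_completion:
  fixes X :: "'c set"
  assumes P: "pseudodiversity X \<delta>" and sep: "\<And>x y. x \<in> X \<Longrightarrow> y \<in> X \<Longrightarrow> \<delta> {x, y} = 0 \<Longrightarrow> x = y"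
  obtains m :: "('c \<Rightarrow> real) metric" and \<delta>' f where
    "mcomplete_of m" "pseudodiversity (mspace m) \<delta>'"
    "\<forall>x\<in>mspace m. \<forall>y\<in>mspace m. mdist m x y = \<delta>' {x, y}"
    "f ` X \<subseteq> mspace m" "\<forall>T. finite T \<and> T \<subseteq> X \<longrightarrow> \<delta>' (f ` T) = \<delta> T"
    "\<forall>x\<in>mspace m. \<forall>\<epsilon>>0. \<exists>a\<in>X. mdist m (f a) x < \<epsilon>"
proof -
  let ?d = "\<lambda>x y. if x \<in> X \<and> y \<in> X then \<delta> {x, y} else 0"
  interpret X: Metric_space X ?d
    by (rule Metric_space_pseudodiversity[OF P sep])
  obtain f :: "'c \<Rightarrow> 'c \<Rightarrow> real" and m where m: "mcomplete_of m" "f \<in> X \<rightarrow> mspace m"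
    "mtopology_of m closure_of f ` X = mspace m"
    "\<And>x y. \<lbrakk>x \<in> X; y \<in> X\<rbrakk> \<Longrightarrow> mdist m (f x) (f y) = ?d x y"
    by (rule X.metric_completion) (rule that, simp_all)
  interpret M: Metric_space "mspace m" "mdist m" by simp
  have f: "f x \<in> mspace m" if "x \<in> X" for x using m(2) that by blast
  have f_iso: "mdist m (f x) (f y) = \<delta> {x, y}" if "x \<in> X" "y \<in> X" for x y using m(4) that by simp
  have dense: "\<exists>a\<in>X. mdist m (f a) x < \<epsilon>" if x: "x \<in> mspace m" "\<epsilon> > 0" for x \<epsilon>
  proof -
    have "x \<in> M.mtopology closure_of f ` X"
      using m(3) x(1) unfolding mtopology_of_def by simp
    then obtain y where "y \<in> f ` X" "mdist m x y < \<epsilon>"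
      using x(2) unfolding M.metric_closure_of M.in_mball by blast
    then show ?thesis by (auto simp: M.commute)
  qed
  have "\<forall>x k. \<exists>a. x \<in> mspace m \<longrightarrow> a \<in> X \<and> mdist m (f a) x < 1 / real (Suc k)"
    using dense by (metis divide_pos_pos of_nat_0_less_iff zero_less_Suc zero_less_one)
  then obtain a where a: "\<And>x k. x \<in> mspace m \<Longrightarrow> a x k \<in> X \<and> mdist m (f (a x k)) x < 1 / real (Suc k)"
    by metis
  define D where "D = (\<lambda>k T. \<delta> ((\<lambda>x. a x k) ` T))"
  have PD: "pseudodiversity (mspace m) (D k)" for k
    unfolding D_def by (rule pseudodiversity_pullback[OF P]) (use a in blast)
  have small: "\<exists>N. \<forall>k\<ge>N. c / real (Suc k) < \<epsilon>" if "\<epsilon> > 0" for c \<epsilon> :: real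
  proof -
    have "(\<lambda>k. c / real (Suc k)) \<longlonglongrightarrow> 0"
      by (rule LIMSEQ_Suc[OF lim_const_over_n])
    then have "\<forall>\<^sub>F k in sequentially. c / real (Suc k) < \<epsilon>"
      using that by (rule order_tendstoD)
    then show ?thesis unfolding eventually_sequentially .
  qed
  have near: "\<delta> {a x j, a x k} \<le> 1 / real (Suc j) + 1 / real (Suc k)" if x: "x \<in> mspace m" for x j k
  proof -
    have "\<delta> {a x j, a x k} = mdist m (f (a x j)) (f (a x k))"
      using f_iso a[OF x] by simp
    also have "\<dots> \<le> mdist m (f (a x j)) x + mdist m x (f (a x k))"
      using a[OF x] f x by (intro M.triangle) auto
    also have "\<dots> \<le> 1 / real (Suc j) + 1 / real (Suc k)"
      using a[OF x, of j] a[OF x, of k] by (simp add: M.commute)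
    finally show ?thesis .
  qed
  have "convergent (\<lambda>k. D k T)" if T: "finite T" "T \<subseteq> mspace m" for T
  proof (rule Cauchy_convergent, rule metric_CauchyI)
    fix \<epsilon> :: real assume "\<epsilon> > 0"
    obtain N where N: "\<forall>k\<ge>N. 2 * real (card T) / real (Suc k) < \<epsilon>"
      using small[OF \<open>\<epsilon> > 0\<close>] by blast
    have "dist (D j T) (D k T) < \<epsilon>" if "j \<ge> N" "k \<ge> N" for j k
    proof -
      have "\<bar>D j T - D k T\<bar> \<le> real (card T) * (2 / real (Suc N))"
        unfolding D_def
      proof (rule pseudodiversity_lipschitz_bound[OF P T(1)])
        show "(\<lambda>x. a x j) ` T \<subseteq> X" "(\<lambda>x. a x k) ` T \<subseteq> X" using a T by blast+
        fix x assume "x \<in> T"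
        then have "\<delta> {a x j, a x k} \<le> 1 / real (Suc j) + 1 / real (Suc k)"
          using near T by blast
        moreover have "1 / real (Suc j) \<le> 1 / real (Suc N)" "1 / real (Suc k) \<le> 1 / real (Suc N)"
          using that by (simp_all add: frac_le)
        ultimately show "\<delta> {a x j, a x k} \<le> 2 / real (Suc N)" by simp
      qed
      then show ?thesis using N by (auto simp: dist_real_def mult.commute)
    qed
    then show "\<exists>N. \<forall>j\<ge>N. \<forall>k\<ge>N. dist (D j T) (D k T) < \<epsilon>" by blast
  qed
  then have lim: "(\<lambda>k. D k T) \<longlonglongrightarrow> lim (\<lambda>k. D k T)" if "finite T" "T \<subseteq> mspace m" for T
    using that by (simp add: convergent_LIMSEQ_iff)
  define \<delta>' where "\<delta>' = (\<lambda>T. lim (\<lambda>k. D k T))"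
  have lim': "\<delta>' T = l" if T: "finite T" "T \<subseteq> mspace m" and l: "\<And>k. \<bar>D k T - l\<bar> \<le> c / real (Suc k)" for T l c
  proof -
    have "(\<lambda>k. D k T) \<longlonglongrightarrow> l"
    proof (rule LIMSEQ_I)
      fix \<epsilon> :: real assume "\<epsilon> > 0"
      then obtain N where "\<forall>k\<ge>N. c / real (Suc k) < \<epsilon>" using small by blast
      then have "\<forall>k\<ge>N. norm (D k T - l) < \<epsilon>"
        using l by (metis real_norm_def order_le_less_trans)
      then show "\<exists>N. \<forall>k\<ge>N. norm (D k T - l) < \<epsilon>" by blast
    qed
    then show ?thesis
      unfolding \<delta>'_def by (rule limI)
  qed
  show ?thesis
  proof (rule that[of m \<delta>' f])
    show "mcomplete_of m" by (rule m(1))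
    show "pseudodiversity (mspace m) \<delta>'"
      using PD lim unfolding \<delta>'_def by (rule pseudodiversity_limit)
    show "\<forall>x\<in>mspace m. \<forall>y\<in>mspace m. mdist m x y = \<delta>' {x, y}"
    proof (intro ballI)
      fix x y assume xy: "x \<in> mspace m" "y \<in> mspace m"
      have "\<delta>' {x, y} = mdist m x y"
      proof (rule lim'[of "{x, y}" "mdist m x y" 2])
        fix k
        have mem: "f (a x k) \<in> mspace m" "f (a y k) \<in> mspace m"
          using a f xy by auto
        have "D k {x, y} = mdist m (f (a x k)) (f (a y k))"
          unfolding D_def using f_iso a xy by simp
        moreover have "mdist m (f (a x k)) x < 1 / real (Suc k)" "mdist m (f (a y k)) y < 1 / real (Suc k)"
          using a xy by auto
        moreover have "mdist m (f (a x k)) (f (a y k)) \<le> mdist m (f (a x k)) x + mdist m x (f (a y k))"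
          "mdist m x (f (a y k)) \<le> mdist m x y + mdist m y (f (a y k))"
          "mdist m x y \<le> mdist m x (f (a x k)) + mdist m (f (a x k)) y"
          "mdist m (f (a x k)) y \<le> mdist m (f (a x k)) (f (a y k)) + mdist m (f (a y k)) y"
          using mem xy by (auto intro!: M.triangle)
        moreover have "2 / real (Suc k) = 1 / real (Suc k) + 1 / real (Suc k)"
          by simp
        ultimately show "\<bar>D k {x, y} - mdist m x y\<bar> \<le> 2 / real (Suc k)"
          using M.commute[of x "f (a x k)"] M.commute[of y "f (a y k)"] unfolding abs_le_iff by linarith
      qed (use xy in auto)
      then show "mdist m x y = \<delta>' {x, y}" by simp
    qed
    show "f ` X \<subseteq> mspace m" using f by blast
    show "\<forall>T. finite T \<and> T \<subseteq> X \<longrightarrow> \<delta>' (f ` T) = \<delta> T"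
    proof (intro allI impI)
      fix T assume T: "finite T \<and> T \<subseteq> X"
      show "\<delta>' (f ` T) = \<delta> T"
      proof (rule lim'[of "f ` T" "\<delta> T" "real (card T)"])
        fix k
        have "\<bar>\<delta> ((\<lambda>t. a (f t) k) ` T) - \<delta> ((\<lambda>t. t) ` T)\<bar> \<le> real (card T) * (1 / real (Suc k))"
        proof (rule pseudodiversity_lipschitz_bound[OF P])
          fix t assume "t \<in> T"
          then have t: "t \<in> X" using T by blast
          have "\<delta> {a (f t) k, t} = mdist m (f (a (f t) k)) (f t)"
            using f_iso a f t by simp
          then show "\<delta> {a (f t) k, t} \<le> 1 / real (Suc k)"
            using a[OF f[OF t], of k] by simp
        qed (use T a f in auto)
        moreover have "D k (f ` T) = \<delta> ((\<lambda>t. a (f t) k) ` T)"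
          unfolding D_def by (simp add: image_image)
        ultimately show "\<bar>D k (f ` T) - \<delta> T\<bar> \<le> real (card T) / real (Suc k)"
          by simp
      qed (use T f in auto)
    qed
    show "\<forall>x\<in>mspace m. \<forall>\<epsilon>>0. \<exists>a\<in>X. mdist m (f a) x < \<epsilon>" using dense by blast
  qed
qed

text \<open>
  A one-point extension of a finite set \<open>S\<close> is first extended to \<open>S\<close> together with nearby points of the
  dense subset, then restricted to these nearby points and realized there. The Lipschitz property
  compares the values over the nearby points with those over \<open>S\<close>.
\<close>

lemma approximate_extension_property_dense:
  assumes P: "pseudodiversity Y \<delta>'" and f: "f ` X \<subseteq> Y" "\<And>T. finite T \<Longrightarrow> T \<subseteq> X \<Longrightarrow> \<delta>' (f ` T) = \<delta> T"
    and dense: "\<And>y \<epsilon>. y \<in> Y \<Longrightarrow> 0 < \<epsilon> \<Longrightarrow> \<exists>a\<in>X. \<delta>' {f a, y} < \<epsilon>"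
    and A: "approximate_extension_property X \<delta>"
  shows "approximate_extension_property Y \<delta>'"
  unfolding approximate_extension_property_def
proof (intro allI impI)
  fix S \<phi> and \<epsilon> :: real
  assume H: "finite S \<and> S \<subseteq> Y \<and> one_point_extension S \<delta>' \<phi> \<and> 0 < \<epsilon>"
  \<comment> \<open>Passing between \<open>S\<close> and the nearby points happens twice, each time with an error of at most
    \<open>(card S + 1) * \<eta> = \<epsilon> / 4\<close>.\<close>
  define \<eta> where "\<eta> = \<epsilon> / (4 * (real (card S) + 1))"
  have \<eta>: "0 < \<eta>" unfolding \<eta>_def using H by simp
  have "\<forall>s\<in>S. \<exists>a. a \<in> X \<and> \<delta>' {f a, s} < \<eta>"
    using dense \<eta> H by blast
  then obtain r where r: "\<And>s. s \<in> S \<Longrightarrow> r s \<in> X \<and> \<delta>' {f (r s), s} < \<eta>"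
    by metis
  let ?S' = "(\<lambda>s. f (r s)) ` S"
  have S': "?S' \<subseteq> Y" using r f(1) by blast
  have PS: "pseudodiversity (S \<union> ?S') \<delta>'"
    using P by (rule pseudodiversity_subset) (use H S' in blast)
  have finS: "finite (S \<union> ?S')" using H by simp
  obtain \<phi>' where \<phi>': "one_point_extension (S \<union> ?S') \<delta>' \<phi>'" "\<forall>T\<subseteq>S. \<phi>' T = \<phi> T"
    by (rule one_point_extension_extend[OF finS PS, of S \<phi>]) (use H in auto)
  let ?R = "r ` S"
  have "one_point_extension ?R (\<lambda>T. \<delta>' (f ` T)) (\<lambda>T. \<phi>' (f ` T))"
    by (rule one_point_extension_pullback[OF \<phi>'(1)]) auto
  moreover have finR: "finite ?R" "?R \<subseteq> X" "0 < \<epsilon> / 2" using H r by auto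
  have "\<delta>' (f ` T) = \<delta> T" if "T \<subseteq> ?R" for T
    using f(2)[OF finite_subset[OF that finR(1)] subset_trans[OF that finR(2)]] .
  ultimately have ER: "one_point_extension ?R \<delta> (\<lambda>T. \<phi>' (f ` T))"
    by (elim one_point_extension_cong) simp_all
  obtain z where z: "z \<in> X" "\<forall>T\<subseteq>?R. \<bar>\<delta> (insert z T) - \<phi>' (f ` T)\<bar> < \<epsilon> / 2"
    by (rule approximate_extension_propertyD[OF A finR(1,2) ER finR(3)])
  have "\<bar>\<delta>' (insert (f z) T) - \<phi> T\<bar> < \<epsilon>" if T: "T \<subseteq> S" for T
  proof -
    let ?g = "\<lambda>s. f (r s)"
    have finT: "finite T" using T H finite_subset by blast
    have gY: "?g ` T \<subseteq> Y" "T \<subseteq> Y" "f z \<in> Y" using S' T H z(1) f(1) by auto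
    have g_near: "\<delta>' {?g t, t} \<le> \<eta>" if "t \<in> T" for t
      using r[of t] T that by auto
    have "\<bar>\<phi>' (?g ` T) - \<phi>' ((\<lambda>t. t) ` T)\<bar> \<le> (real (card T) + 1) * \<eta>"
      using T \<eta> g_near by (intro one_point_extension_lipschitz[OF PS finS \<phi>'(1) finT]) auto
    moreover have E: "one_point_extension (?g ` T \<union> T) \<delta>' (\<lambda>U. \<delta>' (insert (f z) U))"
      using finT gY by (intro one_point_extension_of_point[OF P]) auto
    have "\<bar>\<delta>' (insert (f z) (?g ` T)) - \<delta>' (insert (f z) ((\<lambda>t. t) ` T))\<bar> \<le> (real (card T) + 1) * \<eta>"
      using \<eta> g_near finT gY
      by (intro one_point_extension_lipschitz[OF _ _ E finT]) (auto intro: pseudodiversity_subset[OF P])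
    moreover have "(real (card T) + 1) * \<eta> \<le> (real (card S) + 1) * \<eta>"
      using \<eta> T H by (intro mult_right_mono) (simp_all add: card_mono)
    moreover have "(real (card S) + 1) * \<eta> = \<epsilon> / 4"
    proof -
      have "real (card S) + 1 \<noteq> 0" by linarith
      then show ?thesis unfolding \<eta>_def by (simp add: field_simps)
    qed
    moreover have "\<bar>\<delta> (insert z (r ` T)) - \<phi>' (f ` r ` T)\<bar> < \<epsilon> / 2"
      using z(2) T by (simp add: image_mono)
    moreover have "\<delta>' (f ` insert z (r ` T)) = \<delta> (insert z (r ` T))"
      using finT z(1) r T by (intro f(2)) auto
    moreover have "f ` r ` T = ?g ` T" by (simp add: image_image)
    moreover have "\<phi>' T = \<phi> T" using \<phi>'(2) T by simp
    ultimately show ?thesis by (simp only: image_insert image_ident)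
  qed
  then show "\<exists>z\<in>Y. \<forall>T\<subseteq>S. \<bar>\<delta>' (insert z T) - \<phi> T\<bar> < \<epsilon>"
    using z(1) f(1) by (intro bexI[of _ "f z"]) auto
qed

section \<open>Exact extensions in complete diversities\<close>

text \<open>
  Completeness of the induced metric is spelled out with \<open>\<delta>\<close>, so that it applies to any set \<open>X\<close>.
\<close>

definition complete_diversity :: "'c set \<Rightarrow> ('c set \<Rightarrow> real) \<Rightarrow> bool" where
  "complete_diversity X \<delta> \<longleftrightarrow>
     pseudodiversity X \<delta> \<and> (\<forall>x\<in>X. \<forall>y\<in>X. \<delta> {x, y} = 0 \<longrightarrow> x = y) \<and>
     (\<forall>\<sigma>. (\<forall>k. \<sigma> k \<in> X) \<and> (\<forall>\<epsilon>>0. \<exists>N. \<forall>j\<ge>N. \<forall>k\<ge>N. \<delta> {\<sigma> j, \<sigma> k} < \<epsilon>) \<longrightarrow>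
        (\<exists>x\<in>X. (\<lambda>k. \<delta> {\<sigma> k, x}) \<longlonglongrightarrow> 0))"

lemma complete_diversityD:
  assumes "complete_diversity X \<delta>"
  shows "pseudodiversity X \<delta>" "x \<in> X \<Longrightarrow> y \<in> X \<Longrightarrow> \<delta> {x, y} = 0 \<Longrightarrow> x = y"
  using assms unfolding complete_diversity_def by blast+

lemma complete_diversity_limit:
  assumes "complete_diversity X \<delta>" "\<And>k. \<sigma> k \<in> X"
    and "\<And>\<epsilon>. \<epsilon> > 0 \<Longrightarrow> \<exists>N. \<forall>j\<ge>N. \<forall>k\<ge>N. \<delta> {\<sigma> j, \<sigma> k} < \<epsilon>"
  obtains x where "x \<in> X" "(\<lambda>k. \<delta> {\<sigma> k, x}) \<longlonglongrightarrow> 0"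
proof -
  have "\<exists>x\<in>X. (\<lambda>k. \<delta> {\<sigma> k, x}) \<longlonglongrightarrow> 0"
    using assms unfolding complete_diversity_def by blast
  then show ?thesis using that by (elim bexE) assumption
qed

lemma carries_complete_diversity:
  assumes M: "carries M \<delta>" and "mcomplete_of (met M)"
  shows "complete_diversity (univ M) \<delta>"
  unfolding complete_diversity_def
proof (intro conjI allI impI ballI)
  show "pseudodiversity (univ M) \<delta>" by (rule carries_pseudodiversity[OF M])
  show "x = y" if "x \<in> univ M" "y \<in> univ M" "\<delta> {x, y} = 0" for x y
    using carries_zero[OF M that] .
  fix \<sigma> :: "nat \<Rightarrow> 'a"
  assume H: "(\<forall>k. \<sigma> k \<in> univ M) \<and> (\<forall>\<epsilon>>0. \<exists>N. \<forall>j\<ge>N. \<forall>k\<ge>N. \<delta> {\<sigma> j, \<sigma> k} < \<epsilon>)"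
  have eq: "sdist M (\<sigma> k) x = \<delta> {\<sigma> k, x}" if "x \<in> univ M" for k x
    using carries_sdist[OF M] H that by blast
  have "\<exists>x\<in>univ M. (\<lambda>k. sdist M (\<sigma> k) x) \<longlonglongrightarrow> 0"
    using assms(2)[unfolded mcomplete_of_iff, rule_format, of \<sigma>] H eq by simp
  then show "\<exists>x\<in>univ M. (\<lambda>k. \<delta> {\<sigma> k, x}) \<longlonglongrightarrow> 0"
    using eq by simp
qed

text \<open>
  Let \<open>z\<close> realize \<open>\<phi>\<close> up to an error \<open>\<epsilon>\<close>. By bounded amalgamation, \<open>\<phi>\<close> extends to \<open>S \<union> {z}\<close> with
  distance at most \<open>\<epsilon>\<close> from \<open>z\<close>; an approximate realization of this extension has a smaller error and
  lies close to \<open>z\<close>. With the errors \<open>1 / 2 ^ k\<close> the realizations form a Cauchy sequence, and its limit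
  realizes \<open>\<phi>\<close> exactly.
\<close>

lemma extension_property_complete:
  assumes C: "complete_diversity X \<delta>" and A: "approximate_extension_property X \<delta>"
  shows "extension_property X \<delta>"
  unfolding extension_property_def
proof (intro allI impI)
  note P = complete_diversityD(1)[OF C]
  fix S \<phi> assume "finite S \<and> S \<subseteq> X \<and> one_point_extension S \<delta> \<phi>"
  then have S: "finite S" "S \<subseteq> X" and E: "one_point_extension S \<delta> \<phi>" by auto
  let ?e = "\<lambda>k. (1 / 2) ^ k :: real"
  have "\<exists>\<sigma>. \<forall>k. (\<sigma> k \<in> X \<and> (\<forall>T\<subseteq>S. \<bar>\<delta> (insert (\<sigma> k) T) - \<phi> T\<bar> \<le> ?e k)) \<and>
      \<delta> {\<sigma> k, \<sigma> (Suc k)} \<le> 2 * ?e k"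
  proof (rule dependent_nat_choice)
    obtain z where "z \<in> X" "\<forall>T\<subseteq>S. \<bar>\<delta> (insert z T) - \<phi> T\<bar> < 1"
      by (rule approximate_extension_propertyD[OF A S E zero_less_one])
    then show "\<exists>z. z \<in> X \<and> (\<forall>T\<subseteq>S. \<bar>\<delta> (insert z T) - \<phi> T\<bar> \<le> ?e 0)"
      by (intro exI[of _ z]) (simp add: less_imp_le)
    fix z k assume z: "z \<in> X \<and> (\<forall>T\<subseteq>S. \<bar>\<delta> (insert z T) - \<phi> T\<bar> \<le> ?e k)"
    have Pz: "pseudodiversity (insert z S) \<delta>"
      using P by (rule pseudodiversity_subset) (use z S in blast)
    obtain \<phi>' where \<phi>': "one_point_extension (insert z S) \<delta> \<phi>'" "\<forall>T\<subseteq>S. \<phi>' T = \<phi> T"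
      "\<forall>\<epsilon>. (\<forall>T\<subseteq>S. \<bar>\<phi> T - \<delta> (insert z T)\<bar> \<le> \<epsilon>) \<longrightarrow> \<phi>' {z} \<le> \<epsilon>"
      by (rule one_point_extension_insert[OF S(1) Pz E])
    have \<phi>'z: "\<phi>' {z} \<le> ?e k"
      using \<phi>'(3)[rule_format, of "?e k"] z by (simp add: abs_minus_commute)
    have zS: "finite (insert z S)" "insert z S \<subseteq> X" "0 < ?e (Suc k)" using S z by auto
    obtain y where y: "y \<in> X" "\<forall>T\<subseteq>insert z S. \<bar>\<delta> (insert y T) - \<phi>' T\<bar> < ?e (Suc k)"
      by (rule approximate_extension_propertyD[OF A zS(1,2) \<phi>'(1) zS(3)])
    have "\<bar>\<delta> (insert y T) - \<phi> T\<bar> \<le> ?e (Suc k)" if "T \<subseteq> S" for T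
      using y(2)[rule_format, of T] \<phi>'(2)[rule_format, OF that] that by (simp add: subset_insertI2)
    moreover have "\<delta> {z, y} \<le> 2 * ?e k"
    proof -
      have "\<bar>\<delta> {y, z} - \<phi>' {z}\<bar> < ?e k / 2"
        using y(2)[rule_format, of "{z}"] by simp
      moreover have "0 < ?e k" by simp
      ultimately have "\<delta> {y, z} \<le> 2 * ?e k"
        using \<phi>'z unfolding abs_less_iff by linarith
      then show ?thesis by (simp add: insert_commute)
    qed
    ultimately show "\<exists>y. (y \<in> X \<and> (\<forall>T\<subseteq>S. \<bar>\<delta> (insert y T) - \<phi> T\<bar> \<le> ?e (Suc k))) \<and> \<delta> {z, y} \<le> 2 * ?e k"
      using y(1) by blast
  qed
  then obtain \<sigma> where \<sigma>: "\<forall>k. (\<sigma> k \<in> X \<and> (\<forall>T\<subseteq>S. \<bar>\<delta> (insert (\<sigma> k) T) - \<phi> T\<bar> \<le> ?e k)) \<and>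
      \<delta> {\<sigma> k, \<sigma> (Suc k)} \<le> 2 * ?e k"
    by (elim exE)
  have \<sigma>X: "\<sigma> k \<in> X" and \<sigma>\<phi>: "T \<subseteq> S \<Longrightarrow> \<bar>\<delta> (insert (\<sigma> k) T) - \<phi> T\<bar> \<le> ?e k"
    and step: "\<delta> {\<sigma> k, \<sigma> (Suc k)} \<le> 2 * ?e k" for k T
    using \<sigma>[rule_format, of k] by simp_all
  \<comment> \<open>A telescoping form of the geometric sum of the steps.\<close>
  have far: "\<delta> {\<sigma> n, \<sigma> (n + i)} \<le> 4 * (?e n - ?e (n + i))" for n i
  proof (induction i)
    case 0
    then show ?case using pseudodiversity_singleton[OF P \<sigma>X] by simp
  next
    case (Suc i)
    have "\<delta> {\<sigma> n, \<sigma> (n + Suc i)} \<le> \<delta> {\<sigma> n, \<sigma> (n + i)} + \<delta> {\<sigma> (n + i), \<sigma> (Suc (n + i))}"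
      using \<sigma>X pseudodiversity_triangle[OF P, of "\<sigma> n" "\<sigma> (n + i)" "\<sigma> (n + Suc i)"] by simp
    then show ?case using Suc step[of "n + i"] by simp
  qed
  have e_small: "\<exists>N. \<forall>k\<ge>N. ?e k < \<epsilon>" if "\<epsilon> > 0" for \<epsilon>
  proof -
    have "(\<lambda>k. ?e k) \<longlonglongrightarrow> 0" by (rule LIMSEQ_realpow_zero) simp_all
    then have "\<forall>\<^sub>F k in sequentially. ?e k < \<epsilon>" using that by (rule order_tendstoD)
    then show ?thesis unfolding eventually_sequentially .
  qed
  have "\<exists>N. \<forall>j\<ge>N. \<forall>k\<ge>N. \<delta> {\<sigma> j, \<sigma> k} < \<epsilon>" if \<epsilon>: "\<epsilon> > 0" for \<epsilon>
  proof -
    obtain N where "\<forall>k\<ge>N. ?e k < \<epsilon> / 8"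
      using e_small[of "\<epsilon> / 8"] \<epsilon> by auto
    then have N: "?e N < \<epsilon> / 8" by blast
    have near: "\<delta> {\<sigma> N, \<sigma> k} \<le> 4 * ?e N" if "k \<ge> N" for k
    proof -
      have "\<delta> {\<sigma> N, \<sigma> k} \<le> 4 * (?e N - ?e k)"
        using far[of N "k - N"] that by simp
      also have "\<dots> \<le> 4 * ?e N" by simp
      finally show ?thesis .
    qed
    have "\<delta> {\<sigma> j, \<sigma> k} < \<epsilon>" if "j \<ge> N" "k \<ge> N" for j k
      using pseudodiversity_triangle[OF P \<sigma>X[of j] \<sigma>X[of N] \<sigma>X[of k]] near[OF that(1)] near[OF that(2)] N
      by (simp add: insert_commute)
    then show ?thesis by blast
  qed
  then obtain z where z: "z \<in> X" "(\<lambda>k. \<delta> {\<sigma> k, z}) \<longlonglongrightarrow> 0"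
    by (rule complete_diversity_limit[OF C \<sigma>X])
  have "\<delta> (insert z T) = \<phi> T" if T: "T \<subseteq> S" for T
  proof -
    have T': "finite T" "T \<subseteq> X" using T S finite_subset by auto
    have "\<bar>\<delta> (insert z T) - \<phi> T\<bar> \<le> \<delta> {\<sigma> k, z} + ?e k" for k
      using pseudodiversity_insert_near[OF P T' \<sigma>X z(1), of k] \<sigma>\<phi>[OF T, of k] by linarith
    moreover have "(\<lambda>k. \<delta> {\<sigma> k, z} + ?e k) \<longlonglongrightarrow> 0 + 0"
      by (intro tendsto_add z(2) LIMSEQ_realpow_zero) simp_all
    ultimately have "\<bar>\<delta> (insert z T) - \<phi> T\<bar> \<le> 0"
      by (intro LIMSEQ_le_const[where X = "\<lambda>k. \<delta> {\<sigma> k, z} + ?e k"]) auto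
    then show ?thesis by simp
  qed
  then show "\<exists>z\<in>X. \<forall>T\<subseteq>S. \<delta> (insert z T) = \<phi> T"
    using z(1) by blast
qed

section \<open>Back and forth\<close>

text \<open>
  Relations instead of functions make the notion symmetric, so that a step back is a step forth for the
  converse relation. In the absence of points at distance zero such a relation is the graph of
  an injection.
\<close>

definition partial_isomorphism ::
  "'c set \<Rightarrow> ('c set \<Rightarrow> real) \<Rightarrow> 'd set \<Rightarrow> ('d set \<Rightarrow> real) \<Rightarrow> ('c \<times> 'd) set \<Rightarrow> bool" where
  "partial_isomorphism X \<delta> Y \<delta>' R \<longleftrightarrow>
     R \<subseteq> X \<times> Y \<and> (\<forall>Q. finite Q \<and> Q \<subseteq> R \<longrightarrow> \<delta> (fst ` Q) = \<delta>' (snd ` Q))"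

lemma partial_isomorphism_eq:
  "partial_isomorphism X \<delta> Y \<delta>' R \<Longrightarrow> finite Q \<Longrightarrow> Q \<subseteq> R \<Longrightarrow> \<delta> (fst ` Q) = \<delta>' (snd ` Q)"
  unfolding partial_isomorphism_def by simp

lemma partial_isomorphism_converse:
  assumes "partial_isomorphism X \<delta> Y \<delta>' R"
  shows "partial_isomorphism Y \<delta>' X \<delta> (R\<inverse>)"
  unfolding partial_isomorphism_def
proof (intro conjI allI impI)
  show "R\<inverse> \<subseteq> Y \<times> X" using assms unfolding partial_isomorphism_def by blast
  fix Q assume Q: "finite Q \<and> Q \<subseteq> R\<inverse>"
  have "finite (prod.swap ` Q)" "prod.swap ` Q \<subseteq> R" using Q by auto
  then have "\<delta> (fst ` prod.swap ` Q) = \<delta>' (snd ` prod.swap ` Q)"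
    by (rule partial_isomorphism_eq[OF assms])
  then show "\<delta>' (fst ` Q) = \<delta> (snd ` Q)"
    by (simp add: image_image)
qed

lemma partial_isomorphism_dist:
  assumes "partial_isomorphism X \<delta> Y \<delta>' R" "(a, b) \<in> R" "(a', b') \<in> R"
  shows "\<delta> {a, a'} = \<delta>' {b, b'}"
proof -
  have "\<delta> (fst ` {(a, b), (a', b')}) = \<delta>' (snd ` {(a, b), (a', b')})"
    using assms(2,3) by (intro partial_isomorphism_eq[OF assms(1)]) simp_all
  then show ?thesis by simp
qed

lemma partial_isomorphism_functional:
  assumes R: "partial_isomorphism X \<delta> Y \<delta>' R" and "(a, b) \<in> R" "(a, b') \<in> R"
    and P: "pseudodiversity X \<delta>" and sep: "\<And>x y. x \<in> Y \<Longrightarrow> y \<in> Y \<Longrightarrow> \<delta>' {x, y} = 0 \<Longrightarrow> x = y"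
  shows "b = b'"
proof (rule sep)
  have "a \<in> X" using R assms(2) unfolding partial_isomorphism_def by blast
  then show "\<delta>' {b, b'} = 0"
    using partial_isomorphism_dist[OF R assms(2,3)] pseudodiversity_singleton[OF P] by simp
qed (use R assms(2,3) in \<open>auto simp: partial_isomorphism_def\<close>)

text \<open>
  The map \<open>g\<close> is the inverse of \<open>R\<close>. It carries the one-point extension given by \<open>x\<close> over the domain
  of \<open>R\<close> to one over the range, and \<open>y\<close> realizes it.
\<close>

lemma partial_isomorphism_extend:
  assumes R: "partial_isomorphism X \<delta> Y \<delta>' R" and "finite R" "x \<in> X"
    and P: "pseudodiversity X \<delta>" and sep: "\<And>x y. x \<in> X \<Longrightarrow> y \<in> X \<Longrightarrow> \<delta> {x, y} = 0 \<Longrightarrow> x = y"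
    and P': "pseudodiversity Y \<delta>'" and E: "extension_property Y \<delta>'"
  obtains y where "partial_isomorphism X \<delta> Y \<delta>' (insert (x, y) R)"
proof -
  have RXY: "R \<subseteq> X \<times> Y"
    using R unfolding partial_isomorphism_def by simp
  have R_eq: "\<delta> (fst ` Q) = \<delta>' (snd ` Q)" if "Q \<subseteq> R" for Q
    using finite_subset[OF that assms(2)] that by (rule partial_isomorphism_eq[OF R])
  define g where "g = (\<lambda>b. SOME a. (a, b) \<in> R)"
  have g: "(g b, b) \<in> R" if "b \<in> snd ` R" for b
    unfolding g_def using that by (intro someI_ex[of "\<lambda>a. (a, b) \<in> R"]) auto
  have "g b = a" if "(a, b) \<in> R" for a b
  proof -
    have "b \<in> snd ` R" using that by force
    then have "(b, g b) \<in> R\<inverse>" "(b, a) \<in> R\<inverse>" using g that by simp_all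
    then show ?thesis
      using P' sep by (rule partial_isomorphism_functional[OF partial_isomorphism_converse[OF R]])
  qed
  then have g_snd: "g ` snd ` Q = fst ` Q" if "Q \<subseteq> R" for Q
    unfolding image_image using that by (intro image_cong) (auto simp: subset_iff)
  let ?S = "snd ` R"
  have sub: "g ` ?S \<subseteq> fst ` R" using g_snd[of R] by simp
  have "one_point_extension (fst ` R) \<delta> (\<lambda>U. \<delta> (insert x U))"
    using RXY assms(2,3) by (intro one_point_extension_of_point[OF P]) auto
  from one_point_extension_pullback[OF this sub]
  have "one_point_extension ?S \<delta>' (\<lambda>U. \<delta> (insert x (g ` U)))"
  proof (rule one_point_extension_cong)
    fix U assume "U \<subseteq> ?S"
    then obtain Q where Q: "Q \<subseteq> R" "U = snd ` Q" by (rule subset_imageE)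
    then show "\<delta>' U = \<delta> (g ` U)" using R_eq[OF Q(1)] g_snd[OF Q(1)] by simp
  qed simp
  moreover have "finite ?S" "?S \<subseteq> Y" using RXY assms(2) by auto
  ultimately have "\<exists>y\<in>Y. \<forall>U\<subseteq>?S. \<delta>' (insert y U) = \<delta> (insert x (g ` U))"
    using E unfolding extension_property_def by blast
  then obtain y where y: "y \<in> Y" "\<forall>U\<subseteq>?S. \<delta>' (insert y U) = \<delta> (insert x (g ` U))"
    by (elim bexE)
  have "\<delta> (fst ` Q) = \<delta>' (snd ` Q)" if Q: "Q \<subseteq> insert (x, y) R" for Q
  proof (cases "(x, y) \<in> Q")
    case True
    let ?Q = "Q - {(x, y)}"
    have Q': "?Q \<subseteq> R" using Q by auto
    have "Q = insert (x, y) ?Q" using True by auto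
    then have "fst ` Q = insert x (fst ` ?Q)" "snd ` Q = insert y (snd ` ?Q)"
      by (metis fst_conv image_insert) (metis \<open>Q = insert (x, y) ?Q\<close> snd_conv image_insert)
    moreover have "\<delta>' (insert y (snd ` ?Q)) = \<delta> (insert x (g ` snd ` ?Q))"
      using y(2)[rule_format, OF image_mono[OF Q']] .
    ultimately show ?thesis using g_snd[OF Q'] by simp
  next
    case False
    then show ?thesis using Q R_eq[of Q] by auto
  qed
  then show ?thesis
    using y(1) RXY assms(3) by (intro that[of y]) (auto simp: partial_isomorphism_def)
qed

definition relation_closure ::
  "'c set \<Rightarrow> ('c set \<Rightarrow> real) \<Rightarrow> 'd set \<Rightarrow> ('d set \<Rightarrow> real) \<Rightarrow> ('c \<times> 'd) set \<Rightarrow> ('c \<times> 'd) set" where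
  "relation_closure X \<delta> Y \<delta>' R =
     {(x, y) \<in> X \<times> Y. \<forall>\<epsilon>>0. \<exists>(a, b)\<in>R. \<delta> {a, x} < \<epsilon> \<and> \<delta>' {b, y} < \<epsilon>}"

lemma relation_closure_converse:
  "relation_closure Y \<delta>' X \<delta> (R\<inverse>) = (relation_closure X \<delta> Y \<delta>' R)\<inverse>"
  unfolding relation_closure_def by fastforce

lemma relation_closure_superset:
  assumes R: "R \<subseteq> X \<times> Y" and P: "pseudodiversity X \<delta>" "pseudodiversity Y \<delta>'"
  shows "R \<subseteq> relation_closure X \<delta> Y \<delta>' R"
proof
  fix r assume r: "r \<in> R"
  obtain x y where xy: "r = (x, y)" "x \<in> X" "y \<in> Y" using r R by (cases r) auto
  have "\<delta> {x, x} = 0" "\<delta>' {y, y} = 0"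
    using xy pseudodiversity_singleton[OF P(1)] pseudodiversity_singleton[OF P(2)] by simp_all
  then show "r \<in> relation_closure X \<delta> Y \<delta>' R"
    unfolding relation_closure_def using xy r by (auto intro!: bexI[of _ "(x, y)"])
qed

text \<open>
  By the Lipschitz property both sides of the defining equation are continuous.
\<close>

lemma partial_isomorphism_closure:
  assumes R: "partial_isomorphism X \<delta> Y \<delta>' R"
    and P: "pseudodiversity X \<delta>" and P': "pseudodiversity Y \<delta>'"
  shows "partial_isomorphism X \<delta> Y \<delta>' (relation_closure X \<delta> Y \<delta>' R)"
  unfolding partial_isomorphism_def
proof (intro conjI allI impI)
  show "relation_closure X \<delta> Y \<delta>' R \<subseteq> X \<times> Y"
    unfolding relation_closure_def by auto
  fix Q assume Q: "finite Q \<and> Q \<subseteq> relation_closure X \<delta> Y \<delta>' R"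
  have RXY: "R \<subseteq> X \<times> Y" using R unfolding partial_isomorphism_def by blast
  have QXY: "fst q \<in> X" "snd q \<in> Y" if "q \<in> Q" for q
    using Q that unfolding relation_closure_def by auto
  have "\<bar>\<delta> (fst ` Q) - \<delta>' (snd ` Q)\<bar> \<le> 2 * real (card Q) * \<epsilon>" if \<epsilon>: "\<epsilon> > 0" for \<epsilon>
  proof -
    have "\<forall>q\<in>Q. \<exists>r. r \<in> R \<and> \<delta> {fst r, fst q} < \<epsilon> \<and> \<delta>' {snd r, snd q} < \<epsilon>"
    proof
      fix q assume "q \<in> Q"
      then have "q \<in> relation_closure X \<delta> Y \<delta>' R" using Q by blast
      then have "\<exists>(a, b)\<in>R. \<delta> {a, fst q} < \<epsilon> \<and> \<delta>' {b, snd q} < \<epsilon>"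
        unfolding relation_closure_def using \<epsilon> by (simp add: case_prod_beta)
      then obtain a b where "(a, b) \<in> R" "\<delta> {a, fst q} < \<epsilon>" "\<delta>' {b, snd q} < \<epsilon>"
        by blast
      then show "\<exists>r. r \<in> R \<and> \<delta> {fst r, fst q} < \<epsilon> \<and> \<delta>' {snd r, snd q} < \<epsilon>"
        by (intro exI[of _ "(a, b)"]) simp
    qed
    then obtain r where r: "\<forall>q\<in>Q. r q \<in> R \<and> \<delta> {fst (r q), fst q} < \<epsilon> \<and> \<delta>' {snd (r q), snd q} < \<epsilon>"
      by (rule bchoice[THEN exE])
    have rXY: "fst (r q) \<in> X" "snd (r q) \<in> Y" if "q \<in> Q" for q
    proof -
      have "r q \<in> X \<times> Y" using r RXY that by blast
      then show "fst (r q) \<in> X" "snd (r q) \<in> Y" by (simp_all add: mem_Times_iff)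
    qed
    have "\<bar>\<delta> ((\<lambda>q. fst (r q)) ` Q) - \<delta> (fst ` Q)\<bar> \<le> real (card Q) * \<epsilon>"
      using Q r rXY QXY by (intro pseudodiversity_lipschitz_bound[OF P]) (auto simp: less_imp_le)
    moreover have "\<bar>\<delta>' ((\<lambda>q. snd (r q)) ` Q) - \<delta>' (snd ` Q)\<bar> \<le> real (card Q) * \<epsilon>"
      using Q r rXY QXY by (intro pseudodiversity_lipschitz_bound[OF P']) (auto simp: less_imp_le)
    moreover have "\<delta> (fst ` r ` Q) = \<delta>' (snd ` r ` Q)"
      using Q r by (intro partial_isomorphism_eq[OF R]) auto
    ultimately show ?thesis
      by (simp add: image_image abs_le_iff)
  qed
  then have "\<bar>\<delta> (fst ` Q) - \<delta>' (snd ` Q)\<bar> \<le> 0 + \<epsilon>" if "\<epsilon> > 0" for \<epsilon>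
  proof -
    have "\<epsilon> / (2 * real (card Q) + 1) > 0" using that by simp
    then have "\<bar>\<delta> (fst ` Q) - \<delta>' (snd ` Q)\<bar> \<le> 2 * real (card Q) * (\<epsilon> / (2 * real (card Q) + 1))"
      using \<open>\<And>\<epsilon>. 0 < \<epsilon> \<Longrightarrow> \<bar>\<delta> (fst ` Q) - \<delta>' (snd ` Q)\<bar> \<le> 2 * real (card Q) * \<epsilon>\<close> by blast
    also have "\<dots> \<le> \<epsilon>"
      using that by (simp add: field_simps)
    finally show ?thesis by simp
  qed
  then have "\<bar>\<delta> (fst ` Q) - \<delta>' (snd ` Q)\<bar> \<le> 0"
    by (rule field_le_epsilon)
  then show "\<delta> (fst ` Q) = \<delta>' (snd ` Q)" by simp
qed

text \<open>
  If \<open>x\<close> is a limit of points in the domain, then their partners form a Cauchy sequence, because distances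
  are preserved; the limit of that sequence is a partner of \<open>x\<close>.
\<close>

lemma relation_closure_total:
  assumes R: "partial_isomorphism X \<delta> Y \<delta>' R" and P: "pseudodiversity X \<delta>"
    and C: "complete_diversity Y \<delta>'"
    and dense: "\<And>\<epsilon>. 0 < \<epsilon> \<Longrightarrow> \<exists>a\<in>fst ` R. \<delta> {a, x} < \<epsilon>" and "x \<in> X"
  obtains y where "(x, y) \<in> relation_closure X \<delta> Y \<delta>' R"
proof -
  have RXY: "R \<subseteq> X \<times> Y" using R unfolding partial_isomorphism_def by blast
  have "\<exists>r. r \<in> R \<and> \<delta> {fst r, x} < 1 / real (Suc k)" for k
    using dense[of "1 / real (Suc k)"] by auto
  then obtain r where r: "\<And>k. r k \<in> R" "\<And>k. \<delta> {fst (r k), x} < 1 / real (Suc k)"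
    by metis
  have rXY: "fst (r k) \<in> X" "snd (r k) \<in> Y" for k
    using subsetD[OF RXY r(1)[of k]] by (simp_all add: mem_Times_iff)
  have small: "\<exists>N. \<forall>k\<ge>N. \<delta> {fst (r k), x} < \<epsilon>" if "\<epsilon> > 0" for \<epsilon>
  proof -
    have "(\<lambda>k. 1 / real (Suc k)) \<longlonglongrightarrow> 0"
      by (rule LIMSEQ_Suc[OF lim_const_over_n])
    then have "\<forall>\<^sub>F k in sequentially. 1 / real (Suc k) < \<epsilon>"
      using that by (rule order_tendstoD)
    then show ?thesis
      unfolding eventually_sequentially using r(2) less_trans by blast
  qed
  have "\<exists>N. \<forall>j\<ge>N. \<forall>k\<ge>N. \<delta>' {snd (r j), snd (r k)} < \<epsilon>" if \<epsilon>: "\<epsilon> > 0" for \<epsilon>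
  proof -
    obtain N where N: "\<forall>k\<ge>N. \<delta> {fst (r k), x} < \<epsilon> / 2" using small[of "\<epsilon> / 2"] \<epsilon> by auto
    have "\<delta>' {snd (r j), snd (r k)} < \<epsilon>" if "j \<ge> N" "k \<ge> N" for j k
    proof -
      have "\<delta>' {snd (r j), snd (r k)} = \<delta> {fst (r j), fst (r k)}"
        using partial_isomorphism_dist[OF R, of "fst (r j)" "snd (r j)" "fst (r k)" "snd (r k)"] r(1) by simp
      also have "\<dots> \<le> \<delta> {fst (r j), x} + \<delta> {x, fst (r k)}"
        using rXY \<open>x \<in> X\<close> by (intro pseudodiversity_triangle[OF P])
      also have "\<dots> < \<epsilon>"
        using N[rule_format, OF that(1)] N[rule_format, OF that(2)] by (simp add: insert_commute)
      finally show ?thesis .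
    qed
    then show ?thesis by blast
  qed
  then obtain y where y: "y \<in> Y" "(\<lambda>k. \<delta>' {snd (r k), y}) \<longlonglongrightarrow> 0"
    by (rule complete_diversity_limit[OF C rXY(2)])
  have "\<exists>(a, b)\<in>R. \<delta> {a, x} < \<epsilon> \<and> \<delta>' {b, y} < \<epsilon>" if \<epsilon>: "\<epsilon> > 0" for \<epsilon>
  proof -
    have "\<forall>\<^sub>F k in sequentially. \<delta>' {snd (r k), y} < \<epsilon>"
      using y(2) \<epsilon> by (rule order_tendstoD)
    then obtain M where M: "\<forall>k\<ge>M. \<delta>' {snd (r k), y} < \<epsilon>"
      unfolding eventually_sequentially by blast
    obtain N where N: "\<forall>k\<ge>N. \<delta> {fst (r k), x} < \<epsilon>" using small[OF \<epsilon>] by blast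
    show ?thesis
      using M N r(1)[of "max M N"] by (intro bexI[of _ "r (max M N)"]) (auto simp: case_prod_beta)
  qed
  then show ?thesis
    using y(1) \<open>x \<in> X\<close> by (intro that[of y]) (simp add: relation_closure_def)
qed

definition separable_diversity :: "'c set \<Rightarrow> ('c set \<Rightarrow> real) \<Rightarrow> bool" where
  "separable_diversity X \<delta> \<longleftrightarrow>
     (\<exists>C. countable C \<and> C \<subseteq> X \<and> (\<forall>x\<in>X. \<forall>\<epsilon>>0. \<exists>c\<in>C. \<delta> {c, x} < \<epsilon>))"

lemma separable_diversity_sequence:
  assumes "separable_diversity X \<delta>" "X \<noteq> {}"
  obtains \<sigma> :: "nat \<Rightarrow> 'c" where "range \<sigma> \<subseteq> X" "\<forall>x\<in>X. \<forall>\<epsilon>>0. \<exists>k. \<delta> {\<sigma> k, x} < \<epsilon>"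
proof -
  obtain C where C: "countable C" "C \<subseteq> X" "\<forall>x\<in>X. \<forall>\<epsilon>>0. \<exists>c\<in>C. \<delta> {c, x} < \<epsilon>"
    using assms(1) unfolding separable_diversity_def by blast
  obtain x where "x \<in> X" using assms(2) by blast
  then have "\<exists>c\<in>C. \<delta> {c, x} < 1" using C(3) by simp
  then have "C \<noteq> {}" by blast
  then have range: "range (from_nat_into C) = C" using C(1) by (rule range_from_nat_into)
  have "\<exists>k. \<delta> {from_nat_into C k, x} < \<epsilon>" if H: "x \<in> X" "\<epsilon> > 0" for x \<epsilon>
  proof -
    obtain c where "c \<in> C" "\<delta> {c, x} < \<epsilon>" using C(3) H by blast
    moreover obtain k where "c = from_nat_into C k" using range \<open>c \<in> C\<close> by blast
    ultimately show ?thesis by blast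
  qed
  then show ?thesis
    using range C(2) by (intro that[of "from_nat_into C"]) auto
qed

lemma is_separable_carries:
  assumes M: "carries M \<delta>"
  shows "is_separable M \<longleftrightarrow> separable_diversity (univ M) \<delta>"
proof -
  interpret Metric_space "univ M" "sdist M" by simp
  have "mtopology closure_of C = univ M \<longleftrightarrow> (\<forall>x\<in>univ M. \<forall>\<epsilon>>0. \<exists>c\<in>C. \<delta> {c, x} < \<epsilon>)"
    if C: "C \<subseteq> univ M" for C
  proof -
    have "\<delta> {c, x} = sdist M x c" if "c \<in> C" "x \<in> univ M" for c x
      using carries_sdist[OF M, of x c] C that by (simp add: insert_commute subset_iff)
    then have "(\<forall>\<epsilon>>0. \<exists>c\<in>C. \<delta> {c, x} < \<epsilon>) \<longleftrightarrow> x \<in> mtopology closure_of C" if "x \<in> univ M" for x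
      unfolding metric_closure_of using that C by (auto simp: in_mball subset_iff)
    moreover have "mtopology closure_of C \<subseteq> univ M"
      using closure_of_subset_topspace[of mtopology C] by simp
    ultimately show ?thesis by blast
  qed
  then have "countable C \<and> C \<subseteq> univ M \<and> mtopology closure_of C = univ M \<longleftrightarrow>
      countable C \<and> C \<subseteq> univ M \<and> (\<forall>x\<in>univ M. \<forall>\<epsilon>>0. \<exists>c\<in>C. \<delta> {c, x} < \<epsilon>)" for C
    by blast
  then show ?thesis
    unfolding is_separable_def separable_space_def separable_diversity_def mtopology_of_def
      topspace_mtopology by simp
qed

lemma extension_property_nonempty:
  assumes "extension_property X \<delta>" "pseudodiversity X \<delta>"
  shows "X \<noteq> {}"
proof -
  have "one_point_extension {} \<delta> (\<lambda>_. 0)"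
    unfolding one_point_extension_def using pseudodiversity_empty[OF assms(2)] by simp
  then have "\<exists>z\<in>X. \<forall>T\<subseteq>{}. \<delta> (insert z T) = 0"
    using assms(1)[unfolded extension_property_def, rule_format, of "{}" "\<lambda>_. 0"] by simp
  then show ?thesis by blast
qed

text \<open>
  Alternately a point of a dense sequence of \<open>X\<close> is put into the domain and a point of a dense sequence
  of \<open>Y\<close> into the range. The closure of the union has domain \<open>X\<close> and range \<open>Y\<close>.
\<close>

lemma back_and_forth:
  assumes X: "complete_diversity X \<delta>" "separable_diversity X \<delta>" "extension_property X \<delta>"
    and Y: "complete_diversity Y \<delta>'" "separable_diversity Y \<delta>'" "extension_property Y \<delta>'"
    and R: "partial_isomorphism X \<delta> Y \<delta>' R" "finite R"
  obtains g where "g ` X = Y" "\<forall>T. finite T \<and> T \<subseteq> X \<longrightarrow> \<delta>' (g ` T) = \<delta> T" "\<forall>(x, y)\<in>R. g x = y"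
proof -
  note PX = complete_diversityD(1)[OF X(1)] and sepX = complete_diversityD(2)[OF X(1)]
  note PY = complete_diversityD(1)[OF Y(1)] and sepY = complete_diversityD(2)[OF Y(1)]
  let ?iso = "partial_isomorphism X \<delta> Y \<delta>'"
  have "X \<noteq> {}" by (rule extension_property_nonempty[OF X(3) PX])
  have "Y \<noteq> {}" by (rule extension_property_nonempty[OF Y(3) PY])
  obtain xs :: "nat \<Rightarrow> _" where xs: "range xs \<subseteq> X" "\<forall>x\<in>X. \<forall>\<epsilon>>0. \<exists>k. \<delta> {xs k, x} < \<epsilon>"
    using X(2) \<open>X \<noteq> {}\<close> by (rule separable_diversity_sequence)
  obtain ys :: "nat \<Rightarrow> _" where ys: "range ys \<subseteq> Y" "\<forall>y\<in>Y. \<forall>\<epsilon>>0. \<exists>k. \<delta>' {ys k, y} < \<epsilon>"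
    using Y(2) \<open>Y \<noteq> {}\<close> by (rule separable_diversity_sequence)
  have "\<exists>\<rho>. \<forall>n :: nat. (?iso (\<rho> n) \<and> finite (\<rho> n) \<and> R \<subseteq> \<rho> n) \<and>
      (\<rho> n \<subseteq> \<rho> (Suc n) \<and> xs n \<in> fst ` \<rho> (Suc n) \<and> ys n \<in> snd ` \<rho> (Suc n))"
  proof (rule dependent_nat_choice)
    show "\<exists>S. ?iso S \<and> finite S \<and> R \<subseteq> S" using R by blast
    fix S n assume S: "?iso S \<and> finite S \<and> R \<subseteq> S"
    obtain y where y: "?iso (insert (xs n, y) S)"
      by (rule partial_isomorphism_extend[of X \<delta> Y \<delta>' S "xs n"]) (use S xs(1) PX sepX PY Y(3) in auto)
    let ?S = "insert (xs n, y) S"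
    obtain x where x: "partial_isomorphism Y \<delta>' X \<delta> (insert (ys n, x) (?S\<inverse>))"
      by (rule partial_isomorphism_extend[OF partial_isomorphism_converse[OF y], of "ys n"])
        (use S ys(1) PX sepY PY X(3) in auto)
    have "?iso (insert (x, ys n) ?S)"
    proof -
      have "(insert (ys n, x) (?S\<inverse>))\<inverse> = insert (x, ys n) ?S" by auto
      then show ?thesis using partial_isomorphism_converse[OF x] by simp
    qed
    then show "\<exists>S'. (?iso S' \<and> finite S' \<and> R \<subseteq> S') \<and> (S \<subseteq> S' \<and> xs n \<in> fst ` S' \<and> ys n \<in> snd ` S')"
      using S by (intro exI[of _ "insert (x, ys n) ?S"]) auto
  qed
  then obtain \<rho> where \<rho>: "\<forall>n :: nat. (?iso (\<rho> n) \<and> finite (\<rho> n) \<and> R \<subseteq> \<rho> n) \<and>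
      (\<rho> n \<subseteq> \<rho> (Suc n) \<and> xs n \<in> fst ` \<rho> (Suc n) \<and> ys n \<in> snd ` \<rho> (Suc n))"
    by (elim exE)
  have mono: "\<rho> m \<subseteq> \<rho> n" if "m \<le> n" for m n
    using that by (rule lift_Suc_mono_le[of \<rho>, rotated]) (use \<rho> in blast)
  define U where "U = (\<Union>n. \<rho> n)"
  have isoU: "?iso U"
    unfolding partial_isomorphism_def
  proof (intro conjI allI impI)
    show "U \<subseteq> X \<times> Y" unfolding U_def using \<rho> unfolding partial_isomorphism_def by blast
    fix Q assume Q: "finite Q \<and> Q \<subseteq> U"
    have "\<exists>n. Q \<subseteq> \<rho> n" if "finite Q" "Q \<subseteq> U" for Q
      using that
    proof (induction Q rule: finite_induct)
      case (insert q Q)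
      then obtain m where "Q \<subseteq> \<rho> m" by auto
      moreover obtain n where "q \<in> \<rho> n" using insert.prems unfolding U_def by auto
      ultimately have "insert q Q \<subseteq> \<rho> (max m n)"
        using mono[of m "max m n"] mono[of n "max m n"] by auto
      then show ?case by blast
    qed simp
    then obtain n where "Q \<subseteq> \<rho> n" using Q by blast
    moreover have "?iso (\<rho> n)" using \<rho> by blast
    ultimately show "\<delta> (fst ` Q) = \<delta>' (snd ` Q)"
      using Q by (intro partial_isomorphism_eq) auto
  qed
  define V where "V = relation_closure X \<delta> Y \<delta>' U"
  have isoV: "?iso V"
    unfolding V_def by (rule partial_isomorphism_closure[OF isoU PX PY])
  have RV: "R \<subseteq> V"
  proof -
    have "R \<subseteq> U" unfolding U_def using \<rho> by blast
    also have "U \<subseteq> V"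
      unfolding V_def using isoU PX PY by (intro relation_closure_superset) (auto simp: partial_isomorphism_def)
    finally show ?thesis .
  qed
  have memU: "xs k \<in> fst ` U" "ys k \<in> snd ` U" for k
  proof -
    have "\<rho> (Suc k) \<subseteq> U" unfolding U_def by blast
    then show "xs k \<in> fst ` U" "ys k \<in> snd ` U"
      using \<rho>[rule_format, of k] image_mono[of "\<rho> (Suc k)" U] by blast+
  qed
  have total: "\<exists>y. (x, y) \<in> V" if x: "x \<in> X" for x
  proof -
    have "\<exists>a\<in>fst ` U. \<delta> {a, x} < \<epsilon>" if "\<epsilon> > 0" for \<epsilon>
      using xs(2) memU(1) x that by blast
    then obtain y where "(x, y) \<in> V"
      unfolding V_def by (rule relation_closure_total[OF isoU PX Y(1) _ x])
    then show ?thesis by blast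
  qed
  have onto: "\<exists>x. (x, y) \<in> V" if y: "y \<in> Y" for y
  proof -
    have "\<exists>b\<in>fst ` (U\<inverse>). \<delta>' {b, y} < \<epsilon>" if \<epsilon>: "\<epsilon> > 0" for \<epsilon>
    proof -
      obtain k where "\<delta>' {ys k, y} < \<epsilon>" using ys(2) y \<epsilon> by blast
      moreover have "ys k \<in> fst ` (U\<inverse>)" using memU(2)[of k] by force
      ultimately show ?thesis by blast
    qed
    then obtain x where "(y, x) \<in> relation_closure Y \<delta>' X \<delta> (U\<inverse>)"
      by (rule relation_closure_total[OF partial_isomorphism_converse[OF isoU] PY X(1) _ y])
    then show ?thesis unfolding V_def relation_closure_converse by blast
  qed
  have VXY: "V \<subseteq> X \<times> Y" using isoV unfolding partial_isomorphism_def by blast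
  have unique: "b = b'" if "(a, b) \<in> V" "(a, b') \<in> V" for a b b'
    using partial_isomorphism_functional[OF isoV that PX sepY] .
  define g where "g = (\<lambda>x. SOME y. (x, y) \<in> V)"
  have g: "(x, g x) \<in> V" if "x \<in> X" for x
    unfolding g_def using total[OF that] by (rule someI_ex)
  have g_eq: "g x = y" if "(x, y) \<in> V" for x y
    using unique[OF g that] VXY that by blast
  show ?thesis
  proof (rule that[of g])
    show "g ` X = Y"
    proof
      show "g ` X \<subseteq> Y" using g VXY by blast
      show "Y \<subseteq> g ` X"
      proof
        fix y assume "y \<in> Y"
        then obtain x where "(x, y) \<in> V" using onto by blast
        then show "y \<in> g ` X" using g_eq VXY by blast
      qed
    qed
    show "\<forall>T. finite T \<and> T \<subseteq> X \<longrightarrow> \<delta>' (g ` T) = \<delta> T"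
    proof (intro allI impI)
      fix T assume T: "finite T \<and> T \<subseteq> X"
      let ?Q = "(\<lambda>x. (x, g x)) ` T"
      have "finite ?Q" "?Q \<subseteq> V" using T g by auto
      then have "\<delta> (fst ` ?Q) = \<delta>' (snd ` ?Q)"
        by (rule partial_isomorphism_eq[OF isoV])
      then show "\<delta>' (g ` T) = \<delta> T" by (simp add: image_image)
    qed
    show "\<forall>(x, y)\<in>R. g x = y" using RV g_eq by blast
  qed
qed

lemma partial_isomorphism_extend_finite:
  assumes R: "partial_isomorphism X \<delta> Y \<delta>' R" "finite R" and "finite F" "F \<subseteq> X"
    and P: "pseudodiversity X \<delta>" and sep: "\<And>x y. x \<in> X \<Longrightarrow> y \<in> X \<Longrightarrow> \<delta> {x, y} = 0 \<Longrightarrow> x = y"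
    and P': "pseudodiversity Y \<delta>'" and E: "extension_property Y \<delta>'"
  obtains R' where "partial_isomorphism X \<delta> Y \<delta>' R'" "R \<subseteq> R'" "F \<subseteq> fst ` R'"
proof -
  have "\<exists>R'. partial_isomorphism X \<delta> Y \<delta>' R' \<and> finite R' \<and> R \<subseteq> R' \<and> F \<subseteq> fst ` R'"
    using assms(3,4)
  proof (induction F rule: finite_induct)
    case empty
    then show ?case using R by blast
  next
    case (insert x F)
    then obtain R' where R': "partial_isomorphism X \<delta> Y \<delta>' R'" "finite R'" "R \<subseteq> R'" "F \<subseteq> fst ` R'"
      by auto
    obtain y where "partial_isomorphism X \<delta> Y \<delta>' (insert (x, y) R')"
      by (rule partial_isomorphism_extend[OF R'(1,2) _ P sep P' E, of x]) (use insert.prems in auto)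
    then show ?case using R' by (intro exI[of _ "insert (x, y) R'"]) auto
  qed
  then show ?thesis using that by blast
qed

section \<open>The limit of the class of finite diversities\<close>

text \<open>
  Every finite subset of \<open>M\<close> has a copy in the infinite type \<open>'a\<close>; the copy belongs to the class and
  provides a diversity on the subset. These diversities are all given by the predicates of \<open>M\<close>, hence they
  agree with one function \<open>\<delta>\<close> that evaluates the predicates on a fixed enumeration of each finite set.
\<close>

lemma K_structure_imp_carries:
  fixes M :: "('b, nat) mstructure"
  assumes inf: "infinite (UNIV :: 'a set)"
    and K: "K_structure Suc (finite_diversities :: ('a, nat) mstructure set) M"
  shows "\<exists>\<delta>. carries M \<delta>"
proof -
  have M: "is_structure Suc M"
    using K unfolding K_structure_def by blast
  have sub: "A \<in> finite_diversities" if "is_structure Suc A" "finite (univ A)" "embedding Suc f A M"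
    for A :: "('a, nat) mstructure" and f
    using K that unfolding K_structure_def substructure_def by blast
  have local: "\<exists>\<delta>. carries (induced M U) \<delta>" if U: "finite U" "U \<subseteq> univ M" for U
  proof -
    obtain F :: "'a set" where F: "finite F" "card F = card U"
      using inf infinite_arbitrarily_large by blast
    then obtain e :: "'b \<Rightarrow> 'a" where e: "inj_on e U"
      using card_le_inj[of U F] U(1) by auto
    define i where "i = inv_into U e"
    have ie: "i (e x) = x" if "x \<in> U" for x
      unfolding i_def using e that by simp
    have i: "i x \<in> univ M" "e (i x) = x" if "x \<in> e ` U" for x
      using that ie U(2) by auto
    interpret MM: Metric_space "univ M" "sdist M" by simp
    have met: "Metric_space (e ` U) (\<lambda>x y. sdist M (i x) (i y))"
    proof
      show "0 \<le> sdist M (i x) (i y)" for x y by simp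
      show "sdist M (i x) (i y) = sdist M (i y) (i x)" for x y by (rule MM.commute)
      show "(sdist M (i x) (i y) = 0) = (x = y)" if "x \<in> e ` U" "y \<in> e ` U" for x y
        using MM.zero[OF i(1)[OF that(1)] i(1)[OF that(2)]] i(2)[OF that(1)] i(2)[OF that(2)] by metis
      show "sdist M (i x) (i z) \<le> sdist M (i x) (i y) + sdist M (i y) (i z)"
        if "x \<in> e ` U" "y \<in> e ` U" "z \<in> e ` U" for x y z
        using i(1) that by (intro MM.triangle)
    qed
    define A :: "('a, nat) mstructure" where
      "A = \<lparr>met = metric (e ` U, \<lambda>x y. sdist M (i x) (i y)), rel = \<lambda>k xs. rel M k (map i xs)\<rparr>"
    have A: "univ A = e ` U" "sdist A = (\<lambda>x y. sdist M (i x) (i y))" "rel A = (\<lambda>k xs. rel M k (map i xs))"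
      unfolding A_def using Metric_space.mspace_metric[OF met] Metric_space.mdist_metric[OF met] by simp_all
    have tup: "map i xs \<in> tuples (univ M) n" if "xs \<in> tuples (e ` U) n" for xs n
      using that i(1) unfolding tuples_def by auto
    have emb: "embedding Suc i A M"
      unfolding embedding_def
    proof (intro conjI allI ballI)
      show "i ` univ A \<subseteq> univ M" unfolding A using i(1) by blast
      show "interp M s (map i xs) = interp A s xs" if "xs \<in> tuples (univ A) (arity Suc s)" for s xs
        using that by (cases s) (simp_all add: A tuples_def)
    qed
    have "is_structure Suc A"
      unfolding is_structure_def
    proof (intro conjI allI impI)
      show "mcomplete_of (met A)"
        by (rule mcomplete_finite) (use A(1) U(1) in simp)
      fix k :: nat and \<epsilon> :: real assume "\<epsilon> > 0"
      then have "\<exists>\<eta>>0. \<forall>xs\<in>tuples (univ M) (Suc k). \<forall>ys\<in>tuples (univ M) (Suc k).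
          (\<forall>j<Suc k. sdist M (xs ! j) (ys ! j) < \<eta>) \<longrightarrow> \<bar>rel M k xs - rel M k ys\<bar> < \<epsilon>"
        using M[unfolded is_structure_def, THEN conjunct2, rule_format, of \<epsilon> k] by simp
      then obtain \<eta> where \<eta>: "\<eta> > 0" "\<forall>xs\<in>tuples (univ M) (Suc k). \<forall>ys\<in>tuples (univ M) (Suc k).
          (\<forall>j<Suc k. sdist M (xs ! j) (ys ! j) < \<eta>) \<longrightarrow> \<bar>rel M k xs - rel M k ys\<bar> < \<epsilon>"
        by blast
      have "\<bar>rel A k xs - rel A k ys\<bar> < \<epsilon>"
        if t: "xs \<in> tuples (univ A) (Suc k)" "ys \<in> tuples (univ A) (Suc k)"
          and near: "\<forall>j<Suc k. sdist A (xs ! j) (ys ! j) < \<eta>" for xs ys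
      proof -
        have len: "length xs = Suc k" "length ys = Suc k" using t by (simp_all add: tuples_def)
        have "\<forall>j<Suc k. sdist M (map i xs ! j) (map i ys ! j) < \<eta>"
          using near len by (simp add: A)
        then show ?thesis
          using \<eta>(2) tup[of xs] tup[of ys] t by (simp add: A)
      qed
      then show "\<exists>\<eta>>0. \<forall>xs\<in>tuples (univ A) (Suc k). \<forall>ys\<in>tuples (univ A) (Suc k).
          (\<forall>j<Suc k. sdist A (xs ! j) (ys ! j) < \<eta>) \<longrightarrow> \<bar>rel A k xs - rel A k ys\<bar> < \<epsilon>"
        using \<eta>(1) by blast
    qed
    then have "A \<in> finite_diversities"
      using sub emb A(1) U(1) by simp
    then obtain \<alpha> where \<alpha>: "carries A \<alpha>" unfolding finite_diversities_carries by blast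
    have "embedding Suc e (induced M U) A"
      unfolding embedding_def
    proof (intro conjI allI ballI)
      show "e ` univ (induced M U) \<subseteq> univ A" unfolding A by auto
      fix s xs assume xs: "xs \<in> tuples (univ (induced M U)) (arity Suc s)"
      then have "map i (map e xs) = xs"
        using ie by (simp add: tuples_def map_idI subset_iff)
      moreover have "i (e (xs ! j)) = xs ! j" if "j < length xs" for j
        using xs ie nth_mem[OF that] by (auto simp: tuples_def)
      ultimately show "interp A s (map e xs) = interp (induced M U) s xs"
        using xs by (cases s) (simp_all add: A tuples_def)
    qed
    then have "carries (induced M U) (\<lambda>T. \<alpha> (e ` T))" using \<alpha> by (rule carries_pullback)
    then show ?thesis by blast
  qed
  define enum :: "'b set \<Rightarrow> 'b list" where "enum = (\<lambda>S. SOME xs. set xs = S \<and> distinct xs)"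
  have enum: "set (enum S) = S \<and> distinct (enum S)" if "finite S" for S
    unfolding enum_def using finite_distinct_list[OF that] by (rule someI_ex)
  define \<delta> where "\<delta> = (\<lambda>S. if S = {} then 0 else rel M (card S - 1) (enum S))"
  have eq: "\<delta> T = \<delta>' T" if \<delta>': "carries (induced M U) \<delta>'" and U: "finite U" "U \<subseteq> univ M" "T \<subseteq> U"
    for U T \<delta>'
  proof (cases "T = {}")
    case True
    then show ?thesis
      unfolding \<delta>_def using pseudodiversity_empty[OF carries_pseudodiversity[OF \<delta>']] by simp
  next
    case False
    have T: "finite T" using U finite_subset by blast
    have "length (enum T) = card T" using enum[OF T] distinct_card by metis
    moreover have "card T \<noteq> 0" using T False by simp
    ultimately have "enum T \<in> tuples (univ (induced M U)) (Suc (card T - 1))"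
      using enum[OF T] U unfolding tuples_def by auto
    then show ?thesis
      unfolding \<delta>_def using carries_rel[OF \<delta>', of "enum T" "card T - 1"] enum[OF T] False by simp
  qed
  have "carries M \<delta>"
  proof (rule carriesI)
    show "pseudodiversity (univ M) \<delta>"
    proof (rule pseudodiversity_finite_subsets)
      fix F assume F: "finite F" "F \<subseteq> univ M"
      obtain \<delta>' where \<delta>': "carries (induced M F) \<delta>'" using local[OF F] by blast
      have "univ (induced M F) = F" using F by auto
      then have "pseudodiversity F \<delta>'" using carries_pseudodiversity[OF \<delta>'] by simp
      then show "pseudodiversity F \<delta>"
        by (rule pseudodiversity_cong) (rule eq[OF \<delta>' F])
    qed
    show "sdist M x y = \<delta> {x, y}" if "x \<in> univ M" "y \<in> univ M" for x y
    proof -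
      have F: "finite {x, y}" "{x, y} \<subseteq> univ M" using that by auto
      obtain \<delta>' where \<delta>': "carries (induced M {x, y}) \<delta>'" using local[OF F] by blast
      have "sdist M x y = \<delta>' {x, y}"
        using carries_sdist[OF \<delta>', of x y] that by simp
      then show ?thesis using eq[OF \<delta>' F order_refl] by simp
    qed
    show "rel M k xs = \<delta> (set xs)" if "xs \<in> tuples (univ M) (Suc k)" for k xs
    proof -
      have F: "finite (set xs)" "set xs \<subseteq> univ M" using that by (auto simp: tuples_def)
      obtain \<delta>' where \<delta>': "carries (induced M (set xs)) \<delta>'" using local[OF F] by blast
      have "rel M k xs = \<delta>' (set xs)"
        using carries_rel[OF \<delta>', of xs k] that by (simp add: tuples_def)
      then show ?thesis using eq[OF \<delta>' F order_refl] by simp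
    qed
  qed
  then show ?thesis by blast
qed

text \<open>
  The points of \<open>S\<close> together with the new point form a finite member \<open>A\<close> of the class, after identification
  of points at distance zero. The inclusion of \<open>S\<close> is an embedding of a part of \<open>A\<close>; an embedding of all of
  \<open>A\<close> that nearly extends it sends the new point to the required \<open>z\<close>.
\<close>

lemma fraisse_limit_approximate_extension:
  fixes N :: "('b, nat) mstructure"
  assumes inf: "infinite (UNIV :: 'a set)"
    and N: "fraisse_limit Suc (finite_diversities :: ('a, nat) mstructure set) N"
    and \<delta>: "carries N \<delta>"
  shows "approximate_extension_property (univ N) \<delta>"
  unfolding approximate_extension_property_def
proof (intro allI impI)
  note P = carries_pseudodiversity[OF \<delta>]
  fix S \<phi> and \<epsilon> :: real
  assume "finite S \<and> S \<subseteq> univ N \<and> one_point_extension S \<delta> \<phi> \<and> 0 < \<epsilon>"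
  then have S: "finite S" "S \<subseteq> univ N" and E: "one_point_extension S \<delta> \<phi>" and "0 < \<epsilon>" by auto
  let ?I = "insert None (Some ` S)"
  obtain \<Delta> where \<Delta>: "pseudodiversity ?I \<Delta>" "\<forall>T. \<Delta> (Some ` T) = \<delta> T"
    "\<forall>T. \<Delta> (insert None (Some ` T)) = \<phi> T"
    by (rule one_point_extension_realized[OF pseudodiversity_subset[OF P S(2)] S(1) E])
  have finI: "finite ?I" using S(1) by simp
  obtain A :: "('a, nat) mstructure" and \<alpha> p where A: "A \<in> finite_diversities" "carries A \<alpha>"
    "p ` ?I = univ A" "\<forall>T\<subseteq>?I. \<alpha> (p ` T) = \<Delta> T"
    by (rule finite_structure_exists[OF inf finI \<Delta>(1)])
  have pA: "p i \<in> univ A" if "i \<in> ?I" for i using A(3) that by blast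
  obtain ss where ss: "set ss = S" using finite_list[OF S(1)] by blast
  define as where "as = map (\<lambda>s. p (Some s)) ss"
  have as: "set as \<subseteq> univ A" unfolding as_def using ss pA by auto
  have ss_mem: "ss ! j \<in> S" if "j < length as" for j
    using that ss nth_mem[of j ss] unfolding as_def by simp
  have "\<delta> ((!) ss ` T) = \<alpha> ((!) as ` T)" if T: "T \<subseteq> {..<length as}" for T
  proof -
    have "(!) as ` T = p ` Some ` (!) ss ` T"
      unfolding image_image using T by (intro image_cong) (auto simp: as_def)
    moreover have "Some ` (!) ss ` T \<subseteq> ?I" using ss_mem T by auto
    ultimately show ?thesis using A(4) \<Delta>(2) by simp
  qed
  then obtain h where h: "enum_embedding Suc h (A, as) N" "\<forall>j<length as. h (as ! j) = ss ! j"
    by (rule enum_embedding_nth[OF A(2) \<delta> as, of "(!) ss", rotated]) (use ss_mem S(2) in blast)+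
  have h_p: "h (p (Some s)) = s" if s: "s \<in> S" for s
  proof -
    obtain j where "j < length ss" "ss ! j = s" using s ss by (auto simp: in_set_conv_nth)
    then show ?thesis using h(2) unfolding as_def by auto
  qed
  define \<eta> where "\<eta> = \<epsilon> / (2 * (real (card S) + 1))"
  have \<eta>: "0 < \<eta>" unfolding \<eta>_def using \<open>0 < \<epsilon>\<close> by simp
  have "finite (univ A)" using A(1) unfolding finite_diversities_carries by blast
  moreover have "K_structure Suc (finite_diversities :: ('a, nat) mstructure set) A"
    using HP_finite_diversities A(1) unfolding HP_def by blast
  ultimately have "\<exists>f. embedding Suc f A N \<and> (\<forall>x\<in>set as. sdist N (f x) (h x) < \<eta>)"
    using N[unfolded fraisse_limit_def] as h(1) \<eta> by blast
  then obtain f where f: "embedding Suc f A N" "\<forall>x\<in>set as. sdist N (f x) (h x) < \<eta>" by blast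
  have f': "f ` univ A \<subseteq> univ N" "\<And>T. finite T \<Longrightarrow> T \<subseteq> univ A \<Longrightarrow> \<delta> (f ` T) = \<alpha> T"
    using f(1) unfolding embedding_iff[OF A(2) \<delta>] by auto
  define z where "z = f (p None)"
  have z: "z \<in> univ N" unfolding z_def using f'(1) pA by blast
  let ?g = "\<lambda>s. f (p (Some s))"
  have gN: "?g s \<in> univ N" if "s \<in> S" for s using f'(1) pA that by blast
  have near: "\<delta> {?g s, s} \<le> \<eta>" if s: "s \<in> S" for s
  proof -
    have "p (Some s) \<in> set as" unfolding as_def using s ss by auto
    then have "sdist N (?g s) s < \<eta>" using f(2) h_p[OF s] by force
    then show ?thesis using carries_sdist[OF \<delta> gN[OF s]] S(2) s by auto
  qed
  have "\<bar>\<delta> (insert z T) - \<phi> T\<bar> < \<epsilon>" if T: "T \<subseteq> S" for T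
  proof -
    have finT: "finite T" using T S(1) finite_subset by blast
    let ?X = "?g ` T \<union> T"
    have X: "?X \<subseteq> univ N" "finite ?X" using gN T S(2) finT by auto
    have "\<bar>\<delta> (insert z (?g ` T)) - \<delta> (insert z ((\<lambda>t. t) ` T))\<bar> \<le> (real (card T) + 1) * \<eta>"
      by (rule one_point_extension_lipschitz[OF pseudodiversity_subset[OF P X(1)] X(2)
            one_point_extension_of_point[OF P X(2,1) z] finT]) (use \<eta> near T in auto)
    also have "\<dots> \<le> (real (card S) + 1) * \<eta>"
      using \<eta> T S(1) by (intro mult_right_mono) (simp_all add: card_mono)
    also have "\<dots> = \<epsilon> / 2"
    proof -
      have "real (card S) + 1 \<noteq> 0" by linarith
      then show ?thesis unfolding \<eta>_def by (simp add: field_simps)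
    qed
    finally have "\<bar>\<delta> (insert z (?g ` T)) - \<delta> (insert z T)\<bar> \<le> \<epsilon> / 2" by simp
    moreover have "\<delta> (insert z (?g ` T)) = \<phi> T"
    proof -
      let ?U = "insert None (Some ` T)"
      have U: "?U \<subseteq> ?I" "finite ?U" using T finT by auto
      have "insert z (?g ` T) = f ` p ` ?U" unfolding z_def by (simp add: image_image)
      moreover have "p ` ?U \<subseteq> univ A" using A(3) U(1) by blast
      ultimately have "\<delta> (insert z (?g ` T)) = \<alpha> (p ` ?U)"
        using f'(2)[of "p ` ?U"] U(2) by simp
      also have "\<dots> = \<Delta> ?U" using A(4) U(1) by blast
      also have "\<dots> = \<phi> T" using \<Delta>(3) by blast
      finally show ?thesis .
    qed
    ultimately show ?thesis using \<open>0 < \<epsilon>\<close> by (simp add: abs_minus_commute)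
  qed
  then show "\<exists>z\<in>univ N. \<forall>T\<subseteq>S. \<bar>\<delta> (insert z T) - \<phi> T\<bar> < \<epsilon>" using z by blast
qed

lemma embedding_partial_isomorphism:
  assumes \<beta>: "carries B \<beta>" and \<delta>: "carries M \<delta>" and S: "S \<subseteq> univ B"
    and h: "h ` S \<subseteq> univ M" "\<And>T. finite T \<Longrightarrow> T \<subseteq> S \<Longrightarrow> \<delta> (h ` T) = \<beta> T"
  shows "partial_isomorphism (univ B) \<beta> (univ M) \<delta> ((\<lambda>x. (x, h x)) ` S)"
  unfolding partial_isomorphism_def
proof (intro conjI allI impI)
  show "(\<lambda>x. (x, h x)) ` S \<subseteq> univ B \<times> univ M" using S h(1) by auto
  fix Q assume Q: "finite Q \<and> Q \<subseteq> (\<lambda>x. (x, h x)) ` S"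
  then have "snd ` Q = h ` fst ` Q" "fst ` Q \<subseteq> S"
    unfolding image_image by (auto intro!: image_cong)
  then show "\<beta> (fst ` Q) = \<delta> (snd ` Q)" using h(2)[of "fst ` Q"] Q by simp
qed

text \<open>
  Adding the remaining points of \<open>B\<close> one at a time even extends the given embedding exactly.
\<close>

lemma fraisse_limit_of_extension_property:
  fixes M :: "('b, nat) mstructure"
  assumes \<delta>: "carries M \<delta>" and "mcomplete_of (met M)" and "is_separable M"
    and E: "extension_property (univ M) \<delta>"
  shows "fraisse_limit Suc (finite_diversities :: ('a, nat) mstructure set) M"
  unfolding fraisse_limit_def
proof (intro conjI allI impI)
  let ?K = "finite_diversities :: ('a, nat) mstructure set"
  show "K_structure Suc ?K M" by (rule K_structure_carries[OF \<delta> assms(2)])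
  show "is_separable M" by (rule assms(3))
  fix B :: "('a, nat) mstructure" and as h and \<epsilon> :: real
  assume H: "finite (univ B) \<and> K_structure Suc ?K B \<and> set as \<subseteq> univ B \<and>
    enum_embedding Suc h (B, as) M \<and> 0 < \<epsilon>"
  have "embedding Suc id B B" unfolding embedding_def by simp
  then have "B \<in> ?K"
    using H unfolding K_structure_def substructure_def by blast
  then obtain \<beta> where \<beta>: "carries B \<beta>" unfolding finite_diversities_carries by blast
  have as: "set as \<subseteq> univ B" using H by blast
  have h: "h ` set as \<subseteq> univ M" "\<forall>T\<subseteq>set as. \<delta> (h ` T) = \<beta> T"
    using H unfolding enum_embedding_iff[OF \<beta> \<delta> as] by auto
  let ?R = "(\<lambda>x. (x, h x)) ` set as"
  have R: "partial_isomorphism (univ B) \<beta> (univ M) \<delta> ?R"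
    by (rule embedding_partial_isomorphism[OF \<beta> \<delta> as h(1)]) (use h(2) in blast)
  note PB = carries_pseudodiversity[OF \<beta>] and PM = carries_pseudodiversity[OF \<delta>]
  have finR: "finite ?R" "finite (univ B)" using H by auto
  obtain R' where R': "partial_isomorphism (univ B) \<beta> (univ M) \<delta> R'" "?R \<subseteq> R'" "univ B \<subseteq> fst ` R'"
    by (rule partial_isomorphism_extend_finite[OF R finR order_refl PB carries_zero[OF \<beta>] PM E])
  define f where "f = (\<lambda>x. SOME y. (x, y) \<in> R')"
  have f: "(x, f x) \<in> R'" if "x \<in> univ B" for x
    unfolding f_def using that R'(3) by (intro someI_ex[of "\<lambda>y. (x, y) \<in> R'"]) fastforce
  have "embedding Suc f B M"
    unfolding embedding_iff[OF \<beta> \<delta>]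
  proof (intro conjI allI impI)
    show "f ` univ B \<subseteq> univ M" using f R'(1) unfolding partial_isomorphism_def by blast
    fix T assume T: "finite T \<and> T \<subseteq> univ B"
    have "\<beta> (fst ` (\<lambda>x. (x, f x)) ` T) = \<delta> (snd ` (\<lambda>x. (x, f x)) ` T)"
      using T f by (intro partial_isomorphism_eq[OF R'(1)]) auto
    then show "\<delta> (f ` T) = \<beta> T" by (simp add: image_image)
  qed
  moreover have "sdist M (f x) (h x) < \<epsilon>" if "x \<in> set as" for x
  proof -
    have "(x, h x) \<in> R'" using that R'(2) by blast
    then have "f x = h x"
      using partial_isomorphism_functional[OF R'(1) f _ PB carries_zero[OF \<delta>]] that as by blast
    moreover have "h x \<in> univ M" using h(1) that by blast
    then have "sdist M (h x) (h x) = 0" by simp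
    ultimately show ?thesis using H by simp
  qed
  ultimately show "\<exists>f. embedding Suc f B M \<and> (\<forall>x\<in>set as. sdist M (f x) (h x) < \<epsilon>)" by blast
qed

lemma universal_diversity_structure:
  obtains M :: "(nat \<Rightarrow> real, nat) mstructure" and \<delta> where
    "carries M \<delta>" "mcomplete_of (met M)" "is_separable M" "extension_property (univ M) \<delta>"
proof -
  obtain X :: "nat set" and \<delta> where X: "pseudodiversity X \<delta>"
    "\<forall>x\<in>X. \<forall>y\<in>X. \<delta> {x, y} = 0 \<longrightarrow> x = y" "approximate_extension_property X \<delta>"
    using countable_universal_diversity by blast
  have sep: "x = y" if "x \<in> X" "y \<in> X" "\<delta> {x, y} = 0" for x y using X(2) that by blast
  obtain m :: "(nat \<Rightarrow> real) metric" and \<delta>' f where m: "mcomplete_of m" "pseudodiversity (mspace m) \<delta>'"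
    "\<forall>x\<in>mspace m. \<forall>y\<in>mspace m. mdist m x y = \<delta>' {x, y}" "f ` X \<subseteq> mspace m"
    "\<forall>T. finite T \<and> T \<subseteq> X \<longrightarrow> \<delta>' (f ` T) = \<delta> T"
    "\<forall>x\<in>mspace m. \<forall>\<epsilon>>0. \<exists>a\<in>X. mdist m (f a) x < \<epsilon>"
    by (rule diversity_completion[OF X(1) sep])
  define M where "M = structure_of m \<delta>'"
  have univ: "univ M = mspace m" "met M = m" unfolding M_def structure_of_def by simp_all
  have M: "carries M \<delta>'"
    unfolding M_def using m(3) by (intro carries_structure_of m(2)) blast
  have dense: "\<exists>a\<in>X. \<delta>' {f a, y} < \<epsilon>" if "y \<in> mspace m" "0 < \<epsilon>" for y \<epsilon>
  proof -
    have "\<exists>a\<in>X. mdist m (f a) y < \<epsilon>" using m(6) that by blast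
    moreover have "mdist m (f a) y = \<delta>' {f a, y}" if "a \<in> X" for a
      using m(3,4) that \<open>y \<in> mspace m\<close> by blast
    ultimately show ?thesis by force
  qed
  have "approximate_extension_property (mspace m) \<delta>'"
    by (rule approximate_extension_property_dense[OF m(2,4) _ dense X(3)]) (use m(5) in simp_all)
  moreover have "complete_diversity (mspace m) \<delta>'"
    using carries_complete_diversity[OF M] m(1) univ by simp
  ultimately have "extension_property (univ M) \<delta>'"
    unfolding univ by (intro extension_property_complete)
  moreover have "is_separable M"
    unfolding is_separable_carries[OF M] separable_diversity_def univ(1)
  proof (intro exI[of _ "f ` X"] conjI ballI allI impI)
    show "countable (f ` X)" by (rule countable_image) (rule countableI_type)
    show "f ` X \<subseteq> mspace m" by (rule m(4))
    show "\<exists>c\<in>f ` X. \<delta>' {c, x} < \<epsilon>" if "x \<in> mspace m" "0 < \<epsilon>" for x \<epsilon>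
      using dense[OF that] by blast
  qed
  ultimately show ?thesis
    using M m(1) univ by (intro that[of M \<delta>']) simp_all
qed

theorem theorem24:
  fixes K :: "('a, nat) mstructure set"
  assumes "infinite (UNIV :: 'a set)"
    and "K = finite_diversities"
  shows "HP Suc K \<and> JEP Suc K \<and> bAP Suc K \<and> PP Suc K \<and> CP Suc K \<and>
    fraisse_class Suc K \<and>
    (\<exists>M :: (nat \<Rightarrow> real, nat) mstructure.
       fraisse_limit Suc K M \<and> ultrahomogeneous Suc M \<and>
       (\<forall>N :: ('b, nat) mstructure. fraisse_limit Suc K N \<longrightarrow> isomorphic Suc M N))"
proof -
  note inf = assms(1)
  have properties: "HP Suc K" "JEP Suc K" "AP Suc K" "bAP Suc K" "PP Suc K" "CP Suc K"
    unfolding assms(2)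
    by (rule HP_finite_diversities JEP_finite_diversities[OF inf] AP_finite_diversities[OF inf]
        bAP_finite_diversities[OF inf] PP_finite_diversities[OF inf] CP_finite_diversities[OF inf])+
  obtain M :: "(nat \<Rightarrow> real, nat) mstructure" and \<delta> where
    M: "carries M \<delta>" "mcomplete_of (met M)" "is_separable M" "extension_property (univ M) \<delta>"
    by (rule universal_diversity_structure)
  have cM: "complete_diversity (univ M) \<delta>" "separable_diversity (univ M) \<delta>"
    using carries_complete_diversity[OF M(1,2)] M(3) is_separable_carries[OF M(1)] by auto
  have limit: "fraisse_limit Suc K M"
    unfolding assms(2) by (rule fraisse_limit_of_extension_property[OF M])
  have homogeneous: "ultrahomogeneous Suc M"
    unfolding ultrahomogeneous_def
  proof (intro conjI allI impI)
    show "is_structure Suc M" by (rule is_structure_carries[OF M(1,2)])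
    show "is_separable M" by (rule M(3))
    fix S h assume H: "finite S \<and> S \<subseteq> univ M \<and> embedding Suc h (induced M S) M"
    then have univS: "univ (induced M S) = S" by auto
    have h: "h ` S \<subseteq> univ M" "\<And>T. finite T \<Longrightarrow> T \<subseteq> S \<Longrightarrow> \<delta> (h ` T) = \<delta> T"
      using H embedding_iff[OF carries_induced[OF M(1)] M(1), of h S] unfolding univS by auto
    let ?R = "(\<lambda>x. (x, h x)) ` S"
    have R: "partial_isomorphism (univ M) \<delta> (univ M) \<delta> ?R" "finite ?R"
      using H by (auto intro: embedding_partial_isomorphism[OF M(1) M(1) _ h])
    obtain g where g: "g ` univ M = univ M" "\<forall>T. finite T \<and> T \<subseteq> univ M \<longrightarrow> \<delta> (g ` T) = \<delta> T"
      "\<forall>(x, y)\<in>?R. g x = y"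
      by (rule back_and_forth[OF cM M(4) cM M(4) R])
    have "automorphism Suc g M"
      unfolding isomorphism_def embedding_iff[OF M(1) M(1)] using g(1,2) by simp
    moreover have "\<forall>x\<in>S. g x = h x" using g(3) by simp
    ultimately show "\<exists>g. automorphism Suc g M \<and> (\<forall>x\<in>S. g x = h x)" by blast
  qed
  have unique: "isomorphic Suc M N" if N: "fraisse_limit Suc K N" for N :: "('b, nat) mstructure"
  proof -
    have KN: "K_structure Suc K N" "is_separable N" using N unfolding fraisse_limit_def by blast+
    obtain \<nu> where \<nu>: "carries N \<nu>"
      using K_structure_imp_carries[OF inf KN(1)[unfolded assms(2)]] by blast
    have "mcomplete_of (met N)" using KN(1) unfolding K_structure_def is_structure_def by blast
    then have cN: "complete_diversity (univ N) \<nu>" "separable_diversity (univ N) \<nu>"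
      using carries_complete_diversity[OF \<nu>] KN(2) is_separable_carries[OF \<nu>] by auto
    have EN: "extension_property (univ N) \<nu>"
      by (rule extension_property_complete[OF cN(1)
            fraisse_limit_approximate_extension[OF inf N[unfolded assms(2)] \<nu>]])
    have "\<delta> {} = \<nu> {}"
      using carries_pseudodiversity[OF M(1)] carries_pseudodiversity[OF \<nu>] by (simp add: pseudodiversity_empty)
    then have R: "partial_isomorphism (univ M) \<delta> (univ N) \<nu> {}" "finite {}"
      unfolding partial_isomorphism_def by auto
    obtain g where g: "g ` univ M = univ N" "\<forall>T. finite T \<and> T \<subseteq> univ M \<longrightarrow> \<nu> (g ` T) = \<delta> T"
      "\<forall>(x, y)\<in>{}. g x = y"
      by (rule back_and_forth[OF cM M(4) cN EN R])
    have "isomorphism Suc g M N"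
      unfolding isomorphism_def embedding_iff[OF M(1) \<nu>] using g(1,2) by simp
    then show ?thesis unfolding isomorphic_def by blast
  qed
  show ?thesis
    using properties limit homogeneous unique unfolding fraisse_class_def by blast
qed

end
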